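(* Let $\lambda$ be a partition of $n$ with all parts of size at least $2$, and let $\lambda'$ be the partition of $n+r$ obtained from $\lambda$ by adding $r$ parts of size $1$. Then for any composition $\alpha=(\alpha_1,\ldots,\alpha_k)$ of $m\le n+r$ of length $k$, $$\#\mathcal S^{\alpha}_{\lambda'}=\sum_{p=0}^{m-k}\left(\frac{n+p}{n}\binom{n+m+r-p}{n+m}+\frac{m-p}{n}\binom{n+m+r-p-1}{n+m}\right)\binom{m-k}{p}\,\#\mathcal S_\lambda^{(m-k-p+1,1^{k-1})}.$$ Equivalently, in terms of separation probabilities, $$\sigma^{\alpha}_{\lambda'}=\frac{n!}{\binom{n+r}{\alpha_1,\ldots,\alpha_k,n+r-m}\binom{n+r}{r}}\sum_{p=0}^{m-k}\frac{\left(\frac{n+p}{n}\binom{n+m+r-p}{n+m}+\frac{m-p}{n}\binom{n+m+r-p-1}{n+m}\right)\binom{m-k}{p}}{(n-m+p)!\,(m-k-p+1)!}\,\sigma_\lambda^{(m-k-p+1,1^{k-1})}.$$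
   Context: Permutations are composed as functions: $(\pi\circ\rho)(i)=\pi(\rho(i))$. For a composition $\beta=(\beta_1,\ldots,\beta_j)$ of size at most $N$, $\mathcal A_N^\beta$ is the set of tuples $A=(A_1,\ldots,A_j)$ of pairwise disjoint subsets of $[N]$ with $\#A_i=\beta_i$; a permutation is $A$-separated if no cycle of it contains elements of more than one set $A_i$. For a partition $\mu\vdash N$, $\mathcal S_\mu^\beta$ is the set of pairs $(\pi,A)$ with $\pi$ a permutation of $[N]$ of cycle type $\mu$ and $A\in\mathcal A_N^\beta$ such that $\pi\circ(1,2,\ldots,N)$ is $A$-separated; $\sigma_\mu^\beta$ is the probability that the product of a uniformly random permutation of cycle type $\mu$ with a uniformly random $N$-cycle is $A$-separated for a fixed $A\in\mathcal A_N^\beta$. $(m-k-p+1,1^{k-1})$ denotes the composition with first part $m-k-p+1$ followed by $k-1$ parts equal to $1$. *)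

theory Defs
  imports "HOL-Probability.Probability" "HOL-Combinatorics.Cycles" "HOL-Combinatorics.Orbits"
begin

text \<open>
  Partitions are multisets of positive naturals, compositions are lists of positive naturals.
  A permutation of [N] is a function \<open>\<pi>\<close> with \<open>\<pi> permutes {1..N}\<close>; its cycles, fixed
  points included, are the sets \<open>orbit \<pi> x\<close> for x in [N].
\<close>

definition cycle_sets :: "nat \<Rightarrow> (nat \<Rightarrow> nat) \<Rightarrow> nat set set" where
  "cycle_sets N \<pi> = orbit \<pi> ` {1..N}"

definition cycle_type :: "nat \<Rightarrow> (nat \<Rightarrow> nat) \<Rightarrow> nat multiset" where
  "cycle_type N \<pi> = image_mset card (mset_set (cycle_sets N \<pi>))"

definition perms_of_type :: "nat multiset \<Rightarrow> (nat \<Rightarrow> nat) set" where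
  "perms_of_type \<mu> =
     {\<pi>. \<pi> permutes {1..sum_mset \<mu>} \<and> cycle_type (sum_mset \<mu>) \<pi> = \<mu>}"

definition disjoint_tuples :: "nat \<Rightarrow> nat list \<Rightarrow> nat set list set" where
  "disjoint_tuples N \<beta> = {A. length A = length \<beta>
     \<and> (\<forall>i < length \<beta>. A ! i \<subseteq> {1..N} \<and> card (A ! i) = \<beta> ! i)
     \<and> (\<forall>i < length \<beta>. \<forall>j < length \<beta>. i \<noteq> j \<longrightarrow> A ! i \<inter> A ! j = {})}"

definition cycle_separated :: "nat \<Rightarrow> nat set list \<Rightarrow> (nat \<Rightarrow> nat) \<Rightarrow> bool" where
  "cycle_separated N A \<pi> \<longleftrightarrow> (\<forall>c \<in> cycle_sets N \<pi>. \<forall>i < length A. \<forall>j < length A.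
     c \<inter> A ! i \<noteq> {} \<longrightarrow> c \<inter> A ! j \<noteq> {} \<longrightarrow> i = j)"

text \<open>\<open>cycle_of_list [1..<Suc N]\<close> is the long cycle (1,2,...,N), sending 1 to 2.\<close>

definition separated_pairs ::
    "nat multiset \<Rightarrow> nat list \<Rightarrow> ((nat \<Rightarrow> nat) \<times> nat set list) set" where
  "separated_pairs \<mu> \<beta> = {(\<pi>, A). \<pi> \<in> perms_of_type \<mu> \<and> A \<in> disjoint_tuples (sum_mset \<mu>) \<beta>
     \<and> cycle_separated (sum_mset \<mu>) A (\<pi> \<circ> cycle_of_list [1..<Suc (sum_mset \<mu>)])}"

definition sep_prob_at :: "nat multiset \<Rightarrow> nat set list \<Rightarrow> real" where
  "sep_prob_at \<mu> A = measure_pmf.prob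
     (pair_pmf (pmf_of_set (perms_of_type \<mu>)) (pmf_of_set (perms_of_type {#sum_mset \<mu>#})))
     {(\<pi>, \<rho>). cycle_separated (sum_mset \<mu>) A (\<pi> \<circ> \<rho>)}"

text \<open>
  The probability does not depend on the fixed tuple A, see \<open>sep_prob_eq\<close> below.
  If the size of \<open>\<beta>\<close> exceeds that of \<open>\<mu>\<close>, there is no such tuple and the value is unspecified.
\<close>

definition sep_prob :: "nat multiset \<Rightarrow> nat list \<Rightarrow> real" where
  "sep_prob \<mu> \<beta> = sep_prob_at \<mu> (SOME A. A \<in> disjoint_tuples (sum_mset \<mu>) \<beta>)"

text \<open>The reciprocal of z!, with the usual convention that it vanishes for negative z.\<close>

definition inv_fact :: "int \<Rightarrow> real" where
  "inv_fact z = (if z < 0 then 0 else 1 / fact (nat z))"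

lemma orbit_conj:
  assumes "bij \<tau>"
  shows "orbit (\<tau> \<circ> f \<circ> inv \<tau>) (\<tau> x) = \<tau> ` orbit f x"
proof -
  have inv: "inv \<tau> (\<tau> y) = y" for y
    using assms by (simp add: bij_is_inj)
  have "((\<tau> \<circ> f \<circ> inv \<tau>) ^^ k) (\<tau> x) = \<tau> ((f ^^ k) x)" for k
    by (induction k) (simp_all add: inv)
  then show ?thesis
    by (auto simp: orbit_altdef)
qed

lemma cycle_sets_conj:
  assumes "\<tau> permutes {1..N}"
  shows "cycle_sets N (\<tau> \<circ> f \<circ> inv \<tau>) = (`) \<tau> ` cycle_sets N f"
proof -
  have "cycle_sets N (\<tau> \<circ> f \<circ> inv \<tau>) = orbit (\<tau> \<circ> f \<circ> inv \<tau>) ` (\<tau> ` {1..N})"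
    using permutes_image[OF assms] by (simp add: cycle_sets_def)
  also have "\<dots> = (`) \<tau> ` cycle_sets N f"
    unfolding cycle_sets_def image_image using orbit_conj[OF permutes_bij[OF assms]] by simp
  finally show ?thesis .
qed

lemma cycle_type_conj:
  assumes "\<tau> permutes {1..N}"
  shows "cycle_type N (\<tau> \<circ> f \<circ> inv \<tau>) = cycle_type N f"
proof -
  have inj: "inj \<tau>" using permutes_inj[OF assms] .
  have "mset_set ((`) \<tau> ` cycle_sets N f) = image_mset ((`) \<tau>) (mset_set (cycle_sets N f))"
    by (rule image_mset_mset_set[symmetric]) (meson inj inj_image_eq_iff inj_onI)
  moreover have "card (\<tau> ` c) = card c" for c
    by (rule card_image) (meson inj inj_on_subset subset_UNIV)
  ultimately show ?thesis
    unfolding cycle_type_def cycle_sets_conj[OF assms] by (simp add: multiset.map_comp comp_def)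
qed

lemma perms_of_type_conj:
  assumes "\<tau> permutes {1..sum_mset \<mu>}"
  shows "bij_betw (\<lambda>\<pi>. \<tau> \<circ> \<pi> \<circ> inv \<tau>) (perms_of_type \<mu>) (perms_of_type \<mu>)"
proof -
  have closed: "\<sigma> \<circ> \<pi> \<circ> inv \<sigma> \<in> perms_of_type \<mu>"
    if "\<sigma> permutes {1..sum_mset \<mu>}" "\<pi> \<in> perms_of_type \<mu>" for \<sigma> \<pi>
    using that by (auto simp: perms_of_type_def cycle_type_conj
        intro!: permutes_compose permutes_inv)
  have b: "bij \<tau>" and i: "inv \<tau> permutes {1..sum_mset \<mu>}"
    using assms by (auto intro: permutes_bij permutes_inv)
  have invinv: "inv (inv \<tau>) = \<tau>"
    using b by (simp add: inv_inv_eq)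
  have c1: "inv \<tau> (\<tau> x) = x" and c2: "\<tau> (inv \<tau> x) = x" for x
    using assms by (simp_all add: permutes_inverses)
  show ?thesis
  proof (rule bij_betw_byWitness[where f' = "\<lambda>\<pi>. inv \<tau> \<circ> \<pi> \<circ> \<tau>"])
    show "(\<lambda>\<pi>. inv \<tau> \<circ> \<pi> \<circ> \<tau>) ` perms_of_type \<mu> \<subseteq> perms_of_type \<mu>"
      using closed[OF i] by (auto simp: invinv)
  qed (use closed[OF assms] in \<open>auto simp: fun_eq_iff c1 c2\<close>)
qed

lemma cycle_separated_conj:
  assumes "\<tau> permutes {1..N}" "length B = length A" "\<And>i. i < length A \<Longrightarrow> B ! i = \<tau> ` (A ! i)"
  shows "cycle_separated N B (\<tau> \<circ> f \<circ> inv \<tau>) \<longleftrightarrow> cycle_separated N A f"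
proof -
  have inj: "inj \<tau>" using permutes_inj[OF assms(1)] .
  have "\<tau> ` c \<inter> B ! i \<noteq> {} \<longleftrightarrow> c \<inter> A ! i \<noteq> {}" if "i < length A" for c i
    using assms(3)[OF that] image_Int[OF inj, of c "A ! i"] by auto
  then show ?thesis
    unfolding cycle_separated_def cycle_sets_conj[OF assms(1)] by (simp add: assms(2))
qed

lemma disjoint_tuples_transitive:
  assumes A: "A \<in> disjoint_tuples N \<beta>" and B: "B \<in> disjoint_tuples N \<beta>"
  obtains \<tau> where "\<tau> permutes {1..N}" "\<And>i. i < length A \<Longrightarrow> B ! i = \<tau> ` (A ! i)"
proof -
  define UA where "UA = (\<Union>i<length \<beta>. A ! i)"
  define UB where "UB = (\<Union>i<length \<beta>. B ! i)"
  have Ai: "A ! i \<subseteq> {1..N}" "card (A ! i) = \<beta> ! i" "finite (A ! i)"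
    and Bi: "B ! i \<subseteq> {1..N}" "card (B ! i) = \<beta> ! i" "finite (B ! i)"
    if "i < length \<beta>" for i
    using A B that by (simp_all add: disjoint_tuples_def) (meson finite_atLeastAtMost finite_subset)+
  have dis: "A ! i \<inter> A ! j = {}" "B ! i \<inter> B ! j = {}"
    if "i < length \<beta>" "j < length \<beta>" "i \<noteq> j" for i j
    using A B that by (simp_all add: disjoint_tuples_def)
  have "\<exists>f. bij_betw f (A ! i) (B ! i)" if "i < length \<beta>" for i
    using Ai[OF that] Bi[OF that] by (intro finite_same_card_bij) simp_all
  then obtain f where f: "\<And>i. i < length \<beta> \<Longrightarrow> bij_betw (f i) (A ! i) (B ! i)"
    by metis
  have sub: "UA \<subseteq> {1..N}" "UB \<subseteq> {1..N}"
    using Ai(1) Bi(1) unfolding UA_def UB_def by blast+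
  have "card UA = (\<Sum>i<length \<beta>. card (A ! i))" "card UB = (\<Sum>i<length \<beta>. card (B ! i))"
    unfolding UA_def UB_def using Ai(3) Bi(3) dis by (simp_all add: card_UN_disjoint)
  then have card_U: "card UA = sum_list \<beta>" "card UB = sum_list \<beta>"
    using Ai(2) Bi(2) by (simp_all add: sum_list_sum_nth atLeast0LessThan)
  have "card ({1..N} - UA) = card ({1..N} - UB)"
    using sub card_U by (simp add: card_Diff_subset finite_subset)
  then obtain g where g: "bij_betw g ({1..N} - UA) ({1..N} - UB)"
    using finite_same_card_bij[of "{1..N} - UA" "{1..N} - UB"] by auto
  define \<tau> where "\<tau> x = (if x \<in> {1..N}
     then if x \<in> UA then f (THE i. i < length \<beta> \<and> x \<in> A ! i) x else g x else x)" for x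
  have idx: "(THE j. j < length \<beta> \<and> x \<in> A ! j) = i" if "i < length \<beta>" "x \<in> A ! i" for i x
    using that dis(1) by (intro the_equality) blast+
  have \<tau>_A: "\<tau> x = f i x" if "i < length \<beta>" "x \<in> A ! i" for i x
  proof -
    have "x \<in> UA" using that by (auto simp: UA_def)
    then show ?thesis using sub idx[OF that] by (auto simp: \<tau>_def)
  qed
  have img: "\<tau> ` (A ! i) = B ! i" if "i < length \<beta>" for i
    using f[OF that] \<tau>_A[OF that] by (auto simp: bij_betw_def)
  have imgU: "\<tau> ` UA = UB"
    unfolding UA_def UB_def image_UN using img by simp
  have imgD: "\<tau> ` ({1..N} - UA) = {1..N} - UB"
    using g by (auto simp: bij_betw_def \<tau>_def)
  have surj: "\<tau> ` {1..N} = {1..N}"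
  proof -
    have "{1..N} = UA \<union> ({1..N} - UA)" "UB \<union> ({1..N} - UB) = {1..N}" using sub by auto
    then show ?thesis by (metis image_Un imgD imgU)
  qed
  have "bij_betw \<tau> {1..N} {1..N}"
    using surj by (simp add: bij_betw_def eq_card_imp_inj_on)
  then have "\<tau> permutes {1..N}"
    by (rule bij_imp_permutes) (simp only: \<tau>_def if_False)
  moreover have "length A = length \<beta>"
    using A by (simp add: disjoint_tuples_def)
  ultimately show ?thesis using that img by metis
qed

lemma finite_perms_of_type: "finite (perms_of_type \<mu>)"
  by (rule finite_subset[OF _ finite_permutations[of "{1..sum_mset \<mu>}"]])
    (auto simp: perms_of_type_def)

lemma sep_prob_at_eq:
  assumes ne: "perms_of_type \<mu> \<noteq> {}" "perms_of_type {#sum_mset \<mu>#} \<noteq> {}"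
    and A: "A \<in> disjoint_tuples (sum_mset \<mu>) \<beta>" and B: "B \<in> disjoint_tuples (sum_mset \<mu>) \<beta>"
  shows "sep_prob_at \<mu> A = sep_prob_at \<mu> B"
proof -
  let ?N = "sum_mset \<mu>"
  obtain \<tau> where \<tau>: "\<tau> permutes {1..?N}" "\<And>i. i < length A \<Longrightarrow> B ! i = \<tau> ` (A ! i)"
    using disjoint_tuples_transitive[OF A B] by blast
  have len: "length B = length A"
    using A B by (simp add: disjoint_tuples_def)
  define c where "c \<pi> = \<tau> \<circ> \<pi> \<circ> inv \<tau>" for \<pi>
  have c_eq: "c = (\<lambda>\<pi>. \<tau> \<circ> \<pi> \<circ> inv \<tau>)"
    by (rule ext) (rule c_def)
  have c_comp: "c \<pi> \<circ> c \<rho> = c (\<pi> \<circ> \<rho>)" for \<pi> \<rho>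
    using \<tau>(1) by (simp add: c_def fun_eq_iff permutes_inverses)
  have inv: "map_pmf c (pmf_of_set (perms_of_type \<nu>)) = pmf_of_set (perms_of_type \<nu>)"
    if "sum_mset \<nu> = ?N" "perms_of_type \<nu> \<noteq> {}" for \<nu>
  proof (rule map_pmf_of_set_bij_betw)
    show "bij_betw c (perms_of_type \<nu>) (perms_of_type \<nu>)"
      unfolding c_eq using \<tau>(1) that(1) by (intro perms_of_type_conj) simp
  qed (rule that(2), rule finite_perms_of_type)
  let ?P = "pair_pmf (pmf_of_set (perms_of_type \<mu>)) (pmf_of_set (perms_of_type {#?N#}))"
  have "map_pmf (map_prod c c) ?P = ?P"
    using inv[OF refl ne(1)] inv[OF _ ne(2)] by (simp add: map_prod_def map_pair)
  then have "sep_prob_at \<mu> B = measure_pmf.prob (map_pmf (map_prod c c) ?P)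
      {(\<pi>, \<rho>). cycle_separated ?N B (\<pi> \<circ> \<rho>)}"
    by (simp only: sep_prob_at_def)
  also have "\<dots> = measure_pmf.prob ?P
      (map_prod c c -` {(\<pi>, \<rho>). cycle_separated ?N B (\<pi> \<circ> \<rho>)})"
    by (rule measure_map_pmf)
  also have "map_prod c c -` {(\<pi>, \<rho>). cycle_separated ?N B (\<pi> \<circ> \<rho>)} =
      {(\<pi>, \<rho>). cycle_separated ?N A (\<pi> \<circ> \<rho>)}"
  proof -
    have "cycle_separated ?N B (c \<pi> \<circ> c \<rho>) \<longleftrightarrow> cycle_separated ?N A (\<pi> \<circ> \<rho>)" for \<pi> \<rho>
      unfolding c_comp unfolding c_def by (rule cycle_separated_conj[OF \<tau>(1) len \<tau>(2)])
    then show ?thesis by (simp add: set_eq_iff)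
  qed
  finally show ?thesis by (simp only: sep_prob_at_def)
qed

lemma ex_cyclic_permutes:
  assumes "finite T" "T \<noteq> {}"
  obtains f where "f permutes T" "\<And>x. x \<in> T \<Longrightarrow> orbit f x = T"
proof -
  obtain cs where cs: "set cs = T" "distinct cs"
    using finite_distinct_list[OF assms(1)] by blast
  define f where "f = cycle_of_list cs"
  have len: "0 < length cs" using cs(1) assms(2) by auto
  have f: "f permutes T" using cycle_permutes[of cs] cs(1) by (simp add: f_def)
  have pow: "(f ^^ i) (cs ! 0) = cs ! (i mod length cs)" for i
    using arg_cong[OF cyclic_rotation[OF cs(2), of i], of "\<lambda>l. l ! 0"] len
    by (simp add: f_def nth_rotate)
  have "permutation f" using f assms(1) by (auto simp: permutation_permutes)
  then have "orbit f (cs ! 0) = {cs ! (i mod length cs) | i. True}"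
    by (simp add: orbit_altdef_permutation pow)
  also have "\<dots> = T"
  proof (intro subset_antisym subsetI)
    fix x assume "x \<in> T"
    then obtain i where "i < length cs" "cs ! i = x" using cs(1) by (metis in_set_conv_nth)
    then have "x = cs ! (i mod length cs)" by simp
    then show "x \<in> {cs ! (i mod length cs) | i. True}" by blast
  next
    fix x assume "x \<in> {cs ! (i mod length cs) | i. True}"
    then obtain i where "x = cs ! (i mod length cs)" by blast
    then show "x \<in> T" using cs(1) len nth_mem[of "i mod length cs" cs] by simp
  qed
  finally have "cyclic_on f T"
    using cs(1) nth_mem[OF len] by (intro cyclic_on_singleI[of "cs ! 0"]) simp_all
  then show ?thesis by (intro that[OF f] orbit_cyclic_eq3)
qed

lemma ex_permutes_cycle_type:
  assumes "finite S" "card S = sum_mset \<mu>" "0 \<notin># \<mu>"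
  shows "\<exists>\<pi>. \<pi> permutes S \<and> image_mset card (mset_set (orbit \<pi> ` S)) = \<mu>"
  using assms
proof (induction \<mu> arbitrary: S)
  case empty
  then show ?case by (intro exI[of _ id]) (auto simp: permutes_id)
next
  case (add x \<mu>)
  obtain T where T: "T \<subseteq> S" "card T = x" "finite T"
    using obtain_subset_with_card_n[of x S] add.prems(2) by auto
  define U where "U = S - T"
  have U: "finite U" "card U = sum_mset \<mu>" "T \<inter> U = {}" "S = T \<union> U"
    using add.prems T by (auto simp: U_def card_Diff_subset)
  have T_ne: "T \<noteq> {}" using T(2) add.prems(3) by auto
  obtain f where f: "f permutes T" "\<And>x. x \<in> T \<Longrightarrow> orbit f x = T"
    using ex_cyclic_permutes[OF T(3) T_ne] by blast
  obtain g where g: "g permutes U" "image_mset card (mset_set (orbit g ` U)) = \<mu>"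
    using add.IH[of U] U add.prems(3) by auto
  have perm: "f \<circ> g permutes S"
    using f(1) g(1) U(4) by (auto intro: permutes_compose permutes_subset)
  have "orbit (f \<circ> g) x = orbit f x" if "x \<in> T" for x
  proof (rule orbit_cong0[symmetric, of _ T])
    show "f y = (f \<circ> g) y" if "y \<in> T" for y
    proof -
      have "y \<notin> U" using that U(3) by blast
      then show ?thesis using permutes_not_in[OF g(1)] by simp
    qed
  qed (use that permutes_in_image[OF f(1)] in auto)
  then have oT: "orbit (f \<circ> g) ` T = {T}" using f(2) T_ne by auto
  have "orbit (f \<circ> g) x = orbit g x" if "x \<in> U" for x
  proof (rule orbit_cong0[symmetric, of _ U])
    show "g y = (f \<circ> g) y" if "y \<in> U" for y
    proof -
      have "g y \<notin> T" using that U(3) permutes_in_image[OF g(1)] by auto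
      then show ?thesis using permutes_not_in[OF f(1)] by simp
    qed
  qed (use that permutes_in_image[OF g(1)] in auto)
  then have oU: "orbit (f \<circ> g) ` U = orbit g ` U" by auto
  have "T \<notin> orbit g ` U"
    using permutes_orbit_subset[OF g(1)] U(3) T_ne by blast
  then have "image_mset card (mset_set (orbit (f \<circ> g) ` S)) = add_mset x \<mu>"
    using oT oU U(1) g(2) T(2) by (simp add: U(4) image_Un)
  then show ?case using perm by blast
qed

lemma perms_of_type_nonempty:
  assumes "0 \<notin># \<mu>"
  shows "perms_of_type \<mu> \<noteq> {}"
proof -
  have "card {1..sum_mset \<mu>} = sum_mset \<mu>" by simp
  from ex_permutes_cycle_type[OF finite_atLeastAtMost this assms] show ?thesis
    unfolding perms_of_type_def cycle_type_def cycle_sets_def by blast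
qed

lemma sep_prob_eq:
  assumes "0 \<notin># \<mu>" "\<mu> \<noteq> {#}" and A: "A \<in> disjoint_tuples (sum_mset \<mu>) \<beta>"
  shows "sep_prob \<mu> \<beta> = sep_prob_at \<mu> A"
proof -
  obtain x where "x \<in># \<mu>" using assms(2) by (rule multiset_nonemptyE)
  then have "sum_mset \<mu> \<noteq> 0" using assms(1) unfolding sum_mset_0_iff by fastforce
  then have "perms_of_type \<mu> \<noteq> {}" "perms_of_type {#sum_mset \<mu>#} \<noteq> {}"
    using assms(1) by (simp_all add: perms_of_type_nonempty)
  moreover have "(SOME A. A \<in> disjoint_tuples (sum_mset \<mu>) \<beta>) \<in> disjoint_tuples (sum_mset \<mu>) \<beta>"
    using A by (rule someI)
  ultimately show ?thesis
    unfolding sep_prob_def using A by (blast intro: sep_prob_at_eq)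
qed

end

theory Submission
  imports Defs
begin

text \<open>
  Sum over all long cycles \<open>c\<close> instead of fixing one, and keep \<open>\<pi>\<close> fixed: \<open>sepcount S \<pi> \<alpha>\<close> is
  the number of pairs \<open>(c, A)\<close> such that \<open>\<pi> \<circ> c\<close> is \<open>A\<close>-separated.

  Symmetry: this number depends only on the size and the length of \<open>\<alpha>\<close>. It suffices to move points
  between two parts \<open>A\<^sub>i\<close> and \<open>A\<^sub>j\<close> with fixed union \<open>B\<close>. Averaging over the coset of \<open>c\<close> by the
  permutations \<open>\<rho>\<close> of \<open>B\<close> and passing to first return maps on \<open>B\<close>, one has to count the pairs
  \<open>(d, Y)\<close> of a cyclic permutation \<open>d\<close> of \<open>B\<close> and an \<open>a\<close>-subset \<open>Y\<close> with \<open>d ` Y = \<tau> ` Y\<close>, where \<open>\<tau>\<close> is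
  a fixed permutation of \<open>B\<close>. For given \<open>Y\<close> there are \<open>(a - 1)! (N - a - 1)! card (\<tau> ` Y - Y)\<close> such
  \<open>d\<close>, with \<open>N = card B\<close>, and the total, \<open>(N - 2)!\<close> times the number of points moved by \<open>\<tau>\<close>, does not
  involve \<open>a\<close>.

  Recursion: a new fixed point \<open>f\<close> of \<open>\<pi>\<close> is inserted into \<open>c\<close> after some point \<open>z\<close>, and then follows \<open>z\<close>
  in a cycle of \<open>\<pi> \<circ> c\<close> too. Distinguishing whether \<open>f\<close> lies outside all parts, in a part
  together with \<open>z\<close>, or in a part not containing \<open>z\<close> gives a recursion for \<open>sepcount\<close>; by symmetry it
  closes on the compositions \<open>(d + 1, 1, \<dots>, 1)\<close>, and its solution is the asserted sum.
\<close>

section \<open>Cyclic permutations\<close>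

text \<open>Cycles are not traced point by point. Being a long cycle and being separated are both
  phrased through invariant sets, because one operation governs the whole proof: if
  \<open>v e = e\<close>, then \<open>v \<circ> Transposition.transpose e z\<close> inserts
  \<open>e\<close> right behind \<open>z\<close>, and its invariant sets are exactly those of
  \<open>v\<close> that contain both or neither of \<open>e\<close> and \<open>z\<close>. The same
  operation builds long cycles, contracts the points outside \<open>B\<close>, and adds the new
  fixed points. The averaging cannot be avoided: for a single \<open>c\<close> the number of ways to
  split \<open>B\<close> into separated parts of sizes \<open>a\<close> and \<open>N - a\<close> can
  depend on \<open>a\<close>. The recursion does not produce the bracket of the theorem but the
  single term \<open>(n + r) / n\<close> times
  \<open>(n + m + r - p - 1) choose (n + m - 1)\<close>. There \<open>n + r\<close> and
  \<open>n\<close> are what remains of \<open>fact (n + r - 1)\<close> and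
  \<open>fact (n - 1)\<close>, the numbers of long cycles, after the \<open>r\<close> fixed points
  have been chosen; the bracket is this product in disguise.\<close>

lemma bij_betw_Collect:
  assumes "bij_betw f A B"
  shows "bij_betw f {a \<in> A. P (f a)} {b \<in> B. P b}"
  using assms unfolding bij_betw_def inj_on_def by blast

lemma card_Collect_bij_betw:
  assumes "bij_betw f A B"
  shows "card {b \<in> B. P b} = card {a \<in> A. P (f a)}"
  by (rule bij_betw_same_card[OF bij_betw_Collect[OF assms], symmetric])

text \<open>Long cycles are encoded by the absence of proper nonempty invariant subsets instead of
  by orbits; \<open>cyclic_perms_iff_orbit\<close> gives the equivalence for finite
  \<open>S\<close>.\<close>

definition cyclic_perms :: "'a set \<Rightarrow> ('a \<Rightarrow> 'a) set" where
  "cyclic_perms S = {c. c permutes S \<and> S \<noteq> {} \<and> (\<forall>U\<subseteq>S. c ` U = U \<longrightarrow> U = {} \<or> U = S)}"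

lemma cyclic_permsD: "c \<in> cyclic_perms S \<Longrightarrow> c permutes S"
  by (simp add: cyclic_perms_def)

lemma cyclic_perms_invariantD:
  "c \<in> cyclic_perms S \<Longrightarrow> U \<subseteq> S \<Longrightarrow> c ` U = U \<Longrightarrow> U = {} \<or> U = S"
  unfolding cyclic_perms_def by blast

lemma cyclic_permsI:
  "c permutes S \<Longrightarrow> S \<noteq> {} \<Longrightarrow> (\<And>U. U \<subseteq> S \<Longrightarrow> c ` U = U \<Longrightarrow> U = {} \<or> U = S) \<Longrightarrow> c \<in> cyclic_perms S"
  unfolding cyclic_perms_def by blast

lemma cyclic_perms_nonempty: "c \<in> cyclic_perms S \<Longrightarrow> S \<noteq> {}"
  unfolding cyclic_perms_def by blast

lemma finite_cyclic_perms: "finite S \<Longrightarrow> finite (cyclic_perms S)"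
  by (rule finite_subset[OF _ finite_permutations]) (auto dest: cyclic_permsD)

lemma cyclic_perms_singleton: "cyclic_perms {x} = {id}"
  by (auto simp: cyclic_perms_def)

section \<open>Inserting a point into a cycle behind a given point\<close>

text \<open>The composite sends \<open>z\<close> to \<open>v e = e\<close>, and an invariant set of
  an injective map contains a point exactly if it contains its image.\<close>

lemma invariant_transpose_iff:
  assumes "inj v" "v e = e" "(v \<circ> Transposition.transpose e z) ` U = U"
  shows "e \<in> U \<longleftrightarrow> z \<in> U"
proof -
  let ?w = "v \<circ> Transposition.transpose e z"
  have "inj ?w" using assms(1) by (simp add: inj_compose)
  moreover have "?w z = e" using assms(2) by simp
  ultimately show ?thesis using assms(3) by (metis inj_image_mem_iff)
qed

lemma image_comp_transpose:
  assumes "e \<in> U \<longleftrightarrow> z \<in> U"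
  shows "(v \<circ> Transposition.transpose e z) ` U = v ` U"
  using transpose_image_eq[OF assms] by (simp only: image_comp[symmetric])

text \<open>A fixed point may be added to an invariant set or taken out of it. This is how an
  invariant set of \<open>v\<close> is adjusted to contain both or neither of \<open>e\<close> and
  \<open>z\<close>.\<close>

lemma image_fixed_insert_delete:
  assumes "inj v" "v e = e" "v ` U = U"
  shows "v ` insert e U = insert e U" "v ` (U - {e}) = U - {e}"
  using assms by (simp_all add: image_set_diff)

text \<open>The inverse operation: \<open>c z = e\<close>, so the composite fixes \<open>e\<close>
  and joins its predecessor directly to its successor.\<close>

lemma permutes_comp_transpose:
  assumes "c permutes insert e S" "inv c e = z"
  shows "(c \<circ> Transposition.transpose e z) permutes S"
proof (rule permutes_superset)
  have "z \<in> insert e S"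
    using assms permutes_in_image[OF permutes_inv[OF assms(1)]] by auto
  then show "c \<circ> Transposition.transpose e z permutes insert e S"
    by (intro permutes_compose permutes_swap_id assms) auto
  show "(c \<circ> Transposition.transpose e z) x = x" if "x \<in> insert e S - S" for x
    using that assms by (auto simp: permutes_inverses)
qed

text \<open>The invariant subsets correspond to each other: those of the composite contain
  \<open>e\<close> exactly if they contain \<open>z\<close>, and deleting \<open>e\<close> from them
  gives those of \<open>c\<close> inside \<open>S\<close>.\<close>

lemma cyclic_perms_insert:
  assumes "e \<notin> S" "c permutes S" "z \<in> S"
  shows "c \<circ> Transposition.transpose e z \<in> cyclic_perms (insert e S) \<longleftrightarrow> c \<in> cyclic_perms S"
proof -
  let ?d = "c \<circ> Transposition.transpose e z"
  have perm: "?d permutes insert e S"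
    by (rule permutes_compose[OF permutes_swap_id permutes_imp_permutes_insert[OF assms(2)]])
      (use assms(3) in auto)
  have ce: "c e = e" using assms permutes_not_in by metis
  have inj: "inj c" using assms permutes_inj by metis
  show ?thesis
  proof
    assume d: "?d \<in> cyclic_perms (insert e S)"
    have "U = {} \<or> U = S" if U: "U \<subseteq> S" "c ` U = U" for U
    proof -
      define V where "V = (if z \<in> U then insert e U else U)"
      have "?d ` V = c ` V" using U assms by (intro image_comp_transpose) (auto simp: V_def)
      also have "c ` V = V"
        using image_fixed_insert_delete[OF inj ce U(2)] U(2) by (simp add: V_def)
      finally have "V = {} \<or> V = insert e S"
        using U(1) by (intro cyclic_perms_invariantD[OF d]) (auto simp: V_def)
      then show ?thesis using U(1) assms(1) by (auto simp: V_def split: if_splits)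
    qed
    then show "c \<in> cyclic_perms S" using assms by (intro cyclic_permsI) auto
  next
    assume c: "c \<in> cyclic_perms S"
    have "U = {} \<or> U = insert e S" if U: "U \<subseteq> insert e S" "?d ` U = U" for U
    proof -
      have iff: "e \<in> U \<longleftrightarrow> z \<in> U" by (rule invariant_transpose_iff[OF inj ce U(2)])
      then have "c ` U = U" using U(2) image_comp_transpose by metis
      then have "c ` (U - {e}) = U - {e}" by (rule image_fixed_insert_delete[OF inj ce])
      then have "U - {e} = {} \<or> U - {e} = S" using U(1) by (intro cyclic_perms_invariantD[OF c]) auto
      then show ?thesis using iff assms(1,3) by auto
    qed
    then show "?d \<in> cyclic_perms (insert e S)" using perm by (intro cyclic_permsI) auto
  qed
qed

text \<open>The inverse map reads off the predecessor \<open>z = inv d e\<close> and bypasses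
  \<open>e\<close>. Here \<open>z\<close> differs from \<open>e\<close> because a fixed point would
  be a proper invariant subset.\<close>

lemma bij_betw_cyclic_perms_insert:
  assumes "e \<notin> S" "S \<noteq> {}"
  shows "bij_betw (\<lambda>(c, z). c \<circ> Transposition.transpose e z)
    (cyclic_perms S \<times> S) (cyclic_perms (insert e S))"
proof (rule bij_betw_byWitness[where f' = "\<lambda>d. (d \<circ> Transposition.transpose e (inv d e), inv d e)"])
  have inv_eq: "inv (c \<circ> Transposition.transpose e z) e = z"
    if "c \<in> cyclic_perms S" "z \<in> S" for c z
  proof -
    have "c permutes S" using that cyclic_permsD by blast
    then have "c \<circ> Transposition.transpose e z permutes insert e S" "c e = e"
      using assms(1) that(2)
      by (simp_all add: permutes_compose permutes_swap_id permutes_imp_permutes_insert permutes_not_in)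
    then show ?thesis by (simp add: permutes_inv_eq)
  qed
  show "\<forall>a\<in>cyclic_perms S \<times> S. (\<lambda>d. (d \<circ> Transposition.transpose e (inv d e), inv d e))
      ((\<lambda>(c, z). c \<circ> Transposition.transpose e z) a) = a"
    using inv_eq by (auto simp: comp_assoc)
  show "\<forall>d\<in>cyclic_perms (insert e S). (\<lambda>(c, z). c \<circ> Transposition.transpose e z)
      (d \<circ> Transposition.transpose e (inv d e), inv d e) = d"
    by (auto simp: comp_assoc)
  show "(\<lambda>(c, z). c \<circ> Transposition.transpose e z) ` (cyclic_perms S \<times> S) \<subseteq> cyclic_perms (insert e S)"
    using cyclic_perms_insert[OF assms(1)] by (auto dest: cyclic_permsD)
  show "(\<lambda>d. (d \<circ> Transposition.transpose e (inv d e), inv d e)) ` cyclic_perms (insert e S)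
      \<subseteq> cyclic_perms S \<times> S"
  proof (rule image_subsetI)
    fix d assume d: "d \<in> cyclic_perms (insert e S)"
    then have dp: "d permutes insert e S" by (rule cyclic_permsD)
    define z where "z = inv d e"
    have dz: "d z = e" unfolding z_def using dp by (simp add: permutes_inverses)
    have "z \<noteq> e"
    proof
      assume "z = e"
      then have "d ` {e} = {e}" using dz by auto
      then have "{e} = insert e S" using cyclic_perms_invariantD[OF d, of "{e}"] by auto
      then show False using assms by auto
    qed
    moreover have "z \<in> insert e S"
      using dp dz permutes_in_image[OF dp, of z] by auto
    ultimately have z: "z \<in> S" by auto
    have p: "d \<circ> Transposition.transpose e z permutes S"
      using dp by (rule permutes_comp_transpose) (simp add: z_def)
    have "d \<circ> Transposition.transpose e z \<in> cyclic_perms S"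
      using cyclic_perms_insert[OF assms(1) p z] d by (simp add: comp_assoc)
    then show "(d \<circ> Transposition.transpose e (inv d e), inv d e) \<in> cyclic_perms S \<times> S"
      using z by (simp add: z_def)
  qed
qed

lemma card_cyclic_perms:
  assumes "finite S" "S \<noteq> {}"
  shows "card (cyclic_perms S) = fact (card S - 1)"
  using assms
proof (induction S rule: finite_ne_induct)
  case (singleton x)
  then show ?case by (simp add: cyclic_perms_singleton)
next
  case (insert x S)
  have "card (cyclic_perms (insert x S)) = card (cyclic_perms S \<times> S)"
    using bij_betw_same_card[OF bij_betw_cyclic_perms_insert[of x S]] insert.hyps by simp
  also have "\<dots> = card S * fact (card S - 1)"
    using insert by (simp add: card_cartesian_product)
  also have "\<dots> = fact (card S)" using insert by (metis card_gt_0_iff fact_reduce of_nat_id)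
  finally show ?case using insert by simp
qed

text \<open>Induction on \<open>a\<close>: a point \<open>e\<close> of \<open>Y - X\<close> has its
  predecessor \<open>z\<close> in \<open>X\<close>, and bypassing \<open>e\<close> leaves a cyclic
  permutation of \<open>B - {e}\<close> that maps \<open>X - {z}\<close> onto
  \<open>Y - {e}\<close>. The number \<open>card B - a - 1\<close> does not change in this
  step.\<close>

lemma card_cyclic_perms_image_eq:
  assumes "finite B" "X \<subseteq> B" "Y \<subseteq> B" "card X = a" "card Y = a" "1 \<le> a" "a < card B"
  shows "card {c \<in> cyclic_perms B. c ` X = Y} = fact (a - 1) * fact (card B - a - 1) * card (Y - X)"
  using assms
proof (induction a arbitrary: B X Y)
  case 0
  then show ?case by simp
next
  case (Suc a)
  have fin: "finite X" "finite Y" using Suc.prems finite_subset by blast+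
  show ?case
  proof (cases "Y - X = {}")
    \<comment> \<open>Equal cardinalities force \<open>X = Y\<close>, which would be a proper
      nonempty invariant subset, so both sides vanish.\<close>
    case True
    then have "X = Y" using Suc.prems fin by (metis Diff_eq_empty_iff card_subset_eq)
    moreover have "X \<noteq> {}" "X \<noteq> B" using Suc.prems by auto
    ultimately have "{c \<in> cyclic_perms B. c ` X = Y} = {}"
      using cyclic_perms_invariantD[OF _ Suc.prems(2)] by blast
    then show ?thesis using True by (metis card.empty mult_0_right)
  next
    case False
    then obtain e where e: "e \<in> Y" "e \<notin> X" by auto
    define S where "S = B - {e}"
    have S: "e \<notin> S" "B = insert e S" "finite S" "X \<subseteq> S" "Y - {e} \<subseteq> S"
      using Suc.prems(1-3) e by (auto simp: S_def)
    have S': "S \<noteq> {}" "card B = Suc (card S)"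
      using S Suc.prems(4) by auto
    define G where "G z = {c \<in> cyclic_perms S. c ` (X - {z}) = Y - {e}}" for z
    have image_iff: "(c \<circ> Transposition.transpose e z) ` X = Y \<longleftrightarrow> z \<in> X \<and> c ` (X - {z}) = Y - {e}"
      if c: "c permutes S" and z: "z \<in> S" for c z
    proof -
      have inj: "inj (c \<circ> Transposition.transpose e z)" using c permutes_inj by (metis inj_compose inj_transpose)
      have ce: "c e = e" using c S(1) permutes_not_in by metis
      have *: "(c \<circ> Transposition.transpose e z) ` (X - {z}) = c ` (X - {z})"
        using e by (intro image_comp_transpose) auto
      have "z \<in> X" if "(c \<circ> Transposition.transpose e z) ` X = Y"
        using that e(1) inj ce
        by (metis comp_apply inj_image_mem_iff transpose_apply_second)
      moreover have "(c \<circ> Transposition.transpose e z) ` X = Y \<longleftrightarrow> c ` (X - {z}) = Y - {e}" if "z \<in> X"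
      proof -
        have "(c \<circ> Transposition.transpose e z) ` X = insert e (c ` (X - {z}))"
        proof -
          have "f ` X = insert (f z) (f ` (X - {z}))" for f :: "'a \<Rightarrow> 'a"
            using that by blast
          from this[of "c \<circ> Transposition.transpose e z"] show ?thesis
            unfolding * using ce by simp
        qed
        moreover have "e \<notin> c ` (X - {z})"
          using c S(1,4) permutes_in_image[OF c] by auto
        ultimately show ?thesis using e(1) by auto
      qed
      ultimately show ?thesis by blast
    qed
    have "card {c \<in> cyclic_perms B. c ` X = Y}
      = card {(c, z) \<in> cyclic_perms S \<times> S. (c \<circ> Transposition.transpose e z) ` X = Y}"
      unfolding S(2) card_Collect_bij_betw[OF bij_betw_cyclic_perms_insert[OF S(1) S'(1)]]
      by (rule arg_cong[of _ _ card]) auto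
    also have "{(c, z) \<in> cyclic_perms S \<times> S. (c \<circ> Transposition.transpose e z) ` X = Y}
      = prod.swap ` (SIGMA z:X. G z)"
    proof -
      have swap_eq: "{(c, z) \<in> C \<times> S. P c z} = prod.swap ` (SIGMA z:X. {c \<in> C. Q c z})"
        if "\<And>c z. c \<in> C \<Longrightarrow> z \<in> S \<Longrightarrow> P c z \<longleftrightarrow> z \<in> X \<and> Q c z" for P Q and C :: "('a \<Rightarrow> 'a) set"
        using that S(4) by auto
      show ?thesis unfolding G_def by (rule swap_eq) (rule image_iff[OF cyclic_permsD])
    qed
    also have "card \<dots> = (\<Sum>z\<in>X. card (G z))"
      using fin by (subst card_image) (auto simp: G_def finite_cyclic_perms S(3))
    also have "\<dots> = fact a * fact (card B - Suc a - 1) * card (Y - X)"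
    \<comment> \<open>Sets of size one are treated apart: \<open>X - {z}\<close> is then empty, and
      the induction hypothesis asks for \<open>1 \<le> a\<close>.\<close>
    proof (cases "a = 0")
      case True
      then obtain x where X: "X = {x}" using Suc.prems by (metis One_nat_def card_1_singletonE)
      have Y: "Y = {e}" using Suc.prems True e by (metis One_nat_def card_1_singletonE singletonD)
      have "G x = cyclic_perms S" using X Y by (auto simp: G_def)
      then show ?thesis using X Y e S S' True by (simp add: card_cyclic_perms)
    next
      case False
      have "card (G z) = fact (a - 1) * fact (card B - Suc a - 1) * card ((Y - {e}) - (X - {z}))"
        if "z \<in> X" for z
        unfolding G_def
        using Suc.IH[of S "X - {z}" "Y - {e}"] Suc.prems that S S' e fin False by auto
      then have "(\<Sum>z\<in>X. card (G z)) = fact (a - 1) * fact (card B - Suc a - 1)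
          * (\<Sum>z\<in>X. card ((Y - {e}) - (X - {z})))"
        by (simp add: sum_distrib_left)
      also have "(\<Sum>z\<in>X. card ((Y - {e}) - (X - {z}))) = a * card (Y - X)"
      proof -
        \<comment> \<open>Removing \<open>e\<close> lowers the difference by one; removing
          \<open>z\<close> from \<open>X\<close> raises it by one if \<open>z\<close> lies in
          \<open>Y\<close>.\<close>
        have "card ((Y - {e}) - (X - {z})) = (card (Y - X) - 1) + (if z \<in> Y then 1 else 0)"
          if z: "z \<in> X" for z
        proof -
          have "(Y - {e}) - (X - {z}) = (Y - X - {e}) \<union> (if z \<in> Y then {z} else {})"
            using z e by auto
          moreover have "card (Y - X - {e}) = card (Y - X) - 1" using e fin by simp
          ultimately show ?thesis using fin z by (auto simp: card_insert_if)
        qed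
        then have sum: "(\<Sum>z\<in>X. card ((Y - {e}) - (X - {z}))) =
            Suc a * (card (Y - X) - 1) + card (X \<inter> Y)"
          using Suc.prems(4) fin by (simp add: sum.distrib sum.inter_restrict[symmetric] del: mult_Suc)
        have split: "card (X \<inter> Y) + card (Y - X) = Suc a"
          using Suc.prems(5) fin by (metis Int_commute card_Int_Diff)
        have "card (Y - X) = Suc (card (Y - X - {e}))"
          using e fin by (intro card.remove) auto
        \<comment> \<open>With \<open>card (Y - X) = Suc d\<close> the sum becomes
          \<open>Suc a * d + (a - d) = a * Suc d\<close>.\<close>
        then obtain d where d: "card (Y - X) = Suc d" ..
        then have "a = card (X \<inter> Y) + d" using split by simp
        then show ?thesis unfolding sum d by simp
      qed
      also have "fact (a - 1) * fact (card B - Suc a - 1) * (a * card (Y - X))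
        = fact a * fact (card B - Suc a - 1) * card (Y - X)"
        using False by (simp add: fact_reduce)
      finally show ?thesis .
    qed
    finally show ?thesis by simp
  qed
qed

section \<open>Separation by invariant sets\<close>

lemma card_Collect_pairs_fst:
  assumes "finite A" "finite B"
  shows "card {(x, y). x \<in> A \<and> y \<in> B \<and> P x y} = (\<Sum>x\<in>A. card {y \<in> B. P x y})"
proof -
  have "{(x, y). x \<in> A \<and> y \<in> B \<and> P x y} = (SIGMA x:A. {y \<in> B. P x y})" by auto
  then show ?thesis using assms by simp
qed

lemma card_Collect_pairs_snd:
  assumes "finite A" "finite B"
  shows "card {(x, y). x \<in> A \<and> y \<in> B \<and> P x y} = (\<Sum>y\<in>B. card {x \<in> A. P x y})"
proof -
  have "{(x, y). x \<in> A \<and> y \<in> B \<and> P x y} = prod.swap ` (SIGMA y:B. {x \<in> A. P x y})" by auto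
  then show ?thesis using assms by (simp add: card_image)
qed

text \<open>\<open>U\<close> plays the role of a union of cycles that contains all cycles through
  \<open>X\<close>. It ranges over the whole type, so that for a bijection complements are available
  and the relation is symmetric.\<close>

definition sep_by :: "('a \<Rightarrow> 'a) \<Rightarrow> 'a set \<Rightarrow> 'a set \<Rightarrow> bool" where
  "sep_by v X Y \<longleftrightarrow> (\<exists>U. v ` U = U \<and> X \<subseteq> U \<and> Y \<inter> U = {})"

lemma sep_byI: "v ` U = U \<Longrightarrow> X \<subseteq> U \<Longrightarrow> Y \<inter> U = {} \<Longrightarrow> sep_by v X Y"
  unfolding sep_by_def by blast

lemma sep_by_disjoint: "sep_by v X Y \<Longrightarrow> X \<inter> Y = {}"
  unfolding sep_by_def by blast

lemma bij_invariant_Compl: "bij v \<Longrightarrow> v ` U = U \<Longrightarrow> v ` (- U) = - U"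
  using bij_image_Compl_eq by metis

lemma sep_by_sym:
  assumes "bij v" "sep_by v X Y"
  shows "sep_by v Y X"
proof -
  obtain U where U: "v ` U = U" "X \<subseteq> U" "Y \<inter> U = {}" using assms(2) unfolding sep_by_def by blast
  show ?thesis
    by (rule sep_byI[of _ "- U"]) (use U bij_invariant_Compl[OF assms(1) U(1)] in auto)
qed

lemma sep_by_Un:
  assumes "sep_by v X Z" "sep_by v Y Z"
  shows "sep_by v (X \<union> Y) Z"
proof -
  obtain U V where U: "v ` U = U" "X \<subseteq> U" "Z \<inter> U = {}" and V: "v ` V = V" "Y \<subseteq> V" "Z \<inter> V = {}"
    using assms unfolding sep_by_def by blast
  show ?thesis
    by (rule sep_byI[of _ "U \<union> V"]) (use U V in \<open>auto simp: image_Un\<close>)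
qed

section \<open>Multiplying by permutations of a subset, and first return maps\<close>

lemma permutes_image_eq_self:
  assumes "\<rho> permutes B" "B \<subseteq> U \<or> B \<inter> U = {}"
  shows "\<rho> ` U = U"
  using assms(2)
proof
  assume "B \<subseteq> U"
  then have "\<rho> permutes U" using assms(1) permutes_subset by blast
  then show ?thesis by (rule permutes_image)
next
  assume "B \<inter> U = {}"
  then have "\<rho> x = x" if "x \<in> U" for x using that permutes_not_in[OF assms(1)] by blast
  then show ?thesis by (simp add: image_def)
qed

lemma image_comp_fixed: "\<rho> ` U = U \<Longrightarrow> (w \<circ> \<rho>) ` U = w ` U"
  by (metis image_comp)

definition tuple_sep :: "('a \<Rightarrow> 'a) \<Rightarrow> 'a set list \<Rightarrow> bool" where
  "tuple_sep v A \<longleftrightarrow> (\<forall>i<length A. \<forall>j<length A. i \<noteq> j \<longrightarrow> sep_by v (A ! i) (A ! j))"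

text \<open>The permutation \<open>w'\<close> is the first return map of \<open>w\<close> on \<open>B\<close>; contracting the points
  outside \<open>B\<close> one by one avoids any reasoning about return times.\<close>

lemma ex_first_return:
  assumes "finite D" "D \<inter> B = {}" "w permutes B \<union> D"
  shows "\<exists>w'. w' permutes B \<and> (\<forall>\<rho> V. \<rho> permutes B \<longrightarrow> V \<subseteq> B \<longrightarrow>
    (\<exists>U. (w \<circ> \<rho>) ` U = U \<and> U \<inter> B = V) = ((w' \<circ> \<rho>) ` V = V))"
  using assms
proof (induction D arbitrary: w rule: finite_induct)
  case empty
  have "(\<exists>U. (w \<circ> \<rho>) ` U = U \<and> U \<inter> B = V) = ((w \<circ> \<rho>) ` V = V)"
    if "\<rho> permutes B" "V \<subseteq> B" for \<rho> V
  proof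
    have p: "w \<circ> \<rho> permutes B" using that(1) empty.prems by (simp add: permutes_compose)
    assume "\<exists>U. (w \<circ> \<rho>) ` U = U \<and> U \<inter> B = V"
    then obtain U where U: "(w \<circ> \<rho>) ` U = U" "U \<inter> B = V" by blast
    have "(w \<circ> \<rho>) ` (U \<inter> B) = (w \<circ> \<rho>) ` U \<inter> (w \<circ> \<rho>) ` B"
      using permutes_inj[OF p] by (rule image_Int)
    then show "(w \<circ> \<rho>) ` V = V" unfolding U permutes_image[OF p] .
  qed (use that in blast)
  then show ?case using empty.prems by auto
next
  case (insert e D)
  define z where "z = inv w e"
  define w1 where "w1 = w \<circ> Transposition.transpose e z"
  have w: "w permutes insert e (B \<union> D)" using insert.prems by simp
  have w1: "w1 permutes B \<union> D"
    unfolding w1_def using w by (rule permutes_comp_transpose) (simp add: z_def)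
  have w_eq: "w = w1 \<circ> Transposition.transpose e z" by (simp add: w1_def comp_assoc)
  have e: "e \<notin> B \<union> D" using insert by auto
  have "D \<inter> B = {}" using insert.prems by blast
  from insert.IH[OF this w1] obtain w' where w': "w' permutes B"
    "\<forall>\<rho> V. \<rho> permutes B \<longrightarrow> V \<subseteq> B \<longrightarrow>
      (\<exists>U. (w1 \<circ> \<rho>) ` U = U \<and> U \<inter> B = V) = ((w' \<circ> \<rho>) ` V = V)"
    by (elim exE conjE)
  have "(\<exists>U. (w \<circ> \<rho>) ` U = U \<and> U \<inter> B = V) = (\<exists>U. (w1 \<circ> \<rho>) ` U = U \<and> U \<inter> B = V)"
    if \<rho>: "\<rho> permutes B" "V \<subseteq> B" for \<rho> V
  proof -
    define y where "y = inv \<rho> z"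
    have inv_e: "inv \<rho> e = e"
      using e permutes_not_in[OF permutes_inv[OF \<rho>(1)]] by blast
    \<comment> \<open>Since \<open>\<rho>\<close> fixes \<open>e\<close>, moving the transposition
      past it only changes the insertion point from \<open>z\<close> to
      \<open>y = inv \<rho> z\<close>; so \<open>w \<circ> \<rho>\<close> is again an insertion of
      \<open>e\<close>.\<close>
    have eq: "w \<circ> \<rho> = (w1 \<circ> \<rho>) \<circ> Transposition.transpose e y"
      unfolding w_eq comp_assoc transpose_comp_eq[OF permutes_bij[OF \<rho>(1)]] by (simp add: inv_e y_def)
    have inj: "inj (w1 \<circ> \<rho>)" using permutes_inj[OF w1] permutes_inj[OF \<rho>(1)] by (rule inj_compose)
    have fix_e: "(w1 \<circ> \<rho>) e = e"
      using e permutes_not_in[OF \<rho>(1), of e] permutes_not_in[OF w1, of e] by simp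
    show ?thesis
    proof
      assume "\<exists>U. (w \<circ> \<rho>) ` U = U \<and> U \<inter> B = V"
      then obtain U where U: "(w \<circ> \<rho>) ` U = U" "U \<inter> B = V" by blast
      have "e \<in> U \<longleftrightarrow> y \<in> U" using U(1) unfolding eq by (rule invariant_transpose_iff[OF inj fix_e])
      then have "(w1 \<circ> \<rho>) ` U = U" using U(1) image_comp_transpose unfolding eq by metis
      then show "\<exists>U. (w1 \<circ> \<rho>) ` U = U \<and> U \<inter> B = V" using U(2) by blast
    next
      assume "\<exists>U. (w1 \<circ> \<rho>) ` U = U \<and> U \<inter> B = V"
      then obtain U where U: "(w1 \<circ> \<rho>) ` U = U" "U \<inter> B = V" by blast
      \<comment> \<open>The point \<open>e\<close> lies outside \<open>B\<close>, so adjusting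
        \<open>U\<close> at \<open>e\<close> leaves the trace \<open>U \<inter> B\<close>
        alone.\<close>
      define U' where "U' = (if y \<in> U then insert e U else U - {e})"
      have "(w1 \<circ> \<rho>) ` U' = U'"
        using image_fixed_insert_delete[OF inj fix_e U(1)] by (simp add: U'_def del: image_insert comp_apply)
      moreover have "(w \<circ> \<rho>) ` U' = (w1 \<circ> \<rho>) ` U'"
        unfolding eq by (rule image_comp_transpose) (auto simp: U'_def)
      moreover have "U' \<inter> B = V" using U(2) e by (auto simp: U'_def)
      ultimately show "\<exists>U. (w \<circ> \<rho>) ` U = U \<and> U \<inter> B = V" by metis
    qed
  qed
  then show ?case using w'(2) by (intro exI[of _ w'] conjI w'(1)) simp
qed

text \<open>Invariant sets that avoid \<open>B\<close> are the same for \<open>c\<close> and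
  \<open>c \<circ> \<rho>\<close>; all others are seen by the return map through their traces on
  \<open>B\<close>. Only the second condition involves \<open>\<rho>\<close>, which isolates what
  has to be averaged.\<close>

lemma cyclic_perms_first_return:
  assumes B: "B \<subseteq> S" "B \<noteq> {}" and c: "c permutes S" and \<rho>: "\<rho> permutes B" and c': "c' permutes B"
    and ret: "\<And>V. V \<subseteq> B \<Longrightarrow> (\<exists>U. (c \<circ> \<rho>) ` U = U \<and> U \<inter> B = V) = ((c' \<circ> \<rho>) ` V = V)"
  shows "c \<circ> \<rho> \<in> cyclic_perms S \<longleftrightarrow>
    (\<forall>U\<subseteq>S. U \<inter> B = {} \<longrightarrow> c ` U = U \<longrightarrow> U = {}) \<and> c' \<circ> \<rho> \<in> cyclic_perms B"
proof -
  have p: "c \<circ> \<rho> permutes S" using c \<rho> B by (meson permutes_compose permutes_subset)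
  have p': "c' \<circ> \<rho> permutes B" using c' \<rho> by (rule permutes_compose[rotated])
  \<comment> \<open>The sets supplied by \<open>ret\<close> may reach outside \<open>S\<close>;
    intersecting with \<open>S\<close> keeps them invariant.\<close>
  have inv_S: "(c \<circ> \<rho>) ` (U \<inter> S) = U \<inter> S" if "(c \<circ> \<rho>) ` U = U" for U
    using image_Int[OF permutes_inj[OF p], of U S] unfolding that permutes_image[OF p] .
  have inv_D: "(c \<circ> \<rho>) ` (S - U) = S - U" if "(c \<circ> \<rho>) ` U = U" for U
    using image_set_diff[OF permutes_inj[OF p], of S U] unfolding that permutes_image[OF p] .
  have avoid: "(c \<circ> \<rho>) ` U = c ` U" if "U \<inter> B = {}" for U
    using permutes_image_eq_self[OF \<rho>, of U] that by (intro image_comp_fixed) blast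
  show ?thesis
  proof (intro iffI conjI allI impI)
    assume cyc: "c \<circ> \<rho> \<in> cyclic_perms S"
    show "U = {}" if U: "U \<subseteq> S" "U \<inter> B = {}" "c ` U = U" for U
    proof -
      have "U = {} \<or> U = S" using avoid[OF U(2)] U by (intro cyclic_perms_invariantD[OF cyc]) auto
      then show ?thesis using U B by blast
    qed
    show "c' \<circ> \<rho> \<in> cyclic_perms B"
    proof (rule cyclic_permsI[OF p' B(2)])
      fix V assume V: "V \<subseteq> B" "(c' \<circ> \<rho>) ` V = V"
      from iffD2[OF ret[OF V(1)] V(2)] obtain U where U: "(c \<circ> \<rho>) ` U = U" "U \<inter> B = V"
        by (elim exE conjE)
      have "U \<inter> S = {} \<or> U \<inter> S = S"
        by (rule cyclic_perms_invariantD[OF cyc _ inv_S[OF U(1)]]) simp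
      then show "V = {} \<or> V = B" using U(2) B(1) by blast
    qed
  next
    assume asm: "(\<forall>U\<subseteq>S. U \<inter> B = {} \<longrightarrow> c ` U = U \<longrightarrow> U = {}) \<and> c' \<circ> \<rho> \<in> cyclic_perms B"
    have meets: "U \<inter> B \<noteq> {}" if "U \<subseteq> S" "(c \<circ> \<rho>) ` U = U" "U \<noteq> {}" for U
    proof
      assume "U \<inter> B = {}"
      then show False using asm that avoid[of U] by (simp del: comp_apply)
    qed
    show "c \<circ> \<rho> \<in> cyclic_perms S"
    proof (rule cyclic_permsI[OF p])
      show "S \<noteq> {}" using B by blast
      fix U assume U: "U \<subseteq> S" "(c \<circ> \<rho>) ` U = U"
      have "(c' \<circ> \<rho>) ` (U \<inter> B) = U \<inter> B"
        using U(2) by (intro iffD1[OF ret] exI[of _ U] conjI Int_lower2 refl)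
      then have "U \<inter> B = {} \<or> U \<inter> B = B"
        by (intro cyclic_perms_invariantD[OF conjunct2[OF asm]] Int_lower2)
      then show "U = {} \<or> U = S"
      proof
        assume "U \<inter> B = B"
        then have "(S - U) \<inter> B = {}" by blast
        then have "S - U = {}" using meets[OF _ inv_D[OF U(2)]] by blast
        then show ?thesis using U(1) by blast
      qed (use meets[OF U] in blast)
    qed
  qed
qed

text \<open>A set that contains or avoids \<open>B\<close> is invariant under \<open>w\<close>
  exactly if it is invariant under \<open>w \<circ> \<rho>\<close>. Hence only the separation of
  \<open>Y\<close> from \<open>B - Y\<close> depends on \<open>\<rho>\<close>, and it is read off
  the return map. In \<open>A\<close> all of \<open>B\<close> sits at position \<open>i\<close>,
  while position \<open>j\<close> is empty.\<close>

lemma tuple_sep_first_return: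
  assumes ij: "i < length A" "j < length A" "i \<noteq> j" and A: "A ! i = B" "A ! j = {}"
    and w: "bij w" and \<rho>: "\<rho> permutes B" and Y: "Y \<subseteq> B"
    and ret: "(\<exists>U. (w \<circ> \<rho>) ` U = U \<and> U \<inter> B = Y) = ((w' \<circ> \<rho>) ` Y = Y)"
  shows "tuple_sep (w \<circ> \<rho>) (A[i := Y, j := B - Y]) \<longleftrightarrow> tuple_sep w A \<and> (w' \<circ> \<rho>) ` Y = Y"
proof -
  let ?A = "A[i := Y, j := B - Y]"
  have b: "bij (w \<circ> \<rho>)" using w permutes_bij[OF \<rho>] by (rule bij_comp[rotated])
  have nth: "?A ! i = Y" "?A ! j = B - Y" "\<And>l. l \<noteq> i \<Longrightarrow> l \<noteq> j \<Longrightarrow> ?A ! l = A ! l"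
    using ij by simp_all
  have eqB: "\<rho> ` U = U" if "B \<subseteq> U \<or> B \<inter> U = {}" for U
    using \<rho> that by (rule permutes_image_eq_self)
  have Y_iff: "sep_by (w \<circ> \<rho>) Y (B - Y) \<longleftrightarrow> (w' \<circ> \<rho>) ` Y = Y"
    unfolding ret[symmetric] sep_by_def using Y by blast
  show ?thesis
  proof
    assume sep: "tuple_sep (w \<circ> \<rho>) ?A"
    have s: "sep_by (w \<circ> \<rho>) (?A ! l) (?A ! l')" if "l < length A" "l' < length A" "l \<noteq> l'" for l l'
      using sep that unfolding tuple_sep_def by simp
    have sY: "sep_by (w \<circ> \<rho>) Y (B - Y)" using s[OF ij] nth by simp
    have sB: "\<exists>U. (w \<circ> \<rho>) ` U = U \<and> w ` U = U \<and> B \<subseteq> U \<and> A ! l \<inter> U = {}"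
      if l: "l < length A" "l \<noteq> i" "l \<noteq> j" for l
    proof -
      have "sep_by (w \<circ> \<rho>) (Y \<union> (B - Y)) (A ! l)"
        using s[of i l] s[of j l] nth l ij by (intro sep_by_Un) auto
      then obtain U where U: "(w \<circ> \<rho>) ` U = U" "B \<subseteq> U" "A ! l \<inter> U = {}"
        unfolding sep_by_def using Y by blast
      moreover have "w ` U = U" using U(1,2) eqB[of U] image_comp_fixed by metis
      ultimately show ?thesis by blast
    qed
    have "sep_by w (A ! l) (A ! l')" if l: "l < length A" "l' < length A" "l \<noteq> l'" for l l'
    proof -
      consider "l = i" "l' \<noteq> j" | "l' = i" "l \<noteq> j" | "l = j \<or> l' = j"
        | "l \<noteq> i" "l \<noteq> j" "l' \<noteq> i" "l' \<noteq> j" by blast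
      then show ?thesis
      proof cases
        case 1
        then show ?thesis using sB[of l'] l A unfolding sep_by_def by auto
      next
        case 2
        then have "sep_by w (A ! l') (A ! l)" using sB[of l] l A unfolding sep_by_def by auto
        then show ?thesis by (rule sep_by_sym[OF w])
      next
        case 3
        then show ?thesis
        proof
          assume "l = j"
          then show ?thesis using A by (intro sep_byI[of _ "{}"]) auto
        next
          assume "l' = j"
          then show ?thesis using A bij_is_surj[OF w] by (intro sep_byI[of _ UNIV]) auto
        qed
      next
        case 4
        obtain U where U: "(w \<circ> \<rho>) ` U = U" "A ! l \<subseteq> U" "A ! l' \<inter> U = {}"
          using s[OF l] nth 4 unfolding sep_by_def by auto
        obtain V where V: "(w \<circ> \<rho>) ` V = V" "B \<subseteq> V" "A ! l \<inter> V = {}"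
          using sB[of l] 4 l by blast
        \<comment> \<open>Cutting away \<open>V\<close>, which contains \<open>B\<close>, makes the
          separating set disjoint from \<open>B\<close>, so that \<open>\<rho>\<close> does not move
          it.\<close>
        have "(w \<circ> \<rho>) ` (U - V) = U - V"
          using image_set_diff[OF bij_is_inj[OF b], of U V] U(1) V(1) by simp
        moreover have "\<rho> ` (U - V) = U - V" using V(2) by (intro eqB) blast
        ultimately have "w ` (U - V) = U - V" by (metis image_comp)
        then show ?thesis using U V by (intro sep_byI[of _ "U - V"]) auto
      qed
    qed
    then show "tuple_sep w A \<and> (w' \<circ> \<rho>) ` Y = Y"
      using sY Y_iff unfolding tuple_sep_def by blast
  next
    assume asm: "tuple_sep w A \<and> (w' \<circ> \<rho>) ` Y = Y"
    then have s: "sep_by w (A ! l) (A ! l')" if "l < length A" "l' < length A" "l \<noteq> l'" for l l'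
      using that unfolding tuple_sep_def by simp
    have sY: "sep_by (w \<circ> \<rho>) Y (B - Y)" using asm Y_iff by simp
    have sB: "\<exists>U. (w \<circ> \<rho>) ` U = U \<and> w ` U = U \<and> B \<subseteq> U \<and> A ! l \<inter> U = {}"
      if l: "l < length A" "l \<noteq> i" "l \<noteq> j" for l
    proof -
      obtain U where U: "w ` U = U" "B \<subseteq> U" "A ! l \<inter> U = {}"
        using s[of i l] A l ij unfolding sep_by_def by auto
      moreover have "(w \<circ> \<rho>) ` U = U" using U(1,2) eqB[of U] image_comp_fixed by metis
      ultimately show ?thesis by blast
    qed
    have sBl: "sep_by (w \<circ> \<rho>) Z (A ! l)" if "Z \<subseteq> B" "l < length A" "l \<noteq> i" "l \<noteq> j" for l Z
      using sB[OF that(2-4)] that(1) unfolding sep_by_def by blast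
    have "sep_by (w \<circ> \<rho>) (?A ! l) (?A ! l')" if l: "l < length A" "l' < length A" "l \<noteq> l'" for l l'
    proof -
      consider "l = i" "l' = j" | "l = j" "l' = i" | "l \<in> {i, j}" "l' \<notin> {i, j}"
        | "l \<notin> {i, j}" "l' \<in> {i, j}" | "l \<notin> {i, j}" "l' \<notin> {i, j}" using l(3) by blast
      then show ?thesis
      proof cases
        case 1
        then show ?thesis using sY nth by simp
      next
        case 2
        then show ?thesis using sep_by_sym[OF b sY] nth by simp
      next
        case 3
        then have "?A ! l \<subseteq> B" using nth Y by auto
        then show ?thesis using sBl[of "?A ! l" l'] 3 l nth(3) by simp
      next
        case 4
        then have "?A ! l' \<subseteq> B" using nth Y by auto
        then have "sep_by (w \<circ> \<rho>) (?A ! l') (?A ! l)" using sBl[of "?A ! l'" l] 4 l nth(3) by simp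
        then show ?thesis by (rule sep_by_sym[OF b])
      next
        case 5
        obtain U where U: "w ` U = U" "A ! l \<subseteq> U" "A ! l' \<inter> U = {}"
          using s[OF l] unfolding sep_by_def by auto
        obtain V where V: "w ` V = V" "B \<subseteq> V" "A ! l \<inter> V = {}"
          using sB[of l] 5 l by blast
        have "w ` (U - V) = U - V"
          using image_set_diff[OF bij_is_inj[OF w], of U V] U(1) V(1) by simp
        moreover have "\<rho> ` (U - V) = U - V" using V(2) by (intro eqB) blast
        ultimately have "(w \<circ> \<rho>) ` (U - V) = U - V" by (metis image_comp)
        then have "sep_by (w \<circ> \<rho>) (A ! l) (A ! l')"
          by (rule sep_byI) (use U V in auto)
        then show ?thesis using nth(3) 5 by simp
      qed
    qed
    then show "tuple_sep (w \<circ> \<rho>) ?A" unfolding tuple_sep_def by simp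
  qed
qed

section \<open>Pairs of a cyclic permutation and a subset whose image is prescribed\<close>

lemma card_subsets_moving:
  assumes "finite B" "x \<in> B" "y \<in> B" "x \<noteq> y" "1 \<le> a"
  shows "card {Y. Y \<subseteq> B \<and> card Y = a \<and> x \<in> Y \<and> y \<notin> Y} = (card B - 2) choose (a - 1)"
proof -
  let ?C = "B - {x, y}"
  have "bij_betw (insert x) {Z. Z \<subseteq> ?C \<and> card Z = a - 1} {Y. Y \<subseteq> B \<and> card Y = a \<and> x \<in> Y \<and> y \<notin> Y}"
  proof (rule bij_betw_byWitness[where f' = "\<lambda>Y. Y - {x}"])
    have fin: "finite Z" if "Z \<subseteq> B" for Z using that assms(1) finite_subset by blast
    show "insert x ` {Z. Z \<subseteq> ?C \<and> card Z = a - 1} \<subseteq> {Y. Y \<subseteq> B \<and> card Y = a \<and> x \<in> Y \<and> y \<notin> Y}"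
    proof (intro image_subsetI CollectI)
      fix Z assume "Z \<in> {Z. Z \<subseteq> ?C \<and> card Z = a - 1}"
      then have Z: "Z \<subseteq> ?C" "card Z = a - 1" "finite Z" using fin[of Z] by auto
      have "x \<notin> Z" "y \<notin> Z" using Z(1) by auto
      then show "insert x Z \<subseteq> B \<and> card (insert x Z) = a \<and> x \<in> insert x Z \<and> y \<notin> insert x Z"
        using Z assms by auto
    qed
    show "(\<lambda>Y. Y - {x}) ` {Y. Y \<subseteq> B \<and> card Y = a \<and> x \<in> Y \<and> y \<notin> Y} \<subseteq> {Z. Z \<subseteq> ?C \<and> card Z = a - 1}"
    proof (intro image_subsetI CollectI)
      fix Y assume "Y \<in> {Y. Y \<subseteq> B \<and> card Y = a \<and> x \<in> Y \<and> y \<notin> Y}"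
      then have "Y \<subseteq> B" "card Y = a" "x \<in> Y" "y \<notin> Y" by auto
      then show "Y - {x} \<subseteq> ?C \<and> card (Y - {x}) = a - 1" using fin[of Y] by auto
    qed
  qed auto
  then have "card {Y. Y \<subseteq> B \<and> card Y = a \<and> x \<in> Y \<and> y \<notin> Y} = card {Z. Z \<subseteq> ?C \<and> card Z = a - 1}"
    by (rule bij_betw_same_card[symmetric])
  also have "\<dots> = card ?C choose (a - 1)" using assms(1) by (simp add: n_subsets)
  also have "card ?C = card B - 2" using assms by (simp add: card_Diff_subset)
  finally show ?thesis .
qed

text \<open>Double counting: the image of \<open>Y\<close> under \<open>\<tau>\<close> leaves
  \<open>Y\<close> in as many points as there are \<open>x\<close> in \<open>Y\<close> with
  \<open>\<tau> x\<close> not in \<open>Y\<close>. A moved point \<open>x\<close> has this property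
  for \<open>(card B - 2) choose (a - 1)\<close> sets \<open>Y\<close>, and this binomial combines
  with the factorials \<open>fact (a - 1)\<close> and \<open>fact (card B - a - 1)\<close> to
  \<open>fact (card B - 2)\<close>.\<close>

lemma card_cyclic_perms_agreeing:
  assumes B: "finite B" and \<tau>: "\<tau> permutes B" and a: "1 \<le> a" "a < card B"
  shows "card {(d, Y). d \<in> cyclic_perms B \<and> Y \<subseteq> B \<and> card Y = a \<and> d ` Y = \<tau> ` Y}
    = fact (card B - 2) * card {x \<in> B. \<tau> x \<noteq> x}"
proof -
  let ?P = "{Y. Y \<subseteq> B \<and> card Y = a}"
  have finP: "finite ?P" using B by simp
  have finY: "finite Y" if "Y \<in> ?P" for Y using that B finite_subset by blast
  have "card {(d, Y). d \<in> cyclic_perms B \<and> Y \<subseteq> B \<and> card Y = a \<and> d ` Y = \<tau> ` Y}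
    = (\<Sum>Y\<in>?P. card {d \<in> cyclic_perms B. d ` Y = \<tau> ` Y})"
    using card_Collect_pairs_snd[OF finite_cyclic_perms[OF B] finP, of "\<lambda>d Y. d ` Y = \<tau> ` Y"]
    by (simp add: conj_assoc)
  also have "\<dots> = (\<Sum>Y\<in>?P. fact (a - 1) * fact (card B - a - 1) * card {x \<in> B. x \<in> Y \<and> \<tau> x \<notin> Y})"
  proof (rule sum.cong[OF refl])
    fix Y assume Y: "Y \<in> ?P"
    have im: "\<tau> ` Y \<subseteq> B" using Y permutes_in_image[OF \<tau>] by auto
    have "card (\<tau> ` Y) = a" using Y card_image[OF permutes_inj_on[OF \<tau>]] by auto
    then have "card {d \<in> cyclic_perms B. d ` Y = \<tau> ` Y}
        = fact (a - 1) * fact (card B - a - 1) * card (\<tau> ` Y - Y)"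
      using Y im a by (intro card_cyclic_perms_image_eq[OF B]) auto
    also have "\<tau> ` Y - Y = \<tau> ` {x \<in> B. x \<in> Y \<and> \<tau> x \<notin> Y}" using Y by auto
    finally show "card {d \<in> cyclic_perms B. d ` Y = \<tau> ` Y}
        = fact (a - 1) * fact (card B - a - 1) * card {x \<in> B. x \<in> Y \<and> \<tau> x \<notin> Y}"
      by (simp add: card_image[OF permutes_inj_on[OF \<tau>]])
  qed
  also have "\<dots> = fact (a - 1) * fact (card B - a - 1)
      * (\<Sum>Y\<in>?P. card {x \<in> B. x \<in> Y \<and> \<tau> x \<notin> Y})"
    by (simp add: sum_distrib_left)
  also have "(\<Sum>Y\<in>?P. card {x \<in> B. x \<in> Y \<and> \<tau> x \<notin> Y}) = (\<Sum>x\<in>B. card {Y \<in> ?P. x \<in> Y \<and> \<tau> x \<notin> Y})"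
    by (rule sum_multicount_gen[OF finP B]) simp
  also have "\<dots> = (\<Sum>x\<in>B. if \<tau> x \<noteq> x then (card B - 2) choose (a - 1) else 0)"
  proof (rule sum.cong[OF refl])
    fix x assume x: "x \<in> B"
    show "card {Y \<in> ?P. x \<in> Y \<and> \<tau> x \<notin> Y} = (if \<tau> x \<noteq> x then (card B - 2) choose (a - 1) else 0)"
    proof (cases "\<tau> x = x")
      case True
      then have "{Y \<in> ?P. x \<in> Y \<and> \<tau> x \<notin> Y} = {}" by simp
      then show ?thesis using True by (metis card.empty)
    next
      case False
      have "\<tau> x \<in> B" using x permutes_in_image[OF \<tau>] by simp
      then show ?thesis using card_subsets_moving[OF B x, of "\<tau> x" a] False a by (simp add: conj_assoc)
    qed
  qed
  also have "\<dots> = card {x \<in> B. \<tau> x \<noteq> x} * ((card B - 2) choose (a - 1))"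
    using B by (simp add: sum.inter_filter[symmetric])
  also have "fact (a - 1) * fact (card B - a - 1) * (card {x \<in> B. \<tau> x \<noteq> x} * ((card B - 2) choose (a - 1)))
    = (fact (a - 1) * fact ((card B - 2) - (a - 1)) * ((card B - 2) choose (a - 1))) * card {x \<in> B. \<tau> x \<noteq> x}"
  proof -
    have "card B - a - 1 = (card B - 2) - (a - 1)" using a by simp
    then show ?thesis by (simp add: mult_ac)
  qed
  also have "fact (a - 1) * fact ((card B - 2) - (a - 1)) * ((card B - 2) choose (a - 1)) = fact (card B - 2)"
    using a by (intro binomial_fact_lemma) simp
  finally show ?thesis .
qed

section \<open>Symmetry of the separation counts\<close>

text \<open>The ground set is arbitrary because points are added to it one at a time. Entries
  \<open>0\<close> are allowed: they hold the place of a part that has been merged into another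
  one.\<close>

definition dtuples :: "'a set \<Rightarrow> nat list \<Rightarrow> 'a set list set" where
  "dtuples S \<beta> = {A. length A = length \<beta>
     \<and> (\<forall>i < length \<beta>. A ! i \<subseteq> S \<and> card (A ! i) = \<beta> ! i)
     \<and> (\<forall>i < length \<beta>. \<forall>j < length \<beta>. i \<noteq> j \<longrightarrow> A ! i \<inter> A ! j = {})}"

lemma finite_dtuples:
  assumes "finite S"
  shows "finite (dtuples S \<beta>)"
proof (rule finite_subset)
  show "dtuples S \<beta> \<subseteq> {A. set A \<subseteq> Pow S \<and> length A = length \<beta>}"
    by (fastforce simp: dtuples_def in_set_conv_nth)
  show "finite {A. set A \<subseteq> Pow S \<and> length A = length \<beta>}"
    using assms by (intro finite_lists_length_eq) simp
qed

definition sepcount :: "'a set \<Rightarrow> ('a \<Rightarrow> 'a) \<Rightarrow> nat list \<Rightarrow> nat" where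
  "sepcount S \<pi> \<beta> = card {(c, A). c \<in> cyclic_perms S \<and> A \<in> dtuples S \<beta> \<and> tuple_sep (\<pi> \<circ> c) A}"

text \<open>Along the coset of \<open>c\<close>, cyclicity and separation reduce to the return maps
  \<open>c'\<close> and \<open>w'\<close> on \<open>B\<close>, apart from a condition
  \<open>R\<close> that involves neither \<open>\<rho>\<close> nor \<open>Y\<close>. So
  \<open>h\<close> is either \<open>0\<close> or the number from
  \<open>card_cyclic_perms_agreeing\<close>.\<close>

lemma card_coset_splittings:
  assumes S: "finite S" and \<pi>: "\<pi> permutes S" and c: "c permutes S" and B: "B \<subseteq> S"
    and ij: "i < length A" "j < length A" "i \<noteq> j" and A: "A ! i = B" "A ! j = {}"
  obtains h where "\<And>a. 1 \<le> a \<Longrightarrow> a < card B \<Longrightarrow>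
    card {(\<rho>, Y). \<rho> \<in> {\<rho>. \<rho> permutes B} \<and> Y \<in> {Y. Y \<subseteq> B \<and> card Y = a} \<and>
      c \<circ> \<rho> \<in> cyclic_perms S \<and> tuple_sep (\<pi> \<circ> (c \<circ> \<rho>)) (A[i := Y, j := B - Y])} = h"
proof -
  define E where "E a = {(\<rho>, Y). \<rho> \<in> {\<rho>. \<rho> permutes B} \<and> Y \<in> {Y. Y \<subseteq> B \<and> card Y = a} \<and>
      c \<circ> \<rho> \<in> cyclic_perms S \<and> tuple_sep (\<pi> \<circ> (c \<circ> \<rho>)) (A[i := Y, j := B - Y])}" for a
  have finB: "finite B" using B S finite_subset by blast
  have w: "\<pi> \<circ> c permutes S" using \<pi> c by (rule permutes_compose[rotated])
  have first_return: "\<exists>v'. v' permutes B \<and> (\<forall>\<rho> V. \<rho> permutes B \<longrightarrow> V \<subseteq> B \<longrightarrow>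
      (\<exists>U. (v \<circ> \<rho>) ` U = U \<and> U \<inter> B = V) = ((v' \<circ> \<rho>) ` V = V))" if "v permutes S" for v
    using S that by (intro ex_first_return[of "S - B"]) (auto simp: Un_absorb1[OF B])
  from first_return[OF c] obtain c' where c': "c' permutes B" and
    c'_ret: "\<forall>\<rho> V. \<rho> permutes B \<longrightarrow> V \<subseteq> B \<longrightarrow>
      (\<exists>U. (c \<circ> \<rho>) ` U = U \<and> U \<inter> B = V) = ((c' \<circ> \<rho>) ` V = V)"
    by (elim exE conjE)
  from first_return[OF w] obtain w' where w': "w' permutes B" and
    w'_ret: "\<forall>\<rho> V. \<rho> permutes B \<longrightarrow> V \<subseteq> B \<longrightarrow>
      (\<exists>U. (\<pi> \<circ> c \<circ> \<rho>) ` U = U \<and> U \<inter> B = V) = ((w' \<circ> \<rho>) ` V = V)"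
    by (elim exE conjE)
  define R where "R \<longleftrightarrow> (\<forall>U\<subseteq>S. U \<inter> B = {} \<longrightarrow> c ` U = U \<longrightarrow> U = {}) \<and> tuple_sep (\<pi> \<circ> c) A"
  \<comment> \<open>\<open>w' \<circ> \<rho>\<close> preserves \<open>Y\<close> exactly if
    \<open>\<rho>\<close> maps \<open>Y\<close> onto its preimage under \<open>w'\<close>; applying
    \<open>c'\<close> turns this into a condition on \<open>d = c' \<circ> \<rho>\<close> alone,
    namely that \<open>d\<close> and \<open>\<tau>\<close> have the same image on
    \<open>Y\<close>.\<close>
  define \<tau> where "\<tau> = c' \<circ> inv w'"
  have \<tau>: "\<tau> permutes B" unfolding \<tau>_def using c' w' by (intro permutes_compose permutes_inv)
  have "card (E a) = (if R then fact (card B - 2) * card {x \<in> B. \<tau> x \<noteq> x} else 0)"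
    if a: "1 \<le> a" "a < card B" for a
  proof -
    have "B \<noteq> {}" using a by auto
    have iff: "c \<circ> \<rho> \<in> cyclic_perms S \<and> tuple_sep (\<pi> \<circ> (c \<circ> \<rho>)) (A[i := Y, j := B - Y])
        \<longleftrightarrow> R \<and> c' \<circ> \<rho> \<in> cyclic_perms B \<and> (c' \<circ> \<rho>) ` Y = \<tau> ` Y"
      if \<rho>: "\<rho> permutes B" and Y: "Y \<subseteq> B" for \<rho> Y
    proof -
      have "(w' \<circ> \<rho>) ` Y = Y \<longleftrightarrow> \<rho> ` Y = inv w' ` Y"
        unfolding image_comp[symmetric]
        using image_inv_f_f[OF permutes_inj[OF w']] image_f_inv_f[OF permutes_surj[OF w']] by metis
      also have "\<dots> \<longleftrightarrow> (c' \<circ> \<rho>) ` Y = \<tau> ` Y"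
        unfolding \<tau>_def image_comp[symmetric] using permutes_inj[OF c'] by (simp add: inj_image_eq_iff)
      finally have ret_iff: "(w' \<circ> \<rho>) ` Y = Y \<longleftrightarrow> (c' \<circ> \<rho>) ` Y = \<tau> ` Y" .
      have "c \<circ> \<rho> \<in> cyclic_perms S \<longleftrightarrow> (\<forall>U\<subseteq>S. U \<inter> B = {} \<longrightarrow> c ` U = U \<longrightarrow> U = {})
          \<and> c' \<circ> \<rho> \<in> cyclic_perms B"
        by (rule cyclic_perms_first_return[OF B \<open>B \<noteq> {}\<close> c \<rho> c']) (use c'_ret \<rho> in simp)
      moreover have "tuple_sep (\<pi> \<circ> (c \<circ> \<rho>)) (A[i := Y, j := B - Y])
          \<longleftrightarrow> tuple_sep (\<pi> \<circ> c) A \<and> (w' \<circ> \<rho>) ` Y = Y"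
        unfolding comp_assoc[symmetric]
        by (rule tuple_sep_first_return[OF ij A permutes_bij[OF w] \<rho> Y]) (use w'_ret \<rho> Y in simp)
      ultimately show ?thesis unfolding R_def ret_iff by blast
    qed
    have E: "E a = {(\<rho>, Y). \<rho> permutes B \<and> Y \<subseteq> B \<and> card Y = a \<and> R \<and> c' \<circ> \<rho> \<in> cyclic_perms B
        \<and> (c' \<circ> \<rho>) ` Y = \<tau> ` Y}"
    proof -
      have "(\<rho>, Y) \<in> E a \<longleftrightarrow> \<rho> permutes B \<and> Y \<subseteq> B \<and> card Y = a \<and> R \<and> c' \<circ> \<rho> \<in> cyclic_perms B
        \<and> (c' \<circ> \<rho>) ` Y = \<tau> ` Y" for \<rho> Y
        using iff[of \<rho> Y] unfolding E_def by blast
      then show ?thesis by (intro set_eqI) (simp only: split_paired_all mem_Collect_eq case_prod_conv)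
    qed
    show ?thesis
    proof (cases R)
      case False
      then have "E a = {}" unfolding E by simp
      then show ?thesis using False by simp
    next
      case True
      have "bij_betw (\<lambda>(\<rho>, Y). (c' \<circ> \<rho>, Y)) (E a)
        {(d, Y). d \<in> cyclic_perms B \<and> Y \<subseteq> B \<and> card Y = a \<and> d ` Y = \<tau> ` Y}" (is "bij_betw _ _ ?F")
      proof (rule bij_betw_byWitness[where f' = "\<lambda>(d, Y). (inv c' \<circ> d, Y)"])
        have id: "inv c' \<circ> (c' \<circ> f) = f" "c' \<circ> (inv c' \<circ> f) = f" for f
          using permutes_inv_o[OF c'] by (simp_all add: comp_assoc[symmetric])
        show "\<forall>p\<in>E a. (\<lambda>(d, Y). (inv c' \<circ> d, Y)) ((\<lambda>(\<rho>, Y). (c' \<circ> \<rho>, Y)) p) = p"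
          by (intro ballI) (simp only: split_def fst_conv snd_conv id(1) prod.collapse)
        show "\<forall>p\<in>?F. (\<lambda>(\<rho>, Y). (c' \<circ> \<rho>, Y)) ((\<lambda>(d, Y). (inv c' \<circ> d, Y)) p) = p"
          by (intro ballI) (simp only: split_def fst_conv snd_conv id(2) prod.collapse)
        show "(\<lambda>(\<rho>, Y). (c' \<circ> \<rho>, Y)) ` E a \<subseteq> ?F"
          unfolding E by (rule image_subsetI) (elim CollectE case_prodE, simp)
        show "(\<lambda>(d, Y). (inv c' \<circ> d, Y)) ` ?F \<subseteq> E a"
        proof (rule image_subsetI)
          fix p assume "p \<in> ?F"
          then obtain d Y where p: "p = (d, Y)" "d \<in> cyclic_perms B" "Y \<subseteq> B" "card Y = a" "d ` Y = \<tau> ` Y"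
            by blast
          have "inv c' \<circ> d permutes B"
            using cyclic_permsD[OF p(2)] permutes_inv[OF c'] by (rule permutes_compose)
          then show "(\<lambda>(d, Y). (inv c' \<circ> d, Y)) p \<in> E a"
            unfolding E p(1) mem_Collect_eq case_prod_conv id(2) using p True by blast
        qed
      qed
      then have "card (E a) = card ?F" by (rule bij_betw_same_card)
      then show ?thesis using card_cyclic_perms_agreeing[OF finB \<tau> a] True by simp
    qed
  qed
  then show thesis using that unfolding E_def by blast
qed

text \<open>No coset representatives are chosen: when \<open>c\<close> runs through all permutations
  of \<open>S\<close> and \<open>\<rho>\<close> through those of \<open>B\<close>, every permutation
  of \<open>S\<close> occurs as \<open>c \<circ> \<rho>\<close> exactly \<open>fact (card B)\<close>
  times. For this reason cyclicity is a condition inside \<open>g\<close> and not a restriction of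
  the range of \<open>c\<close>.\<close>

lemma sum_card_splittings_eq:
  assumes S: "finite S" and \<pi>: "\<pi> permutes S" and B: "B \<subseteq> S"
    and ij: "i < length A" "j < length A" "i \<noteq> j" and A: "A ! i = B" "A ! j = {}"
    and a: "1 \<le> a" "a < card B" and b: "1 \<le> b" "b < card B"
  shows "(\<Sum>c\<in>cyclic_perms S. card {Y. Y \<subseteq> B \<and> card Y = a \<and> tuple_sep (\<pi> \<circ> c) (A[i := Y, j := B - Y])})
    = (\<Sum>c\<in>cyclic_perms S. card {Y. Y \<subseteq> B \<and> card Y = b \<and> tuple_sep (\<pi> \<circ> c) (A[i := Y, j := B - Y])})"
proof -
  let ?SymS = "{c. c permutes S}" and ?SymB = "{\<rho>. \<rho> permutes B}"
  define P where "P a = {Y. Y \<subseteq> B \<and> card Y = a}" for a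
  define g where "g a c = card {Y \<in> P a. c \<in> cyclic_perms S \<and> tuple_sep (\<pi> \<circ> c) (A[i := Y, j := B - Y])}" for a c
  have finB: "finite B" using B S finite_subset by blast
  have fin: "finite ?SymS" "finite ?SymB" "finite (P a)" for a
    using S finB by (auto simp: finite_permutations P_def)
  have "\<exists>h. \<forall>a. 1 \<le> a \<longrightarrow> a < card B \<longrightarrow> (\<Sum>\<rho>\<in>?SymB. g a (c \<circ> \<rho>)) = h" if "c \<in> ?SymS" for c
  proof -
    have "c permutes S" using that by simp
    from card_coset_splittings[OF S \<pi> this B ij A] obtain h where "\<And>a. 1 \<le> a \<Longrightarrow> a < card B \<Longrightarrow>
      card {(\<rho>, Y). \<rho> \<in> ?SymB \<and> Y \<in> P a \<and>
        c \<circ> \<rho> \<in> cyclic_perms S \<and> tuple_sep (\<pi> \<circ> (c \<circ> \<rho>)) (A[i := Y, j := B - Y])} = h"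
      unfolding P_def by blast
    then show ?thesis unfolding card_Collect_pairs_fst[OF fin(2,3)] g_def by blast
  qed
  then have "\<forall>c\<in>?SymS. \<exists>h. \<forall>a. 1 \<le> a \<longrightarrow> a < card B \<longrightarrow> (\<Sum>\<rho>\<in>?SymB. g a (c \<circ> \<rho>)) = h" by blast
  from bchoice[OF this] obtain h where
    h: "\<forall>c\<in>?SymS. \<forall>a. 1 \<le> a \<longrightarrow> a < card B \<longrightarrow> (\<Sum>\<rho>\<in>?SymB. g a (c \<circ> \<rho>)) = h c" ..
  have avg: "fact (card B) * (\<Sum>c\<in>?SymS. g a c) = (\<Sum>c\<in>?SymS. h c)" if "1 \<le> a" "a < card B" for a
  proof -
    have shift: "(\<Sum>c\<in>?SymS. g a (c \<circ> \<rho>)) = (\<Sum>c\<in>?SymS. g a c)" if "\<rho> \<in> ?SymB" for \<rho>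
    proof -
      have \<rho>: "\<rho> permutes S" using that B permutes_subset by blast
      have "bij_betw (\<lambda>c. c \<circ> \<rho>) ?SymS ?SymS"
        by (rule bij_betw_byWitness[where f' = "\<lambda>c. c \<circ> inv \<rho>"])
          (use \<rho> permutes_inv[OF \<rho>] permutes_inv_o[OF \<rho>] in \<open>auto simp: comp_assoc permutes_compose\<close>)
      then show ?thesis by (rule sum.reindex_bij_betw)
    qed
    have "(\<Sum>c\<in>?SymS. h c) = (\<Sum>c\<in>?SymS. \<Sum>\<rho>\<in>?SymB. g a (c \<circ> \<rho>))"
      using h that by simp
    also have "\<dots> = (\<Sum>\<rho>\<in>?SymB. \<Sum>c\<in>?SymS. g a (c \<circ> \<rho>))" by (rule sum.swap)
    also have "\<dots> = (\<Sum>\<rho>\<in>?SymB. \<Sum>c\<in>?SymS. g a c)" using shift by simp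
    finally show ?thesis using card_permutations[OF refl finB] by simp
  qed
  have "(\<Sum>c\<in>?SymS. g a c) = (\<Sum>c\<in>cyclic_perms S. card {Y. Y \<subseteq> B \<and> card Y = a \<and>
      tuple_sep (\<pi> \<circ> c) (A[i := Y, j := B - Y])})" for a
  proof (rule sum.mono_neutral_cong_right[OF fin(1)])
    show "\<forall>c\<in>?SymS - cyclic_perms S. g a c = 0" by (simp add: g_def)
  qed (auto simp: g_def P_def conj_assoc dest: cyclic_permsD)
  then show ?thesis using avg[OF a] avg[OF b] by (metis fact_nonzero mult_left_cancel)
qed

section \<open>Splitting a part in two and moving points between parts\<close>

text \<open>The inverse puts the union at position \<open>i\<close> and the empty set at position
  \<open>j\<close>, so that no other part is renumbered.\<close>

lemma bij_betw_dtuples_split: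
  assumes S: "finite S" and ij: "i < length \<beta>" "j < length \<beta>" "i \<noteq> j"
  shows "bij_betw (\<lambda>(A, Y). A[i := Y, j := A ! i - Y])
    (SIGMA A:dtuples S (\<beta>[i := \<beta> ! i + \<beta> ! j, j := 0]). {Y. Y \<subseteq> A ! i \<and> card Y = \<beta> ! i})
    (dtuples S \<beta>)"
    (is "bij_betw ?f ?X ?D")
proof (rule bij_betw_byWitness[where f' = "\<lambda>A. (A[i := A ! i \<union> A ! j, j := {}], A ! i)"])
  let ?\<beta> = "\<beta>[i := \<beta> ! i + \<beta> ! j, j := 0]"
  have fin: "finite Z" if "Z \<subseteq> S" for Z using that S finite_subset by blast
  have ex: "\<exists>A Y. p = (A, Y) \<and> length A = length \<beta> \<and> A ! i \<subseteq> S \<and> card (A ! i) = \<beta> ! i + \<beta> ! j \<and> A ! j = {}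
    \<and> Y \<subseteq> A ! i \<and> card Y = \<beta> ! i
    \<and> (\<forall>l<length \<beta>. l \<noteq> i \<longrightarrow> l \<noteq> j \<longrightarrow> A ! l \<subseteq> S \<and> card (A ! l) = \<beta> ! l)
    \<and> (\<forall>l<length \<beta>. \<forall>l'<length \<beta>. l \<noteq> l' \<longrightarrow> A ! l \<inter> A ! l' = {})" if p: "p \<in> ?X" for p
  proof -
    obtain A Y where AY: "p = (A, Y)" "A \<in> dtuples S ?\<beta>" "Y \<subseteq> A ! i" "card Y = \<beta> ! i"
      using p by blast
    have nth: "A ! l \<subseteq> S \<and> card (A ! l) = ?\<beta> ! l" if "l < length \<beta>" for l
      using AY(2) that by (simp add: dtuples_def)
    have "A ! j = {}" using nth[OF ij(2)] fin[of "A ! j"] ij by simp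
    moreover have "A ! l \<subseteq> S \<and> card (A ! l) = \<beta> ! l" if "l < length \<beta>" "l \<noteq> i" "l \<noteq> j" for l
      using nth[OF that(1)] that by simp
    moreover have "A ! i \<subseteq> S" "card (A ! i) = \<beta> ! i + \<beta> ! j" using nth[OF ij(1)] ij by simp_all
    moreover have "length A = length \<beta>" "\<forall>l<length \<beta>. \<forall>l'<length \<beta>. l \<noteq> l' \<longrightarrow> A ! l \<inter> A ! l' = {}"
      using AY(2) by (simp_all add: dtuples_def)
    ultimately show ?thesis using AY by blast
  qed
  show "\<forall>p\<in>?X. (\<lambda>A. (A[i := A ! i \<union> A ! j, j := {}], A ! i)) (?f p) = p"
  proof
    fix p assume "p \<in> ?X"
    from ex[OF this] obtain A Y where AY: "p = (A, Y)" "length A = length \<beta>" "A ! j = {}" "Y \<subseteq> A ! i"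
      by blast
    then have "Y \<union> (A ! i - Y) = A ! i" by blast
    then have "A[i := Y, j := A ! i - Y, i := Y \<union> (A ! i - Y), j := {}] = A"
      using AY ij by (metis list_update_id list_update_overwrite list_update_swap)
    then show "(\<lambda>A. (A[i := A ! i \<union> A ! j, j := {}], A ! i)) (?f p) = p"
      using AY ij by simp
  qed
  show "\<forall>A\<in>?D. ?f ((\<lambda>A. (A[i := A ! i \<union> A ! j, j := {}], A ! i)) A) = A"
  proof
    fix A assume A: "A \<in> ?D"
    then have len: "length A = length \<beta>" and "A ! i \<inter> A ! j = {}" using ij by (simp_all add: dtuples_def)
    then have "A ! i \<union> A ! j - A ! i = A ! j" by blast
    moreover have "A[i := A ! i \<union> A ! j, j := {}, i := A ! i, j := A ! j] = A"
      using ij len by (metis list_update_id list_update_overwrite list_update_swap)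
    ultimately show "?f ((\<lambda>A. (A[i := A ! i \<union> A ! j, j := {}], A ! i)) A) = A"
      using ij len by simp
  qed
  show "?f ` ?X \<subseteq> ?D"
  proof (rule image_subsetI)
    fix p assume "p \<in> ?X"
    from ex[OF this] obtain A Y where AY: "p = (A, Y)" "length A = length \<beta>" "A ! i \<subseteq> S"
      "card (A ! i) = \<beta> ! i + \<beta> ! j" "Y \<subseteq> A ! i" "card Y = \<beta> ! i"
      and l: "\<forall>l<length \<beta>. l \<noteq> i \<longrightarrow> l \<noteq> j \<longrightarrow> A ! l \<subseteq> S \<and> card (A ! l) = \<beta> ! l"
      and dis: "\<forall>l<length \<beta>. \<forall>l'<length \<beta>. l \<noteq> l' \<longrightarrow> A ! l \<inter> A ! l' = {}"
      by (elim exE conjE)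
    have "finite Y" using AY(3,5) by (intro fin) blast
    then have cd: "card (A ! i - Y) = \<beta> ! j" using AY by (simp add: card_Diff_subset)
    have disi: "Z \<inter> A ! l = {}" "A ! l \<inter> Z = {}" if "Z \<subseteq> A ! i" "l < length \<beta>" "l \<noteq> i" for Z l
      using dis ij(1) that by blast+
    have "A[i := Y, j := A ! i - Y] \<in> ?D"
      unfolding dtuples_def mem_Collect_eq
    proof (intro conjI allI impI)
      fix l l' assume "l < length \<beta>" "l' < length \<beta>" "l \<noteq> l'"
      then show "A[i := Y, j := A ! i - Y] ! l \<inter> A[i := Y, j := A ! i - Y] ! l' = {}"
        using AY(2,5) ij dis disi[of Y] disi[of "A ! i - Y"] by (auto simp: nth_list_update)
    qed (use AY ij l cd in \<open>auto simp: nth_list_update\<close>)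
    then show "?f p \<in> ?D" using AY(1) by simp
  qed
  show "(\<lambda>A. (A[i := A ! i \<union> A ! j, j := {}], A ! i)) ` ?D \<subseteq> ?X"
  proof (rule image_subsetI)
    fix A assume "A \<in> ?D"
    then have A: "length A = length \<beta>" "\<And>l. l < length \<beta> \<Longrightarrow> A ! l \<subseteq> S \<and> card (A ! l) = \<beta> ! l"
      "\<And>l l'. l < length \<beta> \<Longrightarrow> l' < length \<beta> \<Longrightarrow> l \<noteq> l' \<Longrightarrow> A ! l \<inter> A ! l' = {}"
      by (simp_all add: dtuples_def)
    have cu: "card (A ! i \<union> A ! j) = \<beta> ! i + \<beta> ! j"
      using A(2)[OF ij(1)] A(2)[OF ij(2)] A(3)[OF ij] fin by (simp add: card_Un_disjoint)
    have "A[i := A ! i \<union> A ! j, j := {}] \<in> dtuples S ?\<beta>"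
      unfolding dtuples_def mem_Collect_eq length_list_update
    proof (intro conjI allI impI)
      fix l l' assume l: "l < length \<beta>" "l' < length \<beta>" "l \<noteq> l'"
      show "A[i := A ! i \<union> A ! j, j := {}] ! l \<inter> A[i := A ! i \<union> A ! j, j := {}] ! l' = {}"
        using A(1) ij l A(3)[OF l] A(3)[of i l'] A(3)[of j l'] A(3)[of l i] A(3)[of l j]
        by (auto simp: nth_list_update)
    next
      fix l assume l: "l < length \<beta>"
      show "A[i := A ! i \<union> A ! j, j := {}] ! l \<subseteq> S" "card (A[i := A ! i \<union> A ! j, j := {}] ! l) = ?\<beta> ! l"
        using A(1) A(2)[OF l] A(2)[OF ij(1)] A(2)[OF ij(2)] cu ij l by (auto simp: nth_list_update)
    qed (use A in simp)
    then show "(\<lambda>A. (A[i := A ! i \<union> A ! j, j := {}], A ! i)) A \<in> ?X"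
      using A(1) A(2)[OF ij(1)] ij by simp
  qed
qed

lemma sepcount_eq_sum_splittings:
  assumes S: "finite S" and ij: "i < length \<beta>" "j < length \<beta>" "i \<noteq> j"
  shows "sepcount S \<pi> \<beta> = (\<Sum>A\<in>dtuples S (\<beta>[i := \<beta> ! i + \<beta> ! j, j := 0]). \<Sum>c\<in>cyclic_perms S.
    card {Y. Y \<subseteq> A ! i \<and> card Y = \<beta> ! i \<and> tuple_sep (\<pi> \<circ> c) (A[i := Y, j := A ! i - Y])})"
proof -
  let ?D = "dtuples S (\<beta>[i := \<beta> ! i + \<beta> ! j, j := 0])"
  have fin: "finite {Y. Y \<subseteq> A ! i \<and> P Y}" if "A \<in> ?D" for A P
  proof -
    have "A ! i \<subseteq> S" using that ij by (simp add: dtuples_def)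
    then have "{Y. Y \<subseteq> A ! i \<and> P Y} \<subseteq> Pow S" by blast
    then show ?thesis using S by (meson finite_Pow_iff finite_subset)
  qed
  have "card {A \<in> dtuples S \<beta>. tuple_sep w A} =
    (\<Sum>A\<in>?D. card {Y. Y \<subseteq> A ! i \<and> card Y = \<beta> ! i \<and> tuple_sep w (A[i := Y, j := A ! i - Y])})" for w
  proof -
    have "card {A \<in> dtuples S \<beta>. tuple_sep w A} =
      card (SIGMA A:?D. {Y. Y \<subseteq> A ! i \<and> card Y = \<beta> ! i \<and> tuple_sep w (A[i := Y, j := A ! i - Y])})"
      unfolding card_Collect_bij_betw[OF bij_betw_dtuples_split[OF S ij]]
      by (rule arg_cong[of _ _ card]) auto
    then show ?thesis using fin finite_dtuples[OF S] by simp
  qed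
  then have "sepcount S \<pi> \<beta> = (\<Sum>c\<in>cyclic_perms S. \<Sum>A\<in>?D. card {Y. Y \<subseteq> A ! i \<and> card Y = \<beta> ! i \<and>
      tuple_sep (\<pi> \<circ> c) (A[i := Y, j := A ! i - Y])})"
    unfolding sepcount_def card_Collect_pairs_fst[OF finite_cyclic_perms[OF S] finite_dtuples[OF S]] by simp
  then show ?thesis by (simp only: sum.swap[of _ "cyclic_perms S"])
qed

text \<open>Both compositions become the same one when parts \<open>i\<close> and \<open>j\<close>
  are merged. The two counts are therefore sums over the same merged tuples, where
  \<open>sum_card_splittings_eq\<close> compares the summands.\<close>

lemma sepcount_move:
  assumes S: "finite S" and \<pi>: "\<pi> permutes S" and ij: "i < length \<beta>" "j < length \<beta>" "i \<noteq> j"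
    and pos: "1 \<le> \<beta> ! i" "1 \<le> \<beta> ! j" "1 \<le> x" "1 \<le> y" and sum: "x + y = \<beta> ! i + \<beta> ! j"
  shows "sepcount S \<pi> \<beta> = sepcount S \<pi> (\<beta>[i := x, j := y])"
proof -
  let ?\<gamma> = "\<beta>[i := x, j := y]" and ?D = "dtuples S (\<beta>[i := \<beta> ! i + \<beta> ! j, j := 0])"
  have \<gamma>: "i < length ?\<gamma>" "j < length ?\<gamma>" "?\<gamma> ! i = x" "?\<gamma> ! j = y" using ij by simp_all
  have "?\<gamma>[i := x + y, j := 0] = \<beta>[i := \<beta> ! i + \<beta> ! j, j := 0]"
    unfolding sum using ij(3) by (metis list_update_overwrite list_update_swap)
  then have "sepcount S \<pi> ?\<gamma> = (\<Sum>A\<in>?D. \<Sum>c\<in>cyclic_perms S. card {Y. Y \<subseteq> A ! i \<and> card Y = x \<and>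
      tuple_sep (\<pi> \<circ> c) (A[i := Y, j := A ! i - Y])})"
    using sepcount_eq_sum_splittings[OF S \<gamma>(1,2) ij(3), of \<pi>] unfolding \<gamma>(3,4) by simp
  also have "\<dots> = (\<Sum>A\<in>?D. \<Sum>c\<in>cyclic_perms S. card {Y. Y \<subseteq> A ! i \<and> card Y = \<beta> ! i \<and>
      tuple_sep (\<pi> \<circ> c) (A[i := Y, j := A ! i - Y])})"
  proof (rule sum.cong[OF refl])
    fix A assume "A \<in> ?D"
    then have A: "length A = length \<beta>" "A ! i \<subseteq> S" "card (A ! i) = \<beta> ! i + \<beta> ! j" "A ! j \<subseteq> S" "card (A ! j) = 0"
      using ij unfolding dtuples_def by auto
    then have "A ! j = {}" using S finite_subset by (metis card_0_eq)
    then show "(\<Sum>c\<in>cyclic_perms S. card {Y. Y \<subseteq> A ! i \<and> card Y = x \<and>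
        tuple_sep (\<pi> \<circ> c) (A[i := Y, j := A ! i - Y])})
      = (\<Sum>c\<in>cyclic_perms S. card {Y. Y \<subseteq> A ! i \<and> card Y = \<beta> ! i \<and>
        tuple_sep (\<pi> \<circ> c) (A[i := Y, j := A ! i - Y])})"
      using A ij pos sum by (intro sum_card_splittings_eq[OF S \<pi>]) auto
  qed
  also have "\<dots> = sepcount S \<pi> \<beta>" using sepcount_eq_sum_splittings[OF S ij] by simp
  finally show ?thesis by simp
qed

text \<open>The block of ones collects the parts already processed: each part \<open>x\<close> keeps
  one point and hands the other \<open>x - 1\<close> to the head, since \<open>sepcount_move\<close>
  requires both parts to stay nonempty.\<close>

lemma sepcount_Cons_replicate:
  assumes S: "finite S" and \<pi>: "\<pi> permutes S" and pos: "1 \<le> b" "\<forall>x \<in> set xs. 1 \<le> x"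
  shows "sepcount S \<pi> (b # replicate t 1 @ xs)
    = sepcount S \<pi> ((b + sum_list xs - length xs) # replicate (t + length xs) 1)"
  using pos
proof (induction xs arbitrary: b t)
  case Nil
  then show ?case by simp
next
  case (Cons x xs)
  have "sepcount S \<pi> (b # replicate t 1 @ x # xs)
    = sepcount S \<pi> ((b # replicate t 1 @ x # xs)[0 := b + x - 1, Suc t := 1])"
    using Cons.prems by (intro sepcount_move[OF S \<pi>]) (auto simp: nth_append)
  also have "(b # replicate t 1 @ x # xs)[0 := b + x - 1, Suc t := 1]
    = (b + x - 1) # replicate (Suc t) 1 @ xs"
    by (simp add: list_update_append replicate_app_Cons_same)
  also have "sepcount S \<pi> \<dots> = sepcount S \<pi> ((b + x - 1 + sum_list xs - length xs) # replicate (Suc t + length xs) 1)"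
    using Cons.prems by (intro Cons.IH) auto
  finally show ?case using Cons.prems by (simp add: add.assoc)
qed

lemma sepcount_symmetric:
  assumes "finite S" "\<pi> permutes S" "\<beta> \<noteq> []" "\<forall>b \<in> set \<beta>. 1 \<le> b"
  shows "sepcount S \<pi> \<beta>
    = sepcount S \<pi> ((sum_list \<beta> - length \<beta> + 1) # replicate (length \<beta> - 1) 1)"
proof (cases \<beta>)
  case (Cons b xs)
  have "length xs \<le> sum_list xs"
    using assms(4) Cons by (induction xs arbitrary: \<beta>) (auto simp: Cons)
  then have "b + sum_list xs - length xs = sum_list \<beta> - length \<beta> + 1"
    using assms(4) Cons by (simp del: One_nat_def)
  then show ?thesis
    using sepcount_Cons_replicate[OF assms(1,2), of b xs 0] assms(4) Cons by simp
qed (use assms in simp)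

section \<open>Adding fixed points\<close>

text \<open>The inserted point \<open>f\<close> belongs to the cycle of \<open>z\<close>, so it may
  be replaced by \<open>z\<close> before separation is tested for \<open>v\<close>;
  \<open>id(f := z)\<close> is this collapse.\<close>

lemma sep_by_comp_transpose:
  assumes "inj v" "v f = f"
  shows "sep_by (v \<circ> Transposition.transpose f z) X Y \<longleftrightarrow>
    sep_by v ((id(f := z)) ` X) ((id(f := z)) ` Y)"
proof
  assume "sep_by (v \<circ> Transposition.transpose f z) X Y"
  then obtain U where U: "(v \<circ> Transposition.transpose f z) ` U = U" "X \<subseteq> U" "Y \<inter> U = {}"
    unfolding sep_by_def by (elim exE conjE)
  have iff: "f \<in> U \<longleftrightarrow> z \<in> U" by (rule invariant_transpose_iff[OF assms U(1)])
  then have "v ` U = U" using U(1) image_comp_transpose by metis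
  then show "sep_by v ((id(f := z)) ` X) ((id(f := z)) ` Y)"
    by (rule sep_byI) (use U(2,3) iff in auto)
next
  assume "sep_by v ((id(f := z)) ` X) ((id(f := z)) ` Y)"
  then obtain U where U: "v ` U = U" "(id(f := z)) ` X \<subseteq> U" "(id(f := z)) ` Y \<inter> U = {}"
    unfolding sep_by_def by (elim exE conjE)
  define U' where "U' = (if z \<in> U then insert f U else U - {f})"
  have "v ` U' = U'"
    using image_fixed_insert_delete[OF assms U(1)] by (simp add: U'_def del: image_insert)
  moreover have "(v \<circ> Transposition.transpose f z) ` U' = v ` U'"
    by (rule image_comp_transpose) (auto simp: U'_def)
  ultimately have inv: "(v \<circ> Transposition.transpose f z) ` U' = U'" by metis
  have "x \<in> U'" if "x \<in> X" for x
    using U(2) that by (cases "x = f") (auto simp: U'_def image_subset_iff)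
  moreover have "y \<notin> U'" if "y \<in> Y" for y
  proof -
    have "(id(f := z)) y \<notin> U" using U(3) that by blast
    then show ?thesis by (cases "y = f") (auto simp: U'_def)
  qed
  ultimately show "sep_by (v \<circ> Transposition.transpose f z) X Y"
    by (intro sep_byI[OF inv]) blast+
qed

lemma tuple_sep_comp_transpose:
  assumes "inj v" "v f = f"
  shows "tuple_sep (v \<circ> Transposition.transpose f z) A \<longleftrightarrow> tuple_sep v (map ((`) (id(f := z))) A)"
  unfolding tuple_sep_def sep_by_comp_transpose[OF assms] by simp

lemma tuple_sep_disjoint:
  "tuple_sep v A \<Longrightarrow> i < length A \<Longrightarrow> j < length A \<Longrightarrow> i \<noteq> j \<Longrightarrow> A ! i \<inter> A ! j = {}"
  unfolding tuple_sep_def by (blast dest: sep_by_disjoint)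

lemma dtuplesD:
  assumes "A \<in> dtuples S \<beta>"
  shows "length A = length \<beta>"
    and "i < length \<beta> \<Longrightarrow> A ! i \<subseteq> S" and "i < length \<beta> \<Longrightarrow> card (A ! i) = \<beta> ! i"
    and "i < length \<beta> \<Longrightarrow> j < length \<beta> \<Longrightarrow> i \<noteq> j \<Longrightarrow> A ! i \<inter> A ! j = {}"
  using assms by (simp_all add: dtuples_def)

lemma dtuples_updateI:
  assumes A: "A \<in> dtuples S \<beta>" and i: "i < length \<beta>" and Y: "Y \<subseteq> T" "card Y = b"
    and l: "\<And>l. l < length \<beta> \<Longrightarrow> l \<noteq> i \<Longrightarrow> A ! l \<subseteq> T \<and> Y \<inter> A ! l = {}"
  shows "A[i := Y] \<in> dtuples T (\<beta>[i := b])"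
  unfolding dtuples_def mem_Collect_eq length_list_update
proof (intro conjI allI impI)
  fix j l' assume j: "j < length \<beta>" "l' < length \<beta>" "j \<noteq> l'"
  show "A[i := Y] ! j \<inter> A[i := Y] ! l' = {}"
    using dtuplesD(1)[OF A] dtuplesD(4)[OF A j] l[of j] l[of l'] i j
    by (cases "j = i"; cases "l' = i") (auto simp: Int_commute)
next
  fix j assume j: "j < length \<beta>"
  show "A[i := Y] ! j \<subseteq> T" "card (A[i := Y] ! j) = \<beta>[i := b] ! j"
    using dtuplesD(1,3)[OF A] l[of j] i j Y by (auto simp: nth_list_update)
qed (rule dtuplesD(1)[OF A])

text \<open>\<open>W0\<close>, \<open>W1\<close>, \<open>W2\<close> collect the cases of
  \<open>f\<close> in no part, in part \<open>i\<close> with \<open>z\<close>, and in part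
  \<open>i\<close> without \<open>z\<close>. In \<open>W1\<close> deleting \<open>f\<close> shortens
  the part, and \<open>z\<close> is one of its \<open>\<alpha> ! i - 1\<close> remaining points. In
  \<open>W2\<close> replacing \<open>f\<close> by \<open>z\<close> keeps all sizes, and
  \<open>z\<close> can be any of the \<open>\<alpha> ! i\<close> points of the new part; over all
  parts these choices add up to \<open>sum_list \<alpha>\<close>.\<close>

lemma card_tuple_sep_insert:
  fixes v :: "'a \<Rightarrow> 'a"
  assumes S: "finite S" and f: "f \<notin> S"
  defines "D \<equiv> \<lambda>\<alpha>. {A \<in> dtuples S \<alpha>. tuple_sep v A}"
  shows "card {(z, A). z \<in> S \<and> A \<in> dtuples (insert f S) \<alpha> \<and> tuple_sep v (map ((`) (id(f := z))) A)}
    = (card S + sum_list \<alpha>) * card (D \<alpha>)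
      + (\<Sum>i<length \<alpha>. (\<alpha> ! i - 1) * card (D (\<alpha>[i := \<alpha> ! i - 1])))"
proof -
  let ?k = "length \<alpha>" and ?S' = "insert f S"
  define W where "W = {(z, A). z \<in> S \<and> A \<in> dtuples ?S' \<alpha> \<and> tuple_sep v (map ((`) (id(f := z))) A)}"
  define W0 where "W0 = {(z, A). (z, A) \<in> W \<and> (\<forall>i<?k. f \<notin> A ! i)}"
  define W1 where "W1 i = {(z, A). (z, A) \<in> W \<and> f \<in> A ! i \<and> z \<in> A ! i}" for i
  define W2 where "W2 i = {(z, A). (z, A) \<in> W \<and> f \<in> A ! i \<and> z \<notin> A ! i}" for i
  have finD: "finite (D \<beta>)" for \<beta> using finite_dtuples[OF S] by (simp add: D_def)
  have finW: "finite W"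
    by (rule finite_subset[of _ "S \<times> dtuples ?S' \<alpha>"]) (use S finite_dtuples[of ?S'] in \<open>auto simp: W_def\<close>)
  have finY: "finite Y" if "Y \<subseteq> ?S'" for Y using that S by (meson finite.insertI finite_subset)
  have finA: "finite (A ! i)" if "A \<in> dtuples S \<beta>" "i < length \<beta>" for A i \<beta>
    using dtuplesD(2)[OF that] S by (rule finite_subset)
  have map_upd: "map ((`) (id(f := z))) A = A[i := insert z (A ! i - {f})]"
    if A: "A \<in> dtuples ?S' \<alpha>" and i: "i < ?k" "f \<in> A ! i" for z A i
  proof (rule nth_equalityI)
    fix l assume "l < length (map ((`) (id(f := z))) A)"
    then have l: "l < ?k" using dtuplesD(1)[OF A] by simp
    show "map ((`) (id(f := z))) A ! l = A[i := insert z (A ! i - {f})] ! l"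
    proof (cases "l = i")
      case True
      then show ?thesis using l dtuplesD(1)[OF A] i by auto
    next
      case False
      then have "f \<notin> A ! l" using dtuplesD(4)[OF A l i(1)] i(2) by blast
      then have "(id(f := z)) ` (A ! l) = A ! l" by (force simp: image_iff)
      then show ?thesis using l False dtuplesD(1)[OF A] by simp
    qed
  qed simp
  have W_iff: "(z, A) \<in> W \<longleftrightarrow> z \<in> S \<and> A \<in> dtuples ?S' \<alpha> \<and> tuple_sep v (A[i := insert z (A ! i - {f})])"
    if "i < ?k" "f \<in> A ! i" for z A i
    using map_upd[OF _ that] by (auto simp: W_def)
  have decomp: "W = W0 \<union> ((\<Union>i<?k. W1 i) \<union> (\<Union>i<?k. W2 i))"
    by (auto simp: W0_def W1_def W2_def)
  have uniq: "i = j" if "A \<in> dtuples ?S' \<alpha>" "i < ?k" "j < ?k" "f \<in> A ! i" "f \<in> A ! j" for A i j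
    using dtuplesD(4)[OF that(1-3)] that by blast
  have inW: "A \<in> dtuples ?S' \<alpha>" if "(z, A) \<in> W" for z A using that by (simp add: W_def)
  have fins: "finite W0" "finite (W1 i)" "finite (W2 i)" for i
    by (rule finite_subset[OF _ finW], force simp: W0_def W1_def W2_def)+
  have "card W = card W0 + ((\<Sum>i<?k. card (W1 i)) + (\<Sum>i<?k. card (W2 i)))"
  proof -
    have "card (\<Union>i<?k. W1 i) = (\<Sum>i<?k. card (W1 i))" "card (\<Union>i<?k. W2 i) = (\<Sum>i<?k. card (W2 i))"
      using fins uniq inW by (intro card_UN_disjoint; fastforce simp: W1_def W2_def)+
    moreover have "(\<Union>i<?k. W1 i) \<inter> (\<Union>i<?k. W2 i) = {}"
      using uniq inW by (fastforce simp: W1_def W2_def)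
    moreover have "W0 \<inter> ((\<Union>i<?k. W1 i) \<union> (\<Union>i<?k. W2 i)) = {}"
      by (auto simp: W0_def W1_def W2_def)
    ultimately show ?thesis unfolding decomp using fins by (subst card_Un_disjoint; simp add: card_Un_disjoint)
  qed
  moreover have "card W0 = card S * card (D \<alpha>)"
  proof -
    have "W0 = S \<times> D \<alpha>"
    proof -
      have mem: "A \<in> dtuples ?S' \<alpha> \<and> (\<forall>i<?k. f \<notin> A ! i) \<longleftrightarrow> A \<in> dtuples S \<alpha>" for A
        using f by (fastforce simp: dtuples_def)
      have map_id: "map ((`) (id(f := z))) A = A" if "A \<in> dtuples S \<alpha>" for z A
      proof (rule map_idI)
        fix Y assume "Y \<in> set A"
        then have "f \<notin> Y" using that f by (fastforce simp: dtuples_def in_set_conv_nth)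
        then show "(id(f := z)) ` Y = Y" by (force simp: image_iff)
      qed
      have "(z, A) \<in> W0 \<longleftrightarrow> (z, A) \<in> S \<times> D \<alpha>" for z A
        unfolding W0_def W_def D_def using mem[of A] map_id[of A z] by auto
      then show ?thesis by auto
    qed
    then show ?thesis by (simp add: card_cartesian_product)
  qed
  moreover have "card (W1 i) = (\<alpha> ! i - 1) * card (D (\<alpha>[i := \<alpha> ! i - 1]))" if i: "i < ?k" for i
  proof (cases "\<alpha> ! i")
    case 0
    have False if "(z, A) \<in> W" "f \<in> A ! i" for z A
      using dtuplesD(2,3)[OF inW[OF that(1)] i] finY that(2) 0 by (metis card_0_eq empty_iff)
    then have "W1 i = {}" unfolding W1_def by blast
    then show ?thesis using 0 by simp
  next
    case (Suc b)
    let ?\<beta> = "\<alpha>[i := b]"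
    have ib: "i < length ?\<beta>" using i by simp
    have "bij_betw (\<lambda>(z, A). (A[i := A ! i - {f}], z)) (W1 i) (SIGMA A:D ?\<beta>. A ! i)"
    proof (rule bij_betw_byWitness[where f' = "\<lambda>(A, z). (z, A[i := insert f (A ! i)])"])
      show "\<forall>p\<in>W1 i. (\<lambda>(A, z). (z, A[i := insert f (A ! i)])) ((\<lambda>(z, A). (A[i := A ! i - {f}], z)) p) = p"
        using i dtuplesD(1)[OF inW] by (auto simp: W1_def insert_absorb)
      show "\<forall>p\<in>SIGMA A:D ?\<beta>. A ! i.
          (\<lambda>(z, A). (A[i := A ! i - {f}], z)) ((\<lambda>(A, z). (z, A[i := insert f (A ! i)])) p) = p"
      proof
        fix p assume "p \<in> (SIGMA A:D ?\<beta>. A ! i)"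
        then obtain A z where p: "p = (A, z)" "A \<in> D ?\<beta>" by blast
        from p(2) have "length A = ?k" "A ! i \<subseteq> S"
          using dtuplesD(1)[of A S ?\<beta>] dtuplesD(2)[of A S ?\<beta>] i by (auto simp: D_def)
        moreover from this have "f \<notin> A ! i" using f by blast
        ultimately show "(\<lambda>(z, A). (A[i := A ! i - {f}], z)) ((\<lambda>(A, z). (z, A[i := insert f (A ! i)])) p) = p"
          using i p(1) by simp
      qed
      show "(\<lambda>(z, A). (A[i := A ! i - {f}], z)) ` W1 i \<subseteq> (SIGMA A:D ?\<beta>. A ! i)"
      proof (rule image_subsetI)
        fix p assume "p \<in> W1 i"
        then obtain z A where p: "p = (z, A)" "(z, A) \<in> W" "f \<in> A ! i" "z \<in> A ! i" by (auto simp: W1_def)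
        note A = inW[OF p(2)]
        have z: "z \<in> S" "z \<noteq> f" using p(2) f by (auto simp: W_def)
        have "insert z (A ! i - {f}) = A ! i - {f}" using z p(4) by blast
        then have sep: "tuple_sep v (A[i := A ! i - {f}])" using W_iff[OF i p(3)] p(2) by simp
        have "A[i := A ! i - {f}] \<in> dtuples S ?\<beta>"
        proof (rule dtuples_updateI[OF A i])
          show "A ! i - {f} \<subseteq> S" using dtuplesD(2)[OF A i] by blast
          show "card (A ! i - {f}) = b" using dtuplesD(3)[OF A i] p(3) Suc by simp
          show "A ! l \<subseteq> S \<and> (A ! i - {f}) \<inter> A ! l = {}" if "l < ?k" "l \<noteq> i" for l
            using dtuplesD(2)[OF A that(1)] dtuplesD(4)[OF A that(1) i that(2)] p(3) by blast
        qed
        then show "(\<lambda>(z, A). (A[i := A ! i - {f}], z)) p \<in> (SIGMA A:D ?\<beta>. A ! i)"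
          using sep p z i dtuplesD(1)[OF A] by (simp add: D_def)
      qed
      show "(\<lambda>(A, z). (z, A[i := insert f (A ! i)])) ` (SIGMA A:D ?\<beta>. A ! i) \<subseteq> W1 i"
      proof (rule image_subsetI)
        fix p assume "p \<in> (SIGMA A:D ?\<beta>. A ! i)"
        then obtain A z where p: "p = (A, z)" "A \<in> dtuples S ?\<beta>" "tuple_sep v A" "z \<in> A ! i"
          by (auto simp: D_def)
        note A = p(2)
        have len: "length A = ?k" using dtuplesD(1)[OF A] by simp
        have Ai: "A ! i \<subseteq> S" "card (A ! i) = b" "f \<notin> A ! i"
          using dtuplesD(2,3)[OF A ib] i f by auto
        have "A[i := insert f (A ! i)] \<in> dtuples ?S' (?\<beta>[i := Suc b])"
        proof (rule dtuples_updateI[OF A ib])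
          show "insert f (A ! i) \<subseteq> ?S'" using Ai by blast
          show "card (insert f (A ! i)) = Suc b" using Ai S finite_subset by (metis card_insert_disjoint)
          show "A ! l \<subseteq> ?S' \<and> insert f (A ! i) \<inter> A ! l = {}" if "l < length ?\<beta>" "l \<noteq> i" for l
            using dtuplesD(2)[OF A that(1)] dtuplesD(4)[OF A that(1) ib that(2)] f by blast
        qed
        moreover have "?\<beta>[i := Suc b] = \<alpha>" using Suc by (metis list_update_id list_update_overwrite)
        ultimately have mem: "A[i := insert f (A ! i)] \<in> dtuples ?S' \<alpha>" by simp
        have "insert z (insert f (A ! i) - {f}) = A ! i" using Ai(3) p(4) by blast
        then show "(\<lambda>(A, z). (z, A[i := insert f (A ! i)])) p \<in> W1 i"
          using W_iff[OF i, of "A[i := insert f (A ! i)]" z] mem p Ai len i by (auto simp: W1_def)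
      qed
    qed
    then have "card (W1 i) = card (SIGMA A:D ?\<beta>. A ! i)" by (rule bij_betw_same_card)
    also have "\<dots> = (\<Sum>A\<in>D ?\<beta>. card (A ! i))"
      by (rule card_SigmaI[OF finD]) (use finA[OF _ ib] in \<open>simp add: D_def\<close>)
    also have "\<dots> = b * card (D ?\<beta>)"
    proof -
      have "card (A ! i) = b" if "A \<in> D ?\<beta>" for A
        using that dtuplesD(3)[of A S ?\<beta> i] i by (simp add: D_def)
      then show ?thesis by simp
    qed
    finally show ?thesis using Suc by simp
  qed
  moreover have "card (W2 i) = \<alpha> ! i * card (D \<alpha>)" if i: "i < ?k" for i
  proof -
    have "bij_betw (\<lambda>(z, A). (A[i := insert z (A ! i - {f})], z)) (W2 i) (SIGMA A:D \<alpha>. A ! i)"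
    proof (rule bij_betw_byWitness[where f' = "\<lambda>(A, z). (z, A[i := insert f (A ! i - {z})])"])
      show "\<forall>p\<in>W2 i. (\<lambda>(A, z). (z, A[i := insert f (A ! i - {z})]))
          ((\<lambda>(z, A). (A[i := insert z (A ! i - {f})], z)) p) = p"
      proof
        fix p assume "p \<in> W2 i"
        then obtain z A where p: "p = (z, A)" "(z, A) \<in> W2 i" by (cases p) auto
        from p(2) have "(z, A) \<in> W" "f \<in> A ! i" "z \<notin> A ! i" by (auto simp: W2_def)
        moreover from this have "insert f (insert z (A ! i - {f}) - {z}) = A ! i" by blast
        ultimately show "(\<lambda>(A, z). (z, A[i := insert f (A ! i - {z})]))
            ((\<lambda>(z, A). (A[i := insert z (A ! i - {f})], z)) p) = p"
          using dtuplesD(1)[OF inW] i p(1) by simp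
      qed
      show "\<forall>p\<in>SIGMA A:D \<alpha>. A ! i. (\<lambda>(z, A). (A[i := insert z (A ! i - {f})], z))
          ((\<lambda>(A, z). (z, A[i := insert f (A ! i - {z})])) p) = p"
      proof
        fix p assume "p \<in> (SIGMA A:D \<alpha>. A ! i)"
        then obtain A z where p: "p = (A, z)" and Az: "A \<in> D \<alpha>" "z \<in> A ! i" by blast
        from Az(1) have "length A = ?k" "A ! i \<subseteq> S"
          using dtuplesD(1)[of A S \<alpha>] dtuplesD(2)[of A S \<alpha>] i by (auto simp: D_def)
        moreover from this have "insert z (insert f (A ! i - {z}) - {f}) = A ! i" using f Az(2) by blast
        ultimately show "(\<lambda>(z, A). (A[i := insert z (A ! i - {f})], z))
            ((\<lambda>(A, z). (z, A[i := insert f (A ! i - {z})])) p) = p"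
          using i p by simp
      qed
      show "(\<lambda>(z, A). (A[i := insert z (A ! i - {f})], z)) ` W2 i \<subseteq> (SIGMA A:D \<alpha>. A ! i)"
      proof (rule image_subsetI)
        fix p assume "p \<in> W2 i"
        then obtain z A where p: "p = (z, A)" "(z, A) \<in> W" "f \<in> A ! i" "z \<notin> A ! i" by (auto simp: W2_def)
        note A = inW[OF p(2)]
        have z: "z \<in> S" using p(2) by (simp add: W_def)
        have sep: "tuple_sep v (A[i := insert z (A ! i - {f})])" using W_iff[OF i p(3)] p(2) by simp
        have "A[i := insert z (A ! i - {f})] \<in> dtuples S (\<alpha>[i := \<alpha> ! i])"
        proof (rule dtuples_updateI[OF A i])
          show "insert z (A ! i - {f}) \<subseteq> S" using dtuplesD(2)[OF A i] z by blast
          have "finite (A ! i)" using dtuplesD(2)[OF A i] by (rule finY)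
          then show "card (insert z (A ! i - {f})) = \<alpha> ! i"
            using dtuplesD(3)[OF A i] p(3,4) card_Suc_Diff1 by fastforce
          show "A ! l \<subseteq> S \<and> insert z (A ! i - {f}) \<inter> A ! l = {}" if "l < ?k" "l \<noteq> i" for l
          proof -
            have "f \<notin> A ! l" using dtuplesD(4)[OF A that(1) i that(2)] p(3) by blast
            \<comment> \<open>A priori \<open>z\<close> could belong to another part, but then the
              collapsed tuple would have two intersecting parts and could not be separated.\<close>
            moreover have "insert z (A ! i - {f}) \<inter> A ! l = {}"
              using tuple_sep_disjoint[OF sep, of i l] dtuplesD(1)[OF A] that i by simp
            ultimately show ?thesis using dtuplesD(2)[OF A that(1)] by blast
          qed
        qed
        then show "(\<lambda>(z, A). (A[i := insert z (A ! i - {f})], z)) p \<in> (SIGMA A:D \<alpha>. A ! i)"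
          using sep p i dtuplesD(1)[OF A] by (simp add: D_def)
      qed
      show "(\<lambda>(A, z). (z, A[i := insert f (A ! i - {z})])) ` (SIGMA A:D \<alpha>. A ! i) \<subseteq> W2 i"
      proof (rule image_subsetI)
        fix p assume "p \<in> (SIGMA A:D \<alpha>. A ! i)"
        then obtain A z where p: "p = (A, z)" "A \<in> dtuples S \<alpha>" "tuple_sep v A" "z \<in> A ! i"
          by (auto simp: D_def)
        note A = p(2)
        have len: "length A = ?k" using dtuplesD(1)[OF A] by simp
        have Ai: "A ! i \<subseteq> S" "card (A ! i) = \<alpha> ! i" "f \<notin> A ! i" "finite (A ! i)"
          using dtuplesD(2,3)[OF A i] f S finite_subset by auto
        have "A[i := insert f (A ! i - {z})] \<in> dtuples ?S' (\<alpha>[i := \<alpha> ! i])"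
        proof (rule dtuples_updateI[OF A i])
          show "insert f (A ! i - {z}) \<subseteq> ?S'" using Ai by blast
          show "card (insert f (A ! i - {z})) = \<alpha> ! i"
            using Ai p(4) card_Suc_Diff1 by fastforce
          show "A ! l \<subseteq> ?S' \<and> insert f (A ! i - {z}) \<inter> A ! l = {}" if "l < ?k" "l \<noteq> i" for l
            using dtuplesD(2)[OF A that(1)] dtuplesD(4)[OF A that(1) i that(2)] f by blast
        qed
        then have mem: "A[i := insert f (A ! i - {z})] \<in> dtuples ?S' \<alpha>" by simp
        have "insert z (insert f (A ! i - {z}) - {f}) = A ! i" using Ai(3) p(4) by blast
        moreover have "z \<noteq> f" "z \<in> S" using Ai p(4) by auto
        ultimately show "(\<lambda>(A, z). (z, A[i := insert f (A ! i - {z})])) p \<in> W2 i"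
          using W_iff[OF i, of "A[i := insert f (A ! i - {z})]" z] mem p len i by (simp add: W2_def)
      qed
    qed
    then have "card (W2 i) = card (SIGMA A:D \<alpha>. A ! i)" by (rule bij_betw_same_card)
    also have "\<dots> = (\<Sum>A\<in>D \<alpha>. card (A ! i))"
      by (rule card_SigmaI[OF finD]) (use finA[OF _ i] in \<open>simp add: D_def\<close>)
    also have "\<dots> = \<alpha> ! i * card (D \<alpha>)"
    proof -
      have "card (A ! i) = \<alpha> ! i" if "A \<in> D \<alpha>" for A
        using that dtuplesD(3)[of A S \<alpha> i] i by (simp add: D_def)
      then show ?thesis by simp
    qed
    finally show ?thesis .
  qed
  moreover have "sum_list \<alpha> = (\<Sum>i<?k. \<alpha> ! i)"
    by (simp add: sum_list_sum_nth atLeast0LessThan)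
  ultimately show ?thesis
    by (simp add: W_def algebra_simps sum_distrib_left sum_distrib_right)
qed

lemma sepcount_insert:
  assumes S: "finite S" "S \<noteq> {}" and f: "f \<notin> S" and \<pi>: "\<pi> permutes S"
  shows "sepcount (insert f S) \<pi> \<alpha> = (card S + sum_list \<alpha>) * sepcount S \<pi> \<alpha>
    + (\<Sum>i<length \<alpha>. (\<alpha> ! i - 1) * sepcount S \<pi> (\<alpha>[i := \<alpha> ! i - 1]))"
proof -
  let ?S' = "insert f S"
  have S': "finite ?S'" using S by simp
  note fin = finite_cyclic_perms[OF S(1)] S(1) finite_dtuples[OF S(1)] finite_dtuples[OF S']
  have sc: "sepcount S \<pi> \<beta> = (\<Sum>c\<in>cyclic_perms S. card {A \<in> dtuples S \<beta>. tuple_sep (\<pi> \<circ> c) A})" for \<beta>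
    unfolding sepcount_def by (rule card_Collect_pairs_fst[OF fin(1,3)])
  have "sepcount ?S' \<pi> \<alpha> = (\<Sum>A\<in>dtuples ?S' \<alpha>. card {c \<in> cyclic_perms ?S'. tuple_sep (\<pi> \<circ> c) A})"
    unfolding sepcount_def by (rule card_Collect_pairs_snd[OF finite_cyclic_perms[OF S'] fin(4)])
  also have "\<dots> = (\<Sum>A\<in>dtuples ?S' \<alpha>. \<Sum>c\<in>cyclic_perms S.
      card {z \<in> S. tuple_sep (\<pi> \<circ> c) (map ((`) (id(f := z))) A)})"
  proof (rule sum.cong[OF refl])
    fix A
    have iff: "tuple_sep (\<pi> \<circ> (c \<circ> Transposition.transpose f z)) A
        \<longleftrightarrow> tuple_sep (\<pi> \<circ> c) (map ((`) (id(f := z))) A)" if "c \<in> cyclic_perms S" for c z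
    proof -
      have c: "c permutes S" using that by (rule cyclic_permsD)
      have "inj (\<pi> \<circ> c)" using permutes_inj[OF c] permutes_inj[OF \<pi>] by (intro inj_compose)
      moreover have "(\<pi> \<circ> c) f = f" using f permutes_not_in[OF c] permutes_not_in[OF \<pi>] by simp
      ultimately show ?thesis unfolding comp_assoc[symmetric] by (rule tuple_sep_comp_transpose)
    qed
    have "card {c \<in> cyclic_perms ?S'. tuple_sep (\<pi> \<circ> c) A}
      = card {(c, z). c \<in> cyclic_perms S \<and> z \<in> S \<and> tuple_sep (\<pi> \<circ> (c \<circ> Transposition.transpose f z)) A}"
      unfolding card_Collect_bij_betw[OF bij_betw_cyclic_perms_insert[OF f S(2)]]
      by (rule arg_cong[of _ _ card]) auto
    also have "\<dots> = (\<Sum>c\<in>cyclic_perms S. card {z \<in> S. tuple_sep (\<pi> \<circ> (c \<circ> Transposition.transpose f z)) A})"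
      by (rule card_Collect_pairs_fst[OF fin(1,2)])
    finally show "card {c \<in> cyclic_perms ?S'. tuple_sep (\<pi> \<circ> c) A}
      = (\<Sum>c\<in>cyclic_perms S. card {z \<in> S. tuple_sep (\<pi> \<circ> c) (map ((`) (id(f := z))) A)})"
      using iff by simp
  qed
  also have "\<dots> = (\<Sum>c\<in>cyclic_perms S. card {(z, A). z \<in> S \<and> A \<in> dtuples ?S' \<alpha> \<and>
      tuple_sep (\<pi> \<circ> c) (map ((`) (id(f := z))) A)})"
    unfolding card_Collect_pairs_snd[OF fin(2,4)] by (rule sum.swap)
  also have "\<dots> = (card S + sum_list \<alpha>) * sepcount S \<pi> \<alpha>
    + (\<Sum>i<length \<alpha>. (\<alpha> ! i - 1) * sepcount S \<pi> (\<alpha>[i := \<alpha> ! i - 1]))"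
    unfolding card_tuple_sep_insert[OF S(1) f] sc sum.distrib sum_distrib_left
    by (rule arg_cong[of _ _ "(+) _"]) (rule sum.swap)
  finally show ?thesis .
qed

section \<open>Solving the recursion\<close>

text \<open>With \<open>Q = M + r - p - 1\<close> and \<open>L = M - 2\<close>, Pascal's rule on the
  left reduces the claim to \<open>Suc L * (Q choose Suc L) = (Suc r - p) * (Q choose L)\<close>.
  This is the induction step of the closed form below, taken at \<open>M = N + d\<close>.\<close>

lemma binomial_three_term:
  fixes M r p :: nat
  assumes "2 \<le> M" "p < M"
  shows "Suc r * ((M + r - p) choose (M - 1))
    = (M + r) * ((M + r - p - 1) choose (M - 1)) + p * ((M + r - p - 1) choose (M - 2))"
proof -
  define Q where "Q = M + r - p - 1"
  obtain L where M: "M = Suc (Suc L)" using assms(1) by (metis add_2_eq_Suc le_Suc_ex)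
  have Q: "M + r - p = Suc Q" "Q - L = Suc r - p" using assms(2) by (auto simp: Q_def M)
  have absorb: "Suc L * (Q choose Suc L) = (Suc r - p) * (Q choose L)"
    using binomial_absorption[of L Q] binomial_absorb_comp[of Q L] unfolding Q(2) by simp
  have "Suc r * (Q choose L) = p * (Q choose L) + (Suc r - p) * (Q choose L)"
  proof (cases "p \<le> Suc r")
    case True
    then have "Suc r = p + (Suc r - p)" by simp
    then show ?thesis by (metis add_mult_distrib)
  next
    \<comment> \<open>Here \<open>Suc r - p\<close> is truncated to \<open>0\<close>, which is
      harmless because \<open>Q choose L\<close> vanishes too.\<close>
    case False
    then have "Q < L" using assms(2) by (simp add: Q_def M)
    then show ?thesis by (simp add: binomial_eq_0)
  qed
  then have "Suc r * (Suc Q choose Suc L) = (Suc (Suc L) + r) * (Q choose Suc L) + p * (Q choose L)"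
    using absorb by (simp add: algebra_simps)
  then show ?thesis unfolding Q(1) by (simp add: M)
qed

text \<open>Unfolding the recursion gives a sum over paths, in which \<open>p\<close> is the number
  of times the second summand is taken, each time lowering \<open>d\<close> by one; the coefficient
  of \<open>U 0 (d - p)\<close> is the total weight of these paths. The proof verifies the closed
  form by induction on \<open>r\<close>.\<close>

lemma binomial_recursion_solution:
  fixes U :: "nat \<Rightarrow> nat \<Rightarrow> nat"
  assumes rec: "\<And>r d. r < R \<Longrightarrow> U (Suc r) d = (N + d + r) * U r d + d * U r (d - 1)" and N: "2 \<le> N"
    and r: "r \<le> R"
  shows "U r d = (\<Sum>p\<le>d. fact r * ((N + d + r - p - 1) choose (N + d - 1)) * (d choose p) * U 0 (d - p))"
  using r
proof (induction r arbitrary: d)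
  case 0
  have "(\<Sum>p\<le>d. fact 0 * ((N + d + 0 - p - 1) choose (N + d - 1)) * (d choose p) * U 0 (d - p))
    = (\<Sum>p\<le>d. if p = 0 then U 0 d else 0)"
    using N by (intro sum.cong) (auto simp: binomial_eq_0)
  then show ?case by simp
next
  case (Suc r)
  define c where "c d p = fact r * ((N + d + r - p - 1) choose (N + d - 1)) * (d choose p)" for d p
  \<comment> \<open>The contribution of \<open>d * U r (d - 1)\<close>, with its summation index
    shifted by one so that both summands carry \<open>U 0 (d - p)\<close>.\<close>
  define e where "e d p = (if p = 0 then 0 else d * c (d - 1) (p - 1))" for d p
  have IH: "U r d = (\<Sum>p\<le>d. c d p * U 0 (d - p))" for d
    using Suc by (simp add: c_def)
  have "d * U r (d - 1) = (\<Sum>p\<le>d. e d p * U 0 (d - p))"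
  proof (cases d)
    case (Suc b)
    then show ?thesis unfolding IH sum_distrib_left by (simp add: sum.atMost_Suc_shift e_def algebra_simps del: sum.atMost_Suc)
  qed (simp add: e_def)
  then have "U (Suc r) d = (\<Sum>p\<le>d. ((N + d + r) * c d p + e d p) * U 0 (d - p))"
    using rec Suc.prems by (simp add: IH sum_distrib_left sum.distrib algebra_simps)
  also have "\<dots> = (\<Sum>p\<le>d. fact (Suc r) * ((N + d + Suc r - p - 1) choose (N + d - 1)) * (d choose p) * U 0 (d - p))"
  proof (rule sum.cong[OF refl])
    fix p assume "p \<in> {..d}"
    then have p: "p \<le> d" by simp
    have e: "e d p = fact r * (d choose p) * (p * ((N + d + r - p - 1) choose (N + d - 2)))"
    proof (cases p)
      case (Suc q)
      have absorb: "d * ((d - 1) choose q) = p * (d choose p)"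
        using binomial_absorption[of q d] Suc by simp
      have "N + (d - 1) + r - q - 1 = N + d + r - p - 1" "N + (d - 1) - 1 = N + d - 2"
        using p Suc N by auto
      then have "e d p = fact r * (d * ((d - 1) choose q)) * ((N + d + r - p - 1) choose (N + d - 2))"
        unfolding e_def c_def using Suc by simp
      then show ?thesis unfolding absorb by (simp only: mult_ac)
    qed (simp add: e_def)
    have "(N + d + r) * c d p + e d p = fact r * (d choose p) * ((N + d + r) * ((N + d + r - p - 1) choose (N + d - 1))
        + p * ((N + d + r - p - 1) choose (N + d - 2)))"
      unfolding e c_def by (simp add: algebra_simps)
    also have "\<dots> = fact r * (d choose p) * (Suc r * ((N + d + r - p) choose (N + d - 1)))"
      using N p by (subst binomial_three_term) auto
    also have "\<dots> = fact (Suc r) * ((N + d + Suc r - p - 1) choose (N + d - 1)) * (d choose p)"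
      by (simp add: algebra_simps)
    finally show "((N + d + r) * c d p + e d p) * U 0 (d - p)
      = fact (Suc r) * ((N + d + Suc r - p - 1) choose (N + d - 1)) * (d choose p) * U 0 (d - p)"
      by simp
  qed
  finally show ?case .
qed

text \<open>A part equal to one enters with weight \<open>\<alpha> ! i - 1 = 0\<close>, so only the
  head is ever lowered and the hook shape persists. For \<open>d = 0\<close> the truncated
  \<open>d - 1\<close> is \<open>0\<close> again, but its coefficient vanishes.\<close>

lemma sepcount_hook_insert:
  assumes S: "finite S" "S \<noteq> {}" and f: "f \<notin> S" and \<pi>: "\<pi> permutes S" and k: "1 \<le> k"
  shows "sepcount (insert f S) \<pi> (Suc d # replicate (k - 1) 1)
    = (card S + k + d) * sepcount S \<pi> (Suc d # replicate (k - 1) 1)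
      + d * sepcount S \<pi> (Suc (d - 1) # replicate (k - 1) 1)"
proof -
  let ?\<alpha> = "Suc d # replicate (k - 1) 1"
  have "(\<Sum>i<length ?\<alpha>. (?\<alpha> ! i - 1) * sepcount S \<pi> (?\<alpha>[i := ?\<alpha> ! i - 1]))
    = d * sepcount S \<pi> (d # replicate (k - 1) 1)"
    by (simp add: sum.lessThan_Suc_shift del: sum.lessThan_Suc)
  also have "\<dots> = d * sepcount S \<pi> (Suc (d - 1) # replicate (k - 1) 1)" by (cases d) auto
  finally have sum: "(\<Sum>i<length ?\<alpha>. (?\<alpha> ! i - 1) * sepcount S \<pi> (?\<alpha>[i := ?\<alpha> ! i - 1]))
    = d * sepcount S \<pi> (Suc (d - 1) # replicate (k - 1) 1)" .
  have size: "card S + sum_list ?\<alpha> = card S + k + d" using k by (simp add: sum_list_replicate)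
  show ?thesis unfolding sepcount_insert[OF S f \<pi>] sum size by (rule refl)
qed

text \<open>Symmetry is invoked once, over the full set \<open>S \<union> F\<close>, to replace
  \<open>\<alpha>\<close> by its hook. The points of \<open>F\<close> are then added in the order of
  a list, and the closed form is used with \<open>N = card S + k\<close> and
  \<open>d = m - k\<close>, so that \<open>N + d = card S + m\<close>.\<close>

lemma sepcount_fixed_points:
  fixes \<alpha> :: "nat list"
  assumes S: "finite S" "S \<noteq> {}" and \<pi>: "\<pi> permutes S" and F: "finite F" "F \<inter> S = {}"
    and \<alpha>: "\<alpha> \<noteq> []" "\<forall>a\<in>set \<alpha>. 1 \<le> a"
  defines "m \<equiv> sum_list \<alpha>" and "k \<equiv> length \<alpha>"
  shows "sepcount (S \<union> F) \<pi> \<alpha> = (\<Sum>p = 0..m - k. fact (card F)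
    * ((card S + m + card F - p - 1) choose (card S + m - 1)) * ((m - k) choose p)
    * sepcount S \<pi> ((m - k - p + 1) # replicate (k - 1) 1))"
proof -
  have k: "1 \<le> k" using \<alpha>(1) by (cases \<alpha>) (auto simp: k_def)
  have cS: "1 \<le> card S" using S by (simp add: Suc_le_eq card_gt_0_iff)
  have km: "k \<le> m" using \<alpha>(2) unfolding k_def m_def by (induction \<alpha>) auto
  obtain xs where xs: "set xs = F" "distinct xs" using finite_distinct_list[OF F(1)] by blast
  then have len: "length xs = card F" using distinct_card by metis
  define U where "U r d = sepcount (S \<union> set (take r xs)) \<pi> (Suc d # replicate (k - 1) 1)" for r d
  have perm: "\<pi> permutes S \<union> X" for X using \<pi> by (rule permutes_subset) simp
  have "U (Suc r) d = (card S + k + d + r) * U r d + d * U r (d - 1)" if r: "r < card F" for r d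
  proof -
    let ?S = "S \<union> set (take r xs)"
    have new: "xs ! r \<notin> ?S"
    proof -
      have "xs ! r \<in> F" using r xs(1) len by (metis nth_mem)
      moreover have "xs ! r \<notin> set (take r xs)"
        using r xs(2) len by (auto simp: in_set_conv_nth nth_eq_iff_index_eq)
      ultimately show ?thesis using F(2) by blast
    qed
    have "set (take r xs) \<subseteq> F" using xs(1) set_take_subset by fast
    then have "card ?S = card S + card (set (take r xs))"
      using S F by (intro card_Un_disjoint) auto
    moreover have "card (set (take r xs)) = r"
      using r xs(2) len by (simp add: distinct_card)
    ultimately have card: "card ?S = card S + r" by simp
    have "S \<union> set (take (Suc r) xs) = insert (xs ! r) ?S"
      using r len by (simp add: take_Suc_conv_app_nth)
    then show ?thesis
      using sepcount_hook_insert[OF _ _ new perm k, of d] S card unfolding U_def by (simp add: add_ac)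
  qed
  then have "U (card F) (m - k) = (\<Sum>p\<le>m - k. fact (card F)
    * ((card S + k + (m - k) + card F - p - 1) choose (card S + k + (m - k) - 1)) * ((m - k) choose p) * U 0 (m - k - p))"
    using k cS by (intro binomial_recursion_solution[where R = "card F"]) simp_all
  moreover have "sepcount (S \<union> F) \<pi> \<alpha> = U (card F) (m - k)"
    using sepcount_symmetric[OF _ perm \<alpha>, of F] S F by (simp add: U_def xs len[symmetric] m_def k_def)
  ultimately show ?thesis using km by (simp add: U_def atLeast0AtMost)
qed

section \<open>From counts to probabilities\<close>

lemma orbit_subset_invariant: "x \<in> U \<Longrightarrow> v ` U = U \<Longrightarrow> orbit v x \<subseteq> U"
proof
  fix y assume "x \<in> U" "v ` U = U" "y \<in> orbit v x"
  from this(3,1,2) show "y \<in> U" by (induction rule: orbit.induct) auto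
qed

lemma image_orbit:
  assumes "permutation v"
  shows "v ` orbit v x = orbit v x"
proof -
  have sub: "v ` orbit v x \<subseteq> orbit v x" by (auto intro: orbit.step)
  have "finite (orbit v x)" using finite_orbit permutation_self_in_orbit[OF assms] by metis
  moreover have "card (v ` orbit v x) = card (orbit v x)"
    using bij_is_inj[OF permutation_bijective[OF assms]] by (meson card_image inj_on_subset subset_UNIV)
  ultimately show ?thesis using sub by (intro card_subset_eq) auto
qed

lemma cyclic_perms_iff_orbit:
  assumes "finite S"
  shows "c \<in> cyclic_perms S \<longleftrightarrow> c permutes S \<and> S \<noteq> {} \<and> (\<forall>x\<in>S. orbit c x = S)"
proof
  assume c: "c \<in> cyclic_perms S"
  then have p: "c permutes S" by (rule cyclic_permsD)
  then have "permutation c" using assms permutation_permutes by blast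
  then have "orbit c x = S" if "x \<in> S" for x
    using cyclic_perms_invariantD[OF c permutes_orbit_subset[OF p that] image_orbit] orbit_nonempty by metis
  then show "c permutes S \<and> S \<noteq> {} \<and> (\<forall>x\<in>S. orbit c x = S)"
    using p cyclic_perms_nonempty[OF c] by blast
next
  assume c: "c permutes S \<and> S \<noteq> {} \<and> (\<forall>x\<in>S. orbit c x = S)"
  show "c \<in> cyclic_perms S"
  proof (rule cyclic_permsI)
    fix U assume U: "U \<subseteq> S" "c ` U = U"
    show "U = {} \<or> U = S"
    proof (cases "U = {}")
      case False
      then obtain x where x: "x \<in> U" by blast
      then show ?thesis using orbit_subset_invariant[OF x U(2)] U(1) c by blast
    qed simp
  qed (use c in auto)
qed

text \<open>The union of the orbits through \<open>A ! i\<close> serves as the separating invariant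
  set; conversely, an orbit that meets an invariant set lies inside it.\<close>

lemma cycle_separated_iff:
  assumes v: "v permutes {1..N}" and A: "\<And>i. i < length A \<Longrightarrow> A ! i \<subseteq> {1..N}"
  shows "cycle_separated N A v \<longleftrightarrow> tuple_sep v A"
proof
  have perm: "permutation v" using v permutation_permutes by blast
  assume sep: "cycle_separated N A v"
  have "sep_by v (A ! i) (A ! j)" if ij: "i < length A" "j < length A" "i \<noteq> j" for i j
  proof (rule sep_byI)
    show "v ` (\<Union>x\<in>A ! i. orbit v x) = (\<Union>x\<in>A ! i. orbit v x)"
      by (simp add: image_UN image_orbit[OF perm])
    show "A ! i \<subseteq> (\<Union>x\<in>A ! i. orbit v x)"
      using permutation_self_in_orbit[OF perm] by blast
    have False if "x \<in> A ! i" "y \<in> A ! j" "y \<in> orbit v x" for x y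
    proof -
      have "orbit v x \<in> cycle_sets N v" using A[OF ij(1)] that(1) by (auto simp: cycle_sets_def)
      moreover have "x \<in> orbit v x \<inter> A ! i" "y \<in> orbit v x \<inter> A ! j"
        using that permutation_self_in_orbit[OF perm, of x] by simp_all
      ultimately show False
        using sep ij unfolding cycle_separated_def by (metis empty_iff)
    qed
    then show "A ! j \<inter> (\<Union>x\<in>A ! i. orbit v x) = {}" by blast
  qed
  then show "tuple_sep v A" by (simp add: tuple_sep_def)
next
  assume sep: "tuple_sep v A"
  show "cycle_separated N A v"
    unfolding cycle_separated_def
  proof (intro ballI allI impI)
    have perm: "permutation v" using v permutation_permutes by blast
    fix C i j assume C: "C \<in> cycle_sets N v" "i < length A" "j < length A" "C \<inter> A ! i \<noteq> {}" "C \<inter> A ! j \<noteq> {}"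
    obtain x0 where x0: "C = orbit v x0" using C(1) by (auto simp: cycle_sets_def)
    obtain x y where xy: "x \<in> orbit v x0" "x \<in> A ! i" "y \<in> orbit v x0" "y \<in> A ! j"
      using C(4,5) x0 by blast
    have "orbit v x = orbit v x0"
      using cyclic_on_orbit'[OF perm] xy(1) by (rule orbit_cyclic_eq3)
    then have y: "y \<in> orbit v x" using xy(3) by simp
    show "i = j"
    proof (rule ccontr)
      assume "i \<noteq> j"
      then have "sep_by v (A ! i) (A ! j)" using sep C(2,3) unfolding tuple_sep_def by simp
      then obtain U where "v ` U = U" "A ! i \<subseteq> U" "A ! j \<inter> U = {}"
        unfolding sep_by_def by (elim exE conjE)
      then show False using orbit_subset_invariant[of x U v] xy y by blast
    qed
  qed
qed

lemma disjoint_tuples_eq_dtuples: "disjoint_tuples N \<beta> = dtuples {1..N} \<beta>"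
  by (simp add: disjoint_tuples_def dtuples_def)

lemma Union_cycle_sets: "v permutes {1..N} \<Longrightarrow> \<Union> (cycle_sets N v) = {1..N}"
  using permutes_orbit_subset[of v "{1..N}"] permutation_self_in_orbit[of v] permutation_permutes
  by (fastforce simp: cycle_sets_def)

lemma perms_of_type_cycle:
  assumes "1 \<le> N"
  shows "perms_of_type {#N#} = cyclic_perms {1..N}"
proof -
  have "cycle_type N v = {#N#} \<longleftrightarrow> (\<forall>x\<in>{1..N}. orbit v x = {1..N})" if v: "v permutes {1..N}" for v
  proof
    assume type: "cycle_type N v = {#N#}"
    then have "size (cycle_type N v) = 1" by simp
    then have "card (cycle_sets N v) = 1" by (simp add: cycle_type_def)
    then obtain C where C: "cycle_sets N v = {C}" by (rule card_1_singletonE)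
    then have "C = {1..N}" using Union_cycle_sets[OF v] by simp
    then show "\<forall>x\<in>{1..N}. orbit v x = {1..N}" using C unfolding cycle_sets_def by blast
  next
    assume "\<forall>x\<in>{1..N}. orbit v x = {1..N}"
    then have "cycle_sets N v = {{1..N}}" using assms by (auto simp: cycle_sets_def)
    then show "cycle_type N v = {#N#}" by (simp add: cycle_type_def)
  qed
  then show ?thesis
    using assms by (auto simp: perms_of_type_def cyclic_perms_iff_orbit)
qed

section \<open>Conjugacy of long cycles\<close>

lemma cycle_of_list_in_cyclic_perms:
  assumes cs: "distinct cs" "cs \<noteq> []"
  shows "cycle_of_list cs \<in> cyclic_perms (set cs)"
proof -
  let ?f = "cycle_of_list cs"
  have len: "0 < length cs" using cs(2) by simp
  have f: "?f permutes set cs" by (rule cycle_permutes)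
  have perm: "permutation ?f" by (rule permutation_of_cycle)
  have pow: "(?f ^^ i) (cs ! 0) = cs ! i" if "i < length cs" for i
    using arg_cong[OF cyclic_rotation[OF cs(1), of i], of "\<lambda>l. l ! 0"] len that
    by (simp add: nth_rotate)
  have "set cs \<subseteq> orbit ?f (cs ! 0)"
  proof
    fix x assume "x \<in> set cs"
    then obtain i where "i < length cs" "x = cs ! i" by (metis in_set_conv_nth)
    then have "x = (?f ^^ i) (cs ! 0)" using pow by simp
    then show "x \<in> orbit ?f (cs ! 0)" unfolding orbit_altdef_permutation[OF perm] by blast
  qed
  then have eq: "orbit ?f (cs ! 0) = set cs"
    using permutes_orbit_subset[OF f nth_mem[OF len]] by blast
  have "orbit ?f x = set cs" if "x \<in> set cs" for x
    using orbit_cyclic_eq3[OF cyclic_on_orbit'[OF perm, of "cs ! 0"]] that eq by blast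
  then show ?thesis using f cs(2) by (simp add: cyclic_perms_iff_orbit)
qed

lemma cyclic_perms_cycle_of_list:
  assumes "finite S" "c \<in> cyclic_perms S"
  obtains cs where "distinct cs" "set cs = S" "c = cycle_of_list cs"
proof -
  have c: "c permutes S" "S \<noteq> {}" "\<And>x. x \<in> S \<Longrightarrow> orbit c x = S"
    using assms by (simp_all add: cyclic_perms_iff_orbit)
  then have perm: "permutation c" using assms(1) permutation_permutes by blast
  obtain x where x: "x \<in> S" using c(2) by blast
  let ?cs = "support c x"
  have set: "set ?cs = S"
    unfolding support_set[OF perm] c(3)[OF x, symmetric] orbit_altdef_permutation[OF perm] by auto
  have "c y = cycle_of_list ?cs y" for y
  proof (cases "y \<in> S")
    case True
    then show ?thesis using cycle_restrict[OF perm, of y x] set by simp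
  next
    case False
    then show ?thesis using permutes_not_in[OF c(1)] id_outside_supp[of y ?cs] set by simp
  qed
  then show thesis using that[of ?cs] cycle_of_permutation[OF perm] set by blast
qed

lemma ex_permutes_map:
  assumes "distinct xs" "distinct ys" "set xs = S" "set ys = S"
  shows "\<exists>\<tau>. \<tau> permutes S \<and> map \<tau> xs = ys"
proof -
  have len: "length xs = length ys" using assms distinct_card by metis
  define \<tau> where "\<tau> x = (if x \<in> S then the (map_of (zip xs ys) x) else x)" for x
  have nth: "\<tau> (xs ! i) = ys ! i" if "i < length xs" for i
    using map_of_zip_nth[OF len assms(1)] that len assms(3) by (auto simp: \<tau>_def)
  have map: "map \<tau> xs = ys" by (rule nth_equalityI) (use len nth in auto)
  then have "\<tau> ` S = S" using assms by (metis set_map)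
  then have "bij_betw \<tau> S S" using assms(3) by (auto simp: bij_betw_def intro: eq_card_imp_inj_on)
  then have "\<tau> permutes S" by (rule bij_imp_permutes) (simp add: \<tau>_def)
  then show ?thesis using map by blast
qed

text \<open>Write both permutations as cycles of lists; a permutation that carries one list to the
  other conjugates the first into the second.\<close>

lemma cyclic_perms_conj:
  assumes S: "finite S" and c: "c \<in> cyclic_perms S" "d \<in> cyclic_perms S"
  obtains \<tau> where "\<tau> permutes S" "d = \<tau> \<circ> c \<circ> inv \<tau>"
proof -
  obtain xs where xs: "distinct xs" "set xs = S" "c = cycle_of_list xs"
    using cyclic_perms_cycle_of_list[OF S c(1)] by blast
  obtain ys where ys: "distinct ys" "set ys = S" "d = cycle_of_list ys"
    using cyclic_perms_cycle_of_list[OF S c(2)] by blast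
  obtain \<tau> where \<tau>: "\<tau> permutes S" "map \<tau> xs = ys"
    using ex_permutes_map[OF xs(1) ys(1) xs(2) ys(2)] by blast
  then have "d = \<tau> \<circ> c \<circ> inv \<tau>"
    using conjugation_of_cycle[OF xs(1) permutes_bij[OF \<tau>(1)]] xs(3) ys(3) by simp
  then show thesis using that \<tau>(1) by blast
qed

lemma sep_by_conj:
  fixes \<tau> :: "'a \<Rightarrow> 'a"
  assumes "bij \<tau>"
  shows "sep_by (\<tau> \<circ> v \<circ> inv \<tau>) (\<tau> ` X) (\<tau> ` Y) \<longleftrightarrow> sep_by v X Y"
proof
  have inj: "inj \<tau>" and id: "inv \<tau> ` \<tau> ` U = U" "\<tau> ` inv \<tau> ` U = U" for U
    using assms by (simp_all add: bij_is_inj bij_is_surj image_inv_f_f image_f_inv_f)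
  show "sep_by v X Y" if sep: "sep_by (\<tau> \<circ> v \<circ> inv \<tau>) (\<tau> ` X) (\<tau> ` Y)"
  proof -
    obtain U where U: "(\<tau> \<circ> v \<circ> inv \<tau>) ` U = U" "\<tau> ` X \<subseteq> U" "\<tau> ` Y \<inter> U = {}"
      using sep unfolding sep_by_def by (elim exE conjE)
    define V where "V = inv \<tau> ` U"
    have UV: "U = \<tau> ` V" by (simp add: V_def id)
    have "\<tau> ` v ` V = \<tau> ` V" using U(1) unfolding UV image_comp[symmetric] id .
    then have "v ` V = V" using inj by (simp add: inj_image_eq_iff)
    moreover have "X \<subseteq> V" "Y \<inter> V = {}" using U(2,3) inj unfolding UV by (auto simp: inj_image_subset_iff)
    ultimately show ?thesis by (rule sep_byI)
  qed
  show "sep_by (\<tau> \<circ> v \<circ> inv \<tau>) (\<tau> ` X) (\<tau> ` Y)" if sep: "sep_by v X Y"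
  proof -
    obtain V where V: "v ` V = V" "X \<subseteq> V" "Y \<inter> V = {}"
      using sep unfolding sep_by_def by (elim exE conjE)
    have "(\<tau> \<circ> v \<circ> inv \<tau>) ` \<tau> ` V = \<tau> ` V" unfolding image_comp[symmetric] id V(1) ..
    then show ?thesis
      by (rule sep_byI) (use V inj image_Int[OF inj, of Y V] in auto)
  qed
qed

lemma bij_betw_dtuples_map:
  assumes "\<tau> permutes S"
  shows "bij_betw (map ((`) \<tau>)) (dtuples S \<beta>) (dtuples S \<beta>)"
proof (rule bij_betw_byWitness[where f' = "map ((`) (inv \<tau>))"])
  have closed: "map ((`) \<sigma>) ` dtuples S \<beta> \<subseteq> dtuples S \<beta>" if \<sigma>: "\<sigma> permutes S" for \<sigma>
  proof (rule image_subsetI)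
    fix A assume A: "A \<in> dtuples S \<beta>"
    have "\<sigma> ` (A ! i) \<subseteq> S" "card (\<sigma> ` (A ! i)) = \<beta> ! i" if "i < length \<beta>" for i
      using dtuplesD(2,3)[OF A that] permutes_in_image[OF \<sigma>] card_image[OF permutes_inj_on[OF \<sigma>]] by auto
    moreover have "\<sigma> ` (A ! i) \<inter> \<sigma> ` (A ! j) = {}" if "i < length \<beta>" "j < length \<beta>" "i \<noteq> j" for i j
      using dtuplesD(4)[OF A that] image_Int[OF permutes_inj[OF \<sigma>], of "A ! i" "A ! j"] by simp
    ultimately show "map ((`) \<sigma>) A \<in> dtuples S \<beta>"
      using dtuplesD(1)[OF A] by (simp add: dtuples_def)
  qed
  show "map ((`) \<tau>) ` dtuples S \<beta> \<subseteq> dtuples S \<beta>" by (rule closed[OF assms])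
  show "map ((`) (inv \<tau>)) ` dtuples S \<beta> \<subseteq> dtuples S \<beta>" by (rule closed[OF permutes_inv[OF assms]])
  show "\<forall>A\<in>dtuples S \<beta>. map ((`) (inv \<tau>)) (map ((`) \<tau>) A) = A"
    using permutes_inj[OF assms] by (simp add: image_inv_f_f comp_def)
  show "\<forall>A\<in>dtuples S \<beta>. map ((`) \<tau>) (map ((`) (inv \<tau>)) A) = A"
    using permutes_surj[OF assms] by (simp add: image_f_inv_f comp_def)
qed

lemma card_tuple_sep_conj:
  assumes "\<tau> permutes S"
  shows "card {A \<in> dtuples S \<beta>. tuple_sep (\<tau> \<circ> v \<circ> inv \<tau>) A} = card {A \<in> dtuples S \<beta>. tuple_sep v A}"
proof -
  have "tuple_sep (\<tau> \<circ> v \<circ> inv \<tau>) (map ((`) \<tau>) A) \<longleftrightarrow> tuple_sep v A" for A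
    using sep_by_conj[OF permutes_bij[OF assms]] by (simp add: tuple_sep_def)
  then show ?thesis
    using card_Collect_bij_betw[OF bij_betw_dtuples_map[OF assms], where P = "tuple_sep (\<tau> \<circ> v \<circ> inv \<tau>)"]
    by simp
qed

lemma conj_comp:
  assumes "\<tau> permutes S"
  shows "(\<tau> \<circ> f \<circ> inv \<tau>) \<circ> (\<tau> \<circ> g \<circ> inv \<tau>) = \<tau> \<circ> (f \<circ> g) \<circ> inv \<tau>"
  using permutes_inverses(2)[OF assms] by (simp add: fun_eq_iff)

lemma bij_betw_conj:
  assumes \<tau>: "\<tau> permutes S" and "\<And>\<sigma> f. \<sigma> permutes S \<Longrightarrow> f \<in> X \<Longrightarrow> \<sigma> \<circ> f \<circ> inv \<sigma> \<in> X"
  shows "bij_betw (\<lambda>f. \<tau> \<circ> f \<circ> inv \<tau>) X X"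
proof (rule bij_betw_byWitness[where f' = "\<lambda>f. inv \<tau> \<circ> f \<circ> inv (inv \<tau>)"])
  have inv: "inv \<tau> permutes S" using \<tau> by (rule permutes_inv)
  show "(\<lambda>f. \<tau> \<circ> f \<circ> inv \<tau>) ` X \<subseteq> X" using assms by blast
  show "(\<lambda>f. inv \<tau> \<circ> f \<circ> inv (inv \<tau>)) ` X \<subseteq> X" using assms(2)[OF inv] by blast
qed (simp_all add: fun_eq_iff permutes_inverses[OF \<tau>] permutes_inv_inv[OF \<tau>])

lemma cyclic_perms_conj_closed:
  assumes S: "finite S" and \<sigma>: "\<sigma> permutes S" and c: "c \<in> cyclic_perms S"
  shows "\<sigma> \<circ> c \<circ> inv \<sigma> \<in> cyclic_perms S"
proof -
  obtain cs where cs: "distinct cs" "set cs = S" "c = cycle_of_list cs"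
    using cyclic_perms_cycle_of_list[OF S c] by blast
  have "\<sigma> \<circ> c \<circ> inv \<sigma> = cycle_of_list (map \<sigma> cs)"
    unfolding cs(3) by (rule conjugation_of_cycle[OF cs(1) permutes_bij[OF \<sigma>]])
  moreover have "distinct (map \<sigma> cs)" "set (map \<sigma> cs) = S"
    using cs permutes_inj_on[OF \<sigma>] permutes_image[OF \<sigma>] by (simp_all add: distinct_map)
  moreover have "cs \<noteq> []" using cs(2) cyclic_perms_nonempty[OF c] by auto
  ultimately show ?thesis using cycle_of_list_in_cyclic_perms[of "map \<sigma> cs"] by simp
qed

lemma sepcount_eq_sum:
  assumes "finite S"
  shows "sepcount S \<pi> \<beta> = (\<Sum>c\<in>cyclic_perms S. card {A \<in> dtuples S \<beta>. tuple_sep (\<pi> \<circ> c) A})"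
  unfolding sepcount_def by (rule card_Collect_pairs_fst[OF finite_cyclic_perms[OF assms] finite_dtuples[OF assms]])

lemma sepcount_conj:
  assumes S: "finite S" and \<tau>: "\<tau> permutes S"
  shows "sepcount S (\<tau> \<circ> \<pi> \<circ> inv \<tau>) \<beta> = sepcount S \<pi> \<beta>"
proof -
  have "bij_betw (\<lambda>c. \<tau> \<circ> c \<circ> inv \<tau>) (cyclic_perms S) (cyclic_perms S)"
    using \<tau> by (rule bij_betw_conj) (rule cyclic_perms_conj_closed[OF S])
  then have "sepcount S (\<tau> \<circ> \<pi> \<circ> inv \<tau>) \<beta> = (\<Sum>c\<in>cyclic_perms S.
      card {A \<in> dtuples S \<beta>. tuple_sep ((\<tau> \<circ> \<pi> \<circ> inv \<tau>) \<circ> (\<tau> \<circ> c \<circ> inv \<tau>)) A})"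
    unfolding sepcount_eq_sum[OF S] by (rule sum.reindex_bij_betw[symmetric])
  then show ?thesis
    unfolding conj_comp[OF \<tau>] card_tuple_sep_conj[OF \<tau>] sepcount_eq_sum[OF S] .
qed

section \<open>Separated pairs and separation probabilities in terms of
  \<open>sepcount\<close>\<close>

text \<open>A conjugation that carries the standard long cycle to another one permutes the class of
  type \<open>\<mu>\<close> and the tuples, so each of the \<open>fact (sum_mset \<mu> - 1)\<close>
  long cycles contributes the same number of pairs.\<close>

lemma card_separated_pairs:
  assumes "1 \<le> sum_mset \<mu>"
  shows "fact (sum_mset \<mu> - 1) * card (separated_pairs \<mu> \<beta>) = (\<Sum>\<pi>\<in>perms_of_type \<mu>. sepcount {1..sum_mset \<mu>} \<pi> \<beta>)"
proof -
  let ?N = "sum_mset \<mu>" and ?S = "{1..sum_mset \<mu>}" and ?C = "perms_of_type \<mu>"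
  define c0 where "c0 = cycle_of_list [1..<Suc ?N]"
  define G where "G \<pi> c = card {A \<in> dtuples ?S \<beta>. tuple_sep (\<pi> \<circ> c) A}" for \<pi> c :: "nat \<Rightarrow> nat"
  have "set [1..<Suc ?N] = ?S" by auto
  then have c0: "c0 \<in> cyclic_perms ?S"
    unfolding c0_def using cycle_of_list_in_cyclic_perms[of "[1..<Suc ?N]"] assms by simp
  have iff: "cycle_separated ?N A (\<pi> \<circ> c0) \<longleftrightarrow> tuple_sep (\<pi> \<circ> c0) A"
    if "\<pi> \<in> ?C" "A \<in> dtuples ?S \<beta>" for \<pi> A
  proof (rule cycle_separated_iff)
    show "\<pi> \<circ> c0 permutes ?S" using that cyclic_permsD[OF c0] by (auto simp: perms_of_type_def intro: permutes_compose)
  qed (use dtuplesD(1,2)[OF that(2)] in auto)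
  have "separated_pairs \<mu> \<beta> = {(\<pi>, A). \<pi> \<in> ?C \<and> A \<in> dtuples ?S \<beta> \<and> tuple_sep (\<pi> \<circ> c0) A}"
  proof -
    have "(\<pi>, A) \<in> separated_pairs \<mu> \<beta> \<longleftrightarrow> \<pi> \<in> ?C \<and> A \<in> dtuples ?S \<beta> \<and> tuple_sep (\<pi> \<circ> c0) A" for \<pi> A
      unfolding separated_pairs_def disjoint_tuples_eq_dtuples c0_def[symmetric] mem_Collect_eq case_prod_conv
      using iff[of \<pi> A] by blast
    then show ?thesis by (intro set_eqI) (simp only: split_paired_all mem_Collect_eq case_prod_conv)
  qed
  then have pairs: "card (separated_pairs \<mu> \<beta>) = (\<Sum>\<pi>\<in>?C. G \<pi> c0)"
    unfolding G_def by (simp only: card_Collect_pairs_fst[OF finite_perms_of_type finite_dtuples[OF finite_atLeastAtMost]])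
  have "(\<Sum>\<pi>\<in>?C. G \<pi> c) = (\<Sum>\<pi>\<in>?C. G \<pi> c0)" if c: "c \<in> cyclic_perms ?S" for c
  proof -
    obtain \<tau> where \<tau>: "\<tau> permutes ?S" "c = \<tau> \<circ> c0 \<circ> inv \<tau>"
      using cyclic_perms_conj[OF finite_atLeastAtMost c0 c] by blast
    have "(\<Sum>\<pi>\<in>?C. G \<pi> c) = (\<Sum>\<pi>\<in>?C. G (\<tau> \<circ> \<pi> \<circ> inv \<tau>) c)"
      by (rule sum.reindex_bij_betw[OF perms_of_type_conj[OF \<tau>(1)], symmetric])
    then show ?thesis unfolding \<tau>(2) G_def conj_comp[OF \<tau>(1)] card_tuple_sep_conj[OF \<tau>(1)] .
  qed
  then have "(\<Sum>c\<in>cyclic_perms ?S. \<Sum>\<pi>\<in>?C. G \<pi> c) = card (cyclic_perms ?S) * card (separated_pairs \<mu> \<beta>)"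
    by (simp add: pairs)
  moreover have "card (cyclic_perms ?S) = fact (?N - 1)"
    using card_cyclic_perms[of ?S] assms by simp
  moreover have "(\<Sum>\<pi>\<in>?C. sepcount ?S \<pi> \<beta>) = (\<Sum>c\<in>cyclic_perms ?S. \<Sum>\<pi>\<in>?C. G \<pi> c)"
    unfolding sepcount_eq_sum[OF finite_atLeastAtMost] G_def by (rule sum.swap)
  ultimately show ?thesis by simp
qed

lemma pair_pmf_of_set:
  assumes "X \<noteq> {}" "Y \<noteq> {}" "finite Y" "finite X"
  shows "pair_pmf (pmf_of_set X) (pmf_of_set Y) = pmf_of_set (X \<times> Y)"
proof (rule pmf_eqI)
  fix p :: "'a \<times> 'b"
  obtain x y where p: "p = (x, y)" by (cases p)
  have "X \<times> Y \<noteq> {}" "finite (X \<times> Y)" using assms by auto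
  then show "pmf (pair_pmf (pmf_of_set X) (pmf_of_set Y)) p = pmf (pmf_of_set (X \<times> Y)) p"
    using assms by (simp add: p pmf_pair indicator_def card_cartesian_product)
qed

text \<open>The probability is the same for all tuples, hence equal to its mean over them.
  Exchanging the order of summation expresses this mean by \<open>sepcount\<close>, and the number
  of long cycles cancels.\<close>

lemma sep_prob_eq_card:
  assumes \<mu>: "0 \<notin># \<mu>" "\<mu> \<noteq> {#}" "1 \<le> sum_mset \<mu>" and ne: "dtuples {1..sum_mset \<mu>} \<beta> \<noteq> {}"
  shows "sep_prob \<mu> \<beta> = real (card (separated_pairs \<mu> \<beta>))
    / (real (card (dtuples {1..sum_mset \<mu>} \<beta>)) * real (card (perms_of_type \<mu>)))"
proof -
  let ?N = "sum_mset \<mu>" and ?S = "{1..sum_mset \<mu>}" and ?C = "perms_of_type \<mu>"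
  let ?K = "cyclic_perms ?S" and ?D = "dtuples ?S \<beta>"
  have K: "perms_of_type {#?N#} = ?K" using \<mu>(3) by (rule perms_of_type_cycle)
  have finK: "finite ?K" and finD: "finite ?D" by (simp_all add: finite_cyclic_perms finite_dtuples)
  have cardK: "card ?K = fact (?N - 1)" using card_cyclic_perms[of ?S] \<mu>(3) by simp
  then have neK: "?K \<noteq> {}" by (metis card.empty fact_nonzero)
  have neC: "?C \<noteq> {}" using \<mu>(1) by (rule perms_of_type_nonempty)
  have at: "sep_prob_at \<mu> A = card {(\<pi>, c). \<pi> \<in> ?C \<and> c \<in> ?K \<and> tuple_sep (\<pi> \<circ> c) A} / (card ?C * card ?K)"
    if A: "A \<in> ?D" for A
  proof -
    have pair: "pair_pmf (pmf_of_set ?C) (pmf_of_set ?K) = pmf_of_set (?C \<times> ?K)"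
      using neC neK finK finite_perms_of_type by (rule pair_pmf_of_set)
    have "sep_prob_at \<mu> A = card ((?C \<times> ?K) \<inter> {(\<pi>, \<rho>). cycle_separated ?N A (\<pi> \<circ> \<rho>)}) / card (?C \<times> ?K)"
      unfolding sep_prob_at_def K pair using neC neK finK finite_perms_of_type
      by (subst measure_pmf_of_set) auto
    also have "(?C \<times> ?K) \<inter> {(\<pi>, \<rho>). cycle_separated ?N A (\<pi> \<circ> \<rho>)}
      = {(\<pi>, c). \<pi> \<in> ?C \<and> c \<in> ?K \<and> tuple_sep (\<pi> \<circ> c) A}"
    proof -
      have "cycle_separated ?N A (\<pi> \<circ> c) \<longleftrightarrow> tuple_sep (\<pi> \<circ> c) A" if "\<pi> \<in> ?C" "c \<in> ?K" for \<pi> c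
      proof (rule cycle_separated_iff)
        show "\<pi> \<circ> c permutes ?S" using that cyclic_permsD[OF that(2)]
          by (auto simp: perms_of_type_def intro: permutes_compose)
      qed (use dtuplesD(1,2)[OF A] in auto)
      then show ?thesis by auto
    qed
    finally show ?thesis by (simp add: card_cartesian_product)
  qed
  have "card ?D * sep_prob \<mu> \<beta> = (\<Sum>A\<in>?D. sep_prob_at \<mu> A)"
  proof -
    have "sep_prob_at \<mu> A = sep_prob \<mu> \<beta>" if "A \<in> ?D" for A
      using sep_prob_eq[OF \<mu>(1,2)] that unfolding disjoint_tuples_eq_dtuples by simp
    then show ?thesis by simp
  qed
  also have "\<dots> = real (\<Sum>A\<in>?D. card {(\<pi>, c). \<pi> \<in> ?C \<and> c \<in> ?K \<and> tuple_sep (\<pi> \<circ> c) A}) / (card ?C * card ?K)"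
    using at by (simp add: sum_divide_distrib)
  also have "(\<Sum>A\<in>?D. card {(\<pi>, c). \<pi> \<in> ?C \<and> c \<in> ?K \<and> tuple_sep (\<pi> \<circ> c) A})
    = (\<Sum>\<pi>\<in>?C. \<Sum>c\<in>?K. card {A \<in> ?D. tuple_sep (\<pi> \<circ> c) A})"
  proof -
    have "(\<Sum>A\<in>?D. card {(\<pi>, c). \<pi> \<in> ?C \<and> c \<in> ?K \<and> tuple_sep (\<pi> \<circ> c) A})
      = (\<Sum>A\<in>?D. \<Sum>\<pi>\<in>?C. card {c \<in> ?K. tuple_sep (\<pi> \<circ> c) A})"
      by (simp only: card_Collect_pairs_fst[OF finite_perms_of_type finK])
    also have "\<dots> = (\<Sum>\<pi>\<in>?C. \<Sum>A\<in>?D. card {c \<in> ?K. tuple_sep (\<pi> \<circ> c) A})" by (rule sum.swap)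
    finally show ?thesis
      by (simp only: card_Collect_pairs_fst[OF finK finD, symmetric] card_Collect_pairs_snd[OF finK finD, symmetric])
  qed
  also have "\<dots> = fact (?N - 1) * card (separated_pairs \<mu> \<beta>)"
    unfolding card_separated_pairs[OF \<mu>(3)] by (simp add: sepcount_eq_sum)
  finally have "card ?D * sep_prob \<mu> \<beta> = card (separated_pairs \<mu> \<beta>) / card ?C"
    unfolding cardK by simp
  moreover have "card ?D \<noteq> 0" "card ?C \<noteq> 0" using ne finD neC finite_perms_of_type by simp_all
  ultimately show ?thesis by (simp add: field_simps)
qed

text \<open>The multinomial coefficient, with denominators cleared so that the induction stays in
  the naturals. The value \<open>0\<close> for oversized \<open>\<beta>\<close> is what
  \<open>separated_pairs_empty\<close> relies on.\<close>

lemma card_dtuples: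
  assumes "finite S"
  shows "card (dtuples S \<beta>) * ((\<Prod>b\<leftarrow>\<beta>. fact b) * fact (card S - sum_list \<beta>))
    = (if sum_list \<beta> \<le> card S then fact (card S) else 0)"
  using assms
proof (induction \<beta> arbitrary: S)
  case Nil
  have "dtuples S [] = {[]}" by (auto simp: dtuples_def)
  then show ?case by simp
next
  case (Cons b \<beta>)
  let ?X = "{Y. Y \<subseteq> S \<and> card Y = b}"
  have "bij_betw (\<lambda>(Y, A). Y # A) (SIGMA Y:?X. dtuples (S - Y) \<beta>) (dtuples S (b # \<beta>))"
  proof (rule bij_betw_byWitness[where f' = "\<lambda>A. (hd A, tl A)"])
    show "(\<lambda>(Y, A). Y # A) ` (SIGMA Y:?X. dtuples (S - Y) \<beta>) \<subseteq> dtuples S (b # \<beta>)"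
    proof (rule image_subsetI, clarify)
      fix Y A assume Y: "Y \<subseteq> S" "b = card Y" and A: "A \<in> dtuples (S - Y) \<beta>"
      show "Y # A \<in> dtuples S (card Y # \<beta>)"
        unfolding dtuples_def mem_Collect_eq
        using Y dtuplesD[OF A] by (auto simp: nth_Cons less_Suc_eq_0_disj split: nat.split; blast)
    qed
    show "(\<lambda>A. (hd A, tl A)) ` dtuples S (b # \<beta>) \<subseteq> (SIGMA Y:?X. dtuples (S - Y) \<beta>)"
    proof (rule image_subsetI)
      fix A assume A: "A \<in> dtuples S (b # \<beta>)"
      obtain Y As where As: "A = Y # As" using dtuplesD(1)[OF A] by (cases A) auto
      have "As ! i \<subseteq> S - Y" "card (As ! i) = \<beta> ! i" if "i < length \<beta>" for i
        using dtuplesD(2,3)[OF A, of "Suc i"] dtuplesD(4)[OF A, of 0 "Suc i"] that As by auto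
      moreover have "As ! i \<inter> As ! j = {}" if "i < length \<beta>" "j < length \<beta>" "i \<noteq> j" for i j
        using dtuplesD(4)[OF A, of "Suc i" "Suc j"] that As by auto
      ultimately show "(\<lambda>A. (hd A, tl A)) A \<in> (SIGMA Y:?X. dtuples (S - Y) \<beta>)"
        using dtuplesD(1)[OF A] dtuplesD(2,3)[OF A, of 0] As by (auto simp: dtuples_def)
    qed
    show "\<forall>A\<in>dtuples S (b # \<beta>). (\<lambda>(Y, A). Y # A) (hd A, tl A) = A"
      using dtuplesD(1)[of _ S "b # \<beta>"] by (metis case_prod_conv length_0_conv list.collapse list.distinct(1))
  qed auto
  then have "card (dtuples S (b # \<beta>)) = card (SIGMA Y:?X. dtuples (S - Y) \<beta>)"
    by (rule bij_betw_same_card[symmetric])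
  also have "\<dots> = (\<Sum>Y\<in>?X. card (dtuples (S - Y) \<beta>))"
    using Cons.prems by (intro card_SigmaI) (simp, blast intro: finite_dtuples)
  finally have "card (dtuples S (b # \<beta>)) * ((\<Prod>b\<leftarrow>\<beta>. fact b) * fact (card S - b - sum_list \<beta>))
      = (\<Sum>Y\<in>?X. card (dtuples (S - Y) \<beta>) * ((\<Prod>b\<leftarrow>\<beta>. fact b) * fact (card S - b - sum_list \<beta>)))"
    by (simp add: sum_distrib_right)
  also have "\<dots> = (\<Sum>Y\<in>?X. if sum_list \<beta> \<le> card S - b then fact (card S - b) else 0)"
  proof (rule sum.cong[OF refl])
    fix Y assume "Y \<in> ?X"
    then have "finite Y" "Y \<subseteq> S" "card Y = b" using Cons.prems finite_subset by auto
    then have "card (S - Y) = card S - b" by (simp add: card_Diff_subset)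
    then show "card (dtuples (S - Y) \<beta>) * ((\<Prod>b\<leftarrow>\<beta>. fact b) * fact (card S - b - sum_list \<beta>))
      = (if sum_list \<beta> \<le> card S - b then fact (card S - b) else 0)"
      using Cons.IH[of "S - Y"] Cons.prems by simp
  qed
  also have "\<dots> = (card S choose b) * (if sum_list \<beta> \<le> card S - b then fact (card S - b) else 0)"
    using Cons.prems by (simp add: n_subsets)
  finally have eq: "card (dtuples S (b # \<beta>)) * ((\<Prod>b\<leftarrow>\<beta>. fact b) * fact (card S - b - sum_list \<beta>))
    = (card S choose b) * (if sum_list \<beta> \<le> card S - b then fact (card S - b) else 0)" .
  have "card (dtuples S (b # \<beta>)) * ((\<Prod>b\<leftarrow>b # \<beta>. fact b) * fact (card S - sum_list (b # \<beta>)))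
    = fact b * ((card S choose b) * (if sum_list \<beta> \<le> card S - b then fact (card S - b) else 0))"
    unfolding eq[symmetric] by (simp add: mult_ac)
  also have "\<dots> = (if sum_list (b # \<beta>) \<le> card S then fact (card S) else 0)"
  proof (cases "b \<le> card S")
    case True
    have "fact b * ((card S choose b) * fact (card S - b)) = (fact (card S) :: nat)"
      using binomial_fact_lemma[OF True] by (simp add: mult_ac)
    then show ?thesis using True by auto
  qed (simp add: binomial_eq_0)
  finally show ?case .
qed

section \<open>Fixed points and cycle types\<close>

lemma card_fixed_points:
  assumes v: "v permutes {1..N}"
  shows "card {x \<in> {1..N}. v x = x} = count (cycle_type N v) 1"
proof -
  let ?C = "cycle_sets N v" and ?F = "{x \<in> {1..N}. v x = x}"
  have perm: "permutation v" using v permutation_permutes by blast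
  have fin: "finite ?C" by (simp add: cycle_sets_def)
  have "count (cycle_type N v) 1 = card {c \<in> ?C. card c = 1}"
  proof -
    have "card -` {1} \<inter> ?C = {c \<in> ?C. card c = 1}" by blast
    then show ?thesis using fin by (simp add: cycle_type_def count_image_mset)
  qed
  also have "{c \<in> ?C. card c = 1} = (\<lambda>x. {x}) ` ?F"
  proof (intro subset_antisym subsetI)
    fix c assume "c \<in> {c \<in> ?C. card c = 1}"
    then obtain x where x: "x \<in> {1..N}" "c = orbit v x" "card c = 1" by (auto simp: cycle_sets_def)
    have "x \<in> c" using permutation_self_in_orbit[OF perm] x(2) by simp
    then have c: "c = {x}" using x(3) by (metis card_1_singletonE singletonD)
    then have "v x = x" using x(2) orbit_eq_singleton_iff by metis
    then show "c \<in> (\<lambda>x. {x}) ` ?F" using c x(1) by blast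
  next
    fix c assume "c \<in> (\<lambda>x. {x}) ` ?F"
    then obtain x where x: "c = {x}" "x \<in> {1..N}" "v x = x" by blast
    then have "orbit v x = c" by (simp add: orbit_eq_singleton_iff)
    then show "c \<in> {c \<in> ?C. card c = 1}" using x by (auto simp: cycle_sets_def)
  qed
  also have "card \<dots> = card ?F" by (rule card_image) simp
  finally show ?thesis by simp
qed

lemma cycle_type_add_fixed_points:
  assumes v: "v permutes {1..n}"
  shows "cycle_type (n + r) v = cycle_type n v + replicate_mset r 1"
proof -
  let ?F = "{n + 1..n + r}"
  have split: "{1..n + r} = {1..n} \<union> ?F" by auto
  have "orbit v x = {x}" if "x \<in> ?F" for x
    using permutes_not_in[OF v] that by (simp add: orbit_eq_singleton_iff)
  then have eq: "cycle_sets (n + r) v = cycle_sets n v \<union> (\<lambda>x. {x}) ` ?F"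
    unfolding cycle_sets_def split image_Un by simp
  have "c \<subseteq> {1..n}" if "c \<in> cycle_sets n v" for c using Union_cycle_sets[OF v] that by blast
  then have disj: "cycle_sets n v \<inter> (\<lambda>x. {x}) ` ?F = {}" by fastforce
  have "image_mset card (mset_set ((\<lambda>x. {x}) ` ?F)) = image_mset (card \<circ> (\<lambda>x. {x})) (mset_set ?F)"
    by (simp add: image_mset_mset_set[symmetric] multiset.map_comp)
  also have "\<dots> = replicate_mset r 1"
    by (simp add: comp_def image_mset_const_eq)
  finally show ?thesis
    using disj unfolding cycle_type_def eq by (subst mset_set_Union) (auto simp: cycle_sets_def)
qed

text \<open>A permutation of \<open>{1..n}\<close> is, as the same function, a permutation of
  \<open>{1..n + r}\<close> that fixes the new points, so the two sets are literally equal. Since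
  \<open>lam\<close> has no part \<open>1\<close>, a permutation of type \<open>lam\<close> has no
  further fixed points in \<open>{1..n}\<close>.\<close>

lemma perms_of_type_fixed_points:
  assumes "\<forall>x \<in># lam. 2 \<le> x" and n: "sum_mset lam = n"
  shows "{\<pi> \<in> perms_of_type (lam + replicate_mset r 1). {x \<in> {1..n + r}. \<pi> x = x} = {n + 1..n + r}}
    = perms_of_type lam"
proof (intro subset_antisym subsetI)
  let ?F = "{n + 1..n + r}"
  fix \<pi> assume "\<pi> \<in> {\<pi> \<in> perms_of_type (lam + replicate_mset r 1). {x \<in> {1..n + r}. \<pi> x = x} = ?F}"
  then have \<pi>: "\<pi> permutes {1..n + r}" "cycle_type (n + r) \<pi> = lam + replicate_mset r 1"
    and fix_eq: "{x \<in> {1..n + r}. \<pi> x = x} = ?F"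
    using n by (auto simp: perms_of_type_def)
  have p: "\<pi> permutes {1..n}"
  proof (rule permutes_superset[OF \<pi>(1)])
    fix x assume "x \<in> {1..n + r} - {1..n}"
    then have "x \<in> ?F" by auto
    then show "\<pi> x = x" using fix_eq by blast
  qed
  then have "cycle_type n \<pi> = lam" using cycle_type_add_fixed_points[OF p, of r] \<pi>(2) by simp
  then show "\<pi> \<in> perms_of_type lam" using p n by (simp add: perms_of_type_def)
next
  let ?F = "{n + 1..n + r}"
  fix \<pi> assume "\<pi> \<in> perms_of_type lam"
  then have \<pi>: "\<pi> permutes {1..n}" "cycle_type n \<pi> = lam" using n by (auto simp: perms_of_type_def)
  have "count lam 1 = 0" using assms(1) by (auto simp: count_eq_zero_iff)
  then have "{x \<in> {1..n}. \<pi> x = x} = {}" using card_fixed_points[OF \<pi>(1)] \<pi>(2) by simp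
  moreover have "\<pi> x = x" if "x \<in> ?F" for x using permutes_not_in[OF \<pi>(1)] that by simp
  moreover have "{1..n + r} = {1..n} \<union> ?F" by auto
  ultimately have "{x \<in> {1..n + r}. \<pi> x = x} = ?F" by blast
  moreover have "\<pi> permutes {1..n + r}" using \<pi>(1) by (rule permutes_subset) simp
  ultimately show "\<pi> \<in> {\<pi> \<in> perms_of_type (lam + replicate_mset r 1). {x \<in> {1..n + r}. \<pi> x = x} = ?F}"
    using cycle_type_add_fixed_points[OF \<pi>(1), of r] \<pi>(2) n by (simp add: perms_of_type_def)
qed

text \<open>Group the permutations by their fixed points, which form an \<open>r\<close>-subset of
  \<open>{1..n + r}\<close>. Conjugation carries the standard subset to any other one and does not
  change \<open>g\<close>, so all groups have the same sum.\<close>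

lemma sum_perms_of_type_add_fixed_points:
  fixes g :: "(nat \<Rightarrow> nat) \<Rightarrow> nat"
  assumes lam: "\<forall>x \<in># lam. 2 \<le> x" and n: "sum_mset lam = n"
    and g: "\<And>\<tau> \<pi>. \<tau> permutes {1..n + r} \<Longrightarrow> g (\<tau> \<circ> \<pi> \<circ> inv \<tau>) = g \<pi>"
  shows "(\<Sum>\<pi>\<in>perms_of_type (lam + replicate_mset r 1). g \<pi>) = ((n + r) choose r) * (\<Sum>\<pi>\<in>perms_of_type lam. g \<pi>)"
proof -
  let ?C = "perms_of_type (lam + replicate_mset r 1)" and ?F0 = "{n + 1..n + r}"
  let ?X = "{F. F \<subseteq> {1..n + r} \<and> card F = r}"
  define Fx where "Fx \<pi> = {x \<in> {1..n + r}. \<pi> x = x}" for \<pi> :: "nat \<Rightarrow> nat"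
  have N: "sum_mset (lam + replicate_mset r 1) = n + r" using n by simp
  have C: "\<pi> permutes {1..n + r} \<and> cycle_type (n + r) \<pi> = lam + replicate_mset r 1" if "\<pi> \<in> ?C" for \<pi>
    using that n by (simp add: perms_of_type_def)
  have "count lam 1 = 0" using lam by (auto simp: count_eq_zero_iff)
  then have "Fx \<pi> \<in> ?X" if "\<pi> \<in> ?C" for \<pi>
    using C[OF that] card_fixed_points[of \<pi> "n + r"] by (auto simp: Fx_def)
  then have "(\<Sum>\<pi>\<in>?C. g \<pi>) = (\<Sum>F\<in>?X. \<Sum>\<pi>\<in>{\<pi> \<in> ?C. Fx \<pi> = F}. g \<pi>)"
    by (intro sum.group[symmetric] finite_perms_of_type) auto
  also have "\<dots> = (\<Sum>F\<in>?X. \<Sum>\<pi>\<in>perms_of_type lam. g \<pi>)"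
  proof (rule sum.cong[OF refl])
    fix F assume F: "F \<in> ?X"
    \<comment> \<open>Applied to tuples of length one, \<open>disjoint_tuples_transitive\<close>
      supplies a permutation that maps \<open>?F0\<close> onto \<open>F\<close>.\<close>
    have "[?F0] \<in> disjoint_tuples (n + r) [r]" "[F] \<in> disjoint_tuples (n + r) [r]"
      using F by (auto simp: disjoint_tuples_def)
    then obtain \<tau> where \<tau>: "\<tau> permutes {1..n + r}" "\<And>i. i < length [?F0] \<Longrightarrow> [F] ! i = \<tau> ` ([?F0] ! i)"
      using disjoint_tuples_transitive by blast
    have F_eq: "F = \<tau> ` ?F0" using \<tau>(2)[of 0] by simp
    have Fx_conj: "Fx (\<tau> \<circ> \<pi> \<circ> inv \<tau>) = \<tau> ` Fx \<pi>" for \<pi>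
    proof -
      have iff: "(\<tau> \<circ> \<pi> \<circ> inv \<tau>) (\<tau> x) = \<tau> x \<longleftrightarrow> \<pi> x = x" for x
        using permutes_inverses(2)[OF \<tau>(1)] permutes_inj[OF \<tau>(1)] by (simp add: inj_eq)
      have "y \<in> Fx (\<tau> \<circ> \<pi> \<circ> inv \<tau>) \<longleftrightarrow> y \<in> \<tau> ` Fx \<pi>" for y
      proof -
        obtain x where y: "y = \<tau> x" using permutes_surj[OF \<tau>(1)] by (metis surjD)
        show ?thesis
          unfolding y Fx_def inj_image_mem_iff[OF permutes_inj[OF \<tau>(1)]] mem_Collect_eq iff
          using permutes_in_image[OF \<tau>(1)] by blast
      qed
      then show ?thesis by blast
    qed
    have bij: "bij_betw (\<lambda>\<pi>. \<tau> \<circ> \<pi> \<circ> inv \<tau>) ?C ?C"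
      using perms_of_type_conj[of \<tau> "lam + replicate_mset r 1"] \<tau>(1) N by simp
    have "bij_betw (\<lambda>\<pi>. \<tau> \<circ> \<pi> \<circ> inv \<tau>) {\<pi> \<in> ?C. Fx \<pi> = ?F0} {\<pi> \<in> ?C. Fx \<pi> = F}"
    proof -
      have "Fx (\<tau> \<circ> \<pi> \<circ> inv \<tau>) = F \<longleftrightarrow> Fx \<pi> = ?F0" for \<pi>
        unfolding Fx_conj F_eq using permutes_inj[OF \<tau>(1)] by (simp add: inj_image_eq_iff)
      then show ?thesis using bij_betw_Collect[OF bij, of "\<lambda>f. Fx f = F"] by simp
    qed
    then have "(\<Sum>\<pi>\<in>{\<pi> \<in> ?C. Fx \<pi> = F}. g \<pi>) = (\<Sum>\<pi>\<in>{\<pi> \<in> ?C. Fx \<pi> = ?F0}. g (\<tau> \<circ> \<pi> \<circ> inv \<tau>))"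
      by (rule sum.reindex_bij_betw[symmetric])
    also have "\<dots> = (\<Sum>\<pi>\<in>perms_of_type lam. g \<pi>)"
      using g[OF \<tau>(1)] perms_of_type_fixed_points[OF lam n, of r] by (simp only: Fx_def)
    finally show "(\<Sum>\<pi>\<in>{\<pi> \<in> ?C. Fx \<pi> = F}. g \<pi>) = (\<Sum>\<pi>\<in>perms_of_type lam. g \<pi>)" .
  qed
  also have "\<dots> = ((n + r) choose r) * (\<Sum>\<pi>\<in>perms_of_type lam. g \<pi>)"
    by (simp add: n_subsets)
  finally show ?thesis .
qed

section \<open>The coefficients of the theorem\<close>

text \<open>For \<open>p \<le> r\<close> let \<open>L = n + m - 1\<close> and
  \<open>q = r - p\<close>. Multiplied by \<open>n + m\<close>, the two binomials on the left are
  \<open>n + m + q\<close> and \<open>q\<close> times \<open>(L + q) choose L\<close>, and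
  \<open>(n + p) * (n + m + q) + (m - p) * q = (n + m) * (n + r)\<close>. This identifies the
  bracket of the theorem with the coefficient that the recursion delivers.\<close>

lemma binomial_coefficient_identity:
  fixes n m r p :: nat
  assumes "1 \<le> n" "p \<le> m"
  shows "real (n + p) / real n * real ((n + m + r - p) choose (n + m))
      + real (m - p) / real n * real ((n + m + r - p - 1) choose (n + m))
    = real (n + r) / real n * real ((n + m + r - p - 1) choose (n + m - 1))"
proof (cases "p \<le> r")
  case True
  define q where "q = r - p"
  obtain L where L: "n + m = Suc L" using assms(1) by (cases "n + m") auto
  have r: "r = p + q" using True by (simp add: q_def)
  have eqs: "n + m + r - p = Suc (L + q)" "n + m + r - p - 1 = L + q" using L r by auto
  define b u w where "b = real ((L + q) choose L)" and "u = real (Suc (L + q) choose Suc L)"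
    and "w = real ((L + q) choose Suc L)"
  have "Suc L * (Suc (L + q) choose Suc L) = Suc (L + q) * ((L + q) choose L)"
    by (rule binomial_absorption[of L "Suc (L + q)", simplified diff_Suc_1])
  then have u: "real (Suc L) * u = real (Suc (L + q)) * b"
    unfolding b_def u_def by (metis of_nat_mult)
  have "Suc L * ((L + q) choose Suc L) = q * ((L + q) choose L)"
    using binomial_absorption[of L "L + q"] binomial_absorb_comp[of "L + q" L] by simp
  then have w: "real (Suc L) * w = real q * b"
    unfolding b_def w_def by (metis of_nat_mult)
  have nm: "real (Suc L) = real n + real m" using L by (metis of_nat_add)
  have nmq: "real (Suc (L + q)) = real n + real m + real q" using nm by simp
  have "real (Suc L) * (real (n + p) * u + real (m - p) * w)
    = real (n + p) * (real (Suc L) * u) + real (m - p) * (real (Suc L) * w)"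
    by (simp add: algebra_simps)
  also have "\<dots> = (real n + real m) * (real (n + r) * b)"
    unfolding u w nmq using assms(2) r by (simp add: of_nat_diff algebra_simps)
  finally have "real (n + p) * u + real (m - p) * w = real (n + r) * b"
    unfolding nm[symmetric] by (metis mult_left_cancel nat.distinct(1) of_nat_eq_0_iff)
  then show ?thesis
    unfolding eqs unfolding L diff_Suc_1 b_def u_def w_def
    by (simp add: add_divide_distrib[symmetric] del: binomial_Suc_Suc)
next
  case False
  then have "n + m + r - p < n + m" "n + m + r - p - 1 < n + m" "n + m + r - p - 1 < n + m - 1"
    using assms by auto
  then show ?thesis by (simp add: binomial_eq_0)
qed

lemma sum_mset_pos:
  fixes \<mu> :: "nat multiset"
  assumes "0 \<notin># \<mu>" "\<mu> \<noteq> {#}"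
  shows "1 \<le> sum_mset \<mu>"
proof -
  obtain x where "x \<in># \<mu>" using assms(2) by (rule multiset_nonemptyE)
  then have "sum_mset \<mu> \<noteq> 0" using assms(1) unfolding sum_mset_0_iff by metis
  then show ?thesis by linarith
qed

text \<open>The factor \<open>n\<close> on the left avoids division. It completes the collected
  factors \<open>fact r\<close>, \<open>fact (n - 1)\<close> and \<open>(n + r) choose r\<close> to
  \<open>fact (n + r)\<close>; cancelling \<open>fact (n + r - 1)\<close> leaves the factor
  \<open>n + r\<close> on the right.\<close>

lemma card_separated_pairs_add_fixed_points:
  fixes lam :: "nat multiset" and \<alpha> :: "nat list"
  assumes lam: "lam \<noteq> {#}" "\<forall>x \<in># lam. 2 \<le> x" and n: "sum_mset lam = n"
    and \<alpha>: "\<alpha> \<noteq> []" "\<forall>a \<in> set \<alpha>. 1 \<le> a"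
  defines "m \<equiv> sum_list \<alpha>" and "k \<equiv> length \<alpha>"
  shows "n * card (separated_pairs (lam + replicate_mset r 1) \<alpha>) = (n + r) *
    (\<Sum>p = 0..m - k. ((n + m + r - p - 1) choose (n + m - 1)) * ((m - k) choose p)
      * card (separated_pairs lam ((m - k - p + 1) # replicate (k - 1) 1)))"
proof -
  let ?mu = "lam + replicate_mset r 1" and ?F = "{n + 1..n + r}"
  let ?\<beta> = "\<lambda>p. (m - k - p + 1) # replicate (k - 1) 1"
  let ?a = "\<lambda>p. ((n + m + r - p - 1) choose (n + m - 1)) * ((m - k) choose p)"
  have n1: "1 \<le> n" using sum_mset_pos[of lam] lam n by fastforce
  have N: "sum_mset ?mu = n + r" using n by simp
  have un: "{1..n + r} = {1..n} \<union> ?F" by auto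
  have "fact (n + r - 1) * card (separated_pairs ?mu \<alpha>) = (\<Sum>\<pi>\<in>perms_of_type ?mu. sepcount {1..n + r} \<pi> \<alpha>)"
    using card_separated_pairs[of ?mu \<alpha>] n1 unfolding N by simp
  also have "\<dots> = ((n + r) choose r) * (\<Sum>\<pi>\<in>perms_of_type lam. sepcount {1..n + r} \<pi> \<alpha>)"
    by (rule sum_perms_of_type_add_fixed_points[OF lam(2) n]) (rule sepcount_conj, simp_all)
  also have "(\<Sum>\<pi>\<in>perms_of_type lam. sepcount {1..n + r} \<pi> \<alpha>)
    = (\<Sum>\<pi>\<in>perms_of_type lam. \<Sum>p = 0..m - k. fact r * ?a p * sepcount {1..n} \<pi> (?\<beta> p))"
  proof (rule sum.cong[OF refl])
    fix \<pi> assume "\<pi> \<in> perms_of_type lam"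
    then have "\<pi> permutes {1..n}" using n by (simp add: perms_of_type_def)
    then have "sepcount ({1..n} \<union> ?F) \<pi> \<alpha> = (\<Sum>p = 0..m - k. fact (card ?F)
      * ((card {1..n} + m + card ?F - p - 1) choose (card {1..n} + m - 1)) * ((m - k) choose p)
      * sepcount {1..n} \<pi> (?\<beta> p))"
      unfolding m_def k_def by (intro sepcount_fixed_points) (use n1 \<alpha> in auto)
    then show "sepcount {1..n + r} \<pi> \<alpha> = (\<Sum>p = 0..m - k. fact r * ?a p * sepcount {1..n} \<pi> (?\<beta> p))"
      unfolding un by (simp add: mult.assoc)
  qed
  also have "\<dots> = (\<Sum>p = 0..m - k. fact r * ?a p * (\<Sum>\<pi>\<in>perms_of_type lam. sepcount {1..n} \<pi> (?\<beta> p)))"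
    unfolding sum_distrib_left by (rule sum.swap)
  also have "\<dots> = (\<Sum>p = 0..m - k. fact r * ?a p * (fact (n - 1) * card (separated_pairs lam (?\<beta> p))))"
    using card_separated_pairs[of lam] n1 unfolding n by simp
  also have "\<dots> = fact r * fact (n - 1) * (\<Sum>p = 0..m - k. ?a p * card (separated_pairs lam (?\<beta> p)))"
    unfolding sum_distrib_left by (rule sum.cong) (simp_all only: mult_ac)
  finally have eq: "fact (n + r - 1) * card (separated_pairs ?mu \<alpha>) = ((n + r) choose r) * (fact r * fact (n - 1)
      * (\<Sum>p = 0..m - k. ?a p * card (separated_pairs lam (?\<beta> p))))" .
  have "fact (n + r - 1) * (n * card (separated_pairs ?mu \<alpha>))
    = (fact r * (n * fact (n - 1)) * ((n + r) choose r)) * (\<Sum>p = 0..m - k. ?a p * card (separated_pairs lam (?\<beta> p)))"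
    using arg_cong[OF eq, of "\<lambda>x. n * x"] by (simp only: mult_ac)
  also have "n * fact (n - 1) = fact n" using n1 by (simp add: fact_reduce)
  also have "fact r * fact n * ((n + r) choose r) = (fact (n + r) :: nat)"
    using binomial_fact_lemma[of r "n + r"] by simp
  also have "\<dots> = (n + r) * fact (n + r - 1)" using n1 by (simp add: fact_reduce)
  finally have "fact (n + r - 1) * (n * card (separated_pairs ?mu \<alpha>)) = fact (n + r - 1) * ((n + r) *
      (\<Sum>p = 0..m - k. ?a p * card (separated_pairs lam (?\<beta> p))))"
    by (simp only: mult_ac)
  then show ?thesis by (rule mult_left_cancel[OF fact_nonzero, THEN iffD1])
qed

lemma card_perms_of_type_add_fixed_points:
  assumes "\<forall>x \<in># lam. 2 \<le> x" "sum_mset lam = n"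
  shows "card (perms_of_type (lam + replicate_mset r 1)) = ((n + r) choose r) * card (perms_of_type lam)"
  using sum_perms_of_type_add_fixed_points[OF assms, of r "\<lambda>_. 1"] by simp

text \<open>The number of tuples times \<open>P\<close> is \<open>fact (sum_mset \<mu>)\<close>,
  which trades the multinomial coefficient for factorials. The size bound on \<open>\<beta>\<close>
  ensures that a tuple exists, so that \<open>sep_prob\<close> has its intended value.\<close>

lemma sep_prob_eq_fact:
  assumes \<mu>: "0 \<notin># \<mu>" "\<mu> \<noteq> {#}" "1 \<le> sum_mset \<mu>" and \<beta>: "sum_list \<beta> \<le> sum_mset \<mu>"
  shows "sep_prob \<mu> \<beta> = (\<Prod>b\<leftarrow>\<beta>. fact b) * fact (sum_mset \<mu> - sum_list \<beta>) * real (card (separated_pairs \<mu> \<beta>))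
    / (fact (sum_mset \<mu>) * real (card (perms_of_type \<mu>)))"
proof -
  let ?N = "sum_mset \<mu>" and ?d = "card (dtuples {1..sum_mset \<mu>} \<beta>)"
  define P where "P = (\<Prod>b\<leftarrow>\<beta>. fact b) * (fact (?N - sum_list \<beta>) :: real)"
  have prod: "real (\<Prod>b\<leftarrow>\<beta>. fact b) = (\<Prod>b\<leftarrow>\<beta>. fact b)" by (induction \<beta>) simp_all
  have "?d * ((\<Prod>b\<leftarrow>\<beta>. fact b) * fact (?N - sum_list \<beta>)) = fact ?N"
    using card_dtuples[of "{1..?N}" \<beta>] \<beta> by simp
  then have "real (?d * ((\<Prod>b\<leftarrow>\<beta>. fact b) * fact (?N - sum_list \<beta>))) = real (fact ?N)" by (rule arg_cong)
  then have dP: "real ?d * P = fact ?N"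
    unfolding of_nat_mult prod of_nat_fact P_def .
  have "real ?d * P \<noteq> 0" unfolding dP by simp
  then have "?d \<noteq> 0" and P: "P \<noteq> 0" by auto
  then have "dtuples {1..?N} \<beta> \<noteq> {}" by (metis card.empty)
  then have "sep_prob \<mu> \<beta> = real (card (separated_pairs \<mu> \<beta>)) / (real ?d * real (card (perms_of_type \<mu>)))"
    by (rule sep_prob_eq_card[OF \<mu>])
  also have "\<dots> = P * real (card (separated_pairs \<mu> \<beta>)) / (real ?d * P * real (card (perms_of_type \<mu>)))"
    using P by simp
  also have "\<dots> = P * real (card (separated_pairs \<mu> \<beta>)) / (fact ?N * real (card (perms_of_type \<mu>)))"
    unfolding dP by (rule refl)
  finally show ?thesis unfolding P_def .
qed

lemma separated_pairs_empty:
  assumes "sum_mset \<mu> < sum_list \<beta>"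
  shows "separated_pairs \<mu> \<beta> = {}"
proof -
  have "(\<Prod>b\<leftarrow>\<beta>. fact b) \<noteq> (0 :: nat)" by (induction \<beta>) simp_all
  then have "card (dtuples {1..sum_mset \<mu>} \<beta>) = 0"
    using card_dtuples[of "{1..sum_mset \<mu>}" \<beta>] assms by simp
  then have "dtuples {1..sum_mset \<mu>} \<beta> = {}" by (simp add: finite_dtuples)
  then show ?thesis by (simp add: separated_pairs_def disjoint_tuples_eq_dtuples)
qed

theorem theorem4p1:
  fixes lam :: "nat multiset" and \<alpha> :: "nat list" and n r m k :: nat
  assumes "lam \<noteq> {#}" and "\<forall>x \<in># lam. 2 \<le> x" and "sum_mset lam = n"
    and "length \<alpha> = k" and "1 \<le> k" and "\<forall>a \<in> set \<alpha>. 1 \<le> a"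
    and "sum_list \<alpha> = m" and "m \<le> n + r"
  shows "real (card (separated_pairs (lam + replicate_mset r 1) \<alpha>)) =
           (\<Sum>p = 0..m - k.
              (real (n + p) / real n * real ((n + m + r - p) choose (n + m))
               + real (m - p) / real n * real ((n + m + r - p - 1) choose (n + m)))
              * real ((m - k) choose p)
              * real (card (separated_pairs lam ((m - k - p + 1) # replicate (k - 1) 1))))
       \<and> sep_prob (lam + replicate_mset r 1) \<alpha> =
           fact n / (fact (n + r) / ((\<Prod>a\<leftarrow>\<alpha>. fact a) * fact (n + r - m)) * real ((n + r) choose r))
           * (\<Sum>p = 0..m - k.
              (real (n + p) / real n * real ((n + m + r - p) choose (n + m))
               + real (m - p) / real n * real ((n + m + r - p - 1) choose (n + m)))
              * real ((m - k) choose p)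
              * inv_fact (int n - int m + int p) * (1 / fact (m - k - p + 1))
              * sep_prob lam ((m - k - p + 1) # replicate (k - 1) 1))"
proof -
  let ?mu = "lam + replicate_mset r 1" and ?\<beta> = "\<lambda>p. (m - k - p + 1) # replicate (k - 1) 1"
  let ?c = "\<lambda>p. real (n + p) / real n * real ((n + m + r - p) choose (n + m))
    + real (m - p) / real n * real ((n + m + r - p - 1) choose (n + m))"
  have lam0: "0 \<notin># lam" using assms(2) by fastforce
  have n1: "1 \<le> n" using sum_mset_pos[OF lam0 assms(1)] assms(3) by simp
  have ne: "\<alpha> \<noteq> []" using assms(4,5) by auto
  have c: "?c p = real (n + r) / real n * real ((n + m + r - p - 1) choose (n + m - 1))" if "p \<in> {0..m - k}" for p
    using that n1 by (intro binomial_coefficient_identity) auto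
  have count: "real (card (separated_pairs ?mu \<alpha>)) =
    (\<Sum>p = 0..m - k. ?c p * real ((m - k) choose p) * real (card (separated_pairs lam (?\<beta> p))))"
  proof -
    have "real n * real (card (separated_pairs ?mu \<alpha>)) = real (n + r) *
      (\<Sum>p = 0..m - k. real ((n + m + r - p - 1) choose (n + m - 1)) * real ((m - k) choose p)
        * real (card (separated_pairs lam (?\<beta> p))))"
      using arg_cong[OF card_separated_pairs_add_fixed_points[OF assms(1-3) ne assms(6), of r], of real]
      unfolding assms(4,7) by (simp only: of_nat_mult of_nat_sum)
    then have "real (card (separated_pairs ?mu \<alpha>)) = real (n + r) / real n *
      (\<Sum>p = 0..m - k. real ((n + m + r - p - 1) choose (n + m - 1)) * real ((m - k) choose p)
        * real (card (separated_pairs lam (?\<beta> p))))"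
      using n1 by (simp add: field_simps)
    also have "\<dots> = (\<Sum>p = 0..m - k. ?c p * real ((m - k) choose p) * real (card (separated_pairs lam (?\<beta> p))))"
      unfolding sum_distrib_left by (rule sum.cong[OF refl]) (simp only: c mult.assoc)
    finally show ?thesis .
  qed
  define K where "K = real (card (perms_of_type lam))"
  have K: "K \<noteq> 0" using perms_of_type_nonempty[OF lam0] finite_perms_of_type by (simp add: K_def)
  \<comment> \<open>The two sums agree term by term up to \<open>fact n * K\<close>: the reciprocal
    factorials cancel against those in \<open>sep_prob_eq_fact\<close>, where the parts equal to
    \<open>1\<close> contribute only factors \<open>1\<close>.\<close>
  have term_eq: "?c p * real ((m - k) choose p) * inv_fact (int n - int m + int p) * (1 / fact (m - k - p + 1)) * sep_prob lam (?\<beta> p)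
    = ?c p * real ((m - k) choose p) * real (card (separated_pairs lam (?\<beta> p))) / (fact n * K)"
    if p: "p \<in> {0..m - k}" for p
  proof -
    have km: "k \<le> m" using assms(6) unfolding assms(4,7)[symmetric] by (induction \<alpha>) auto
    have size: "sum_list (?\<beta> p) = m - p" using p km assms(5) by (simp add: sum_list_replicate)
    have "inv_fact (int n - int m + int p) * (1 / fact (m - k - p + 1)) * sep_prob lam (?\<beta> p)
      = real (card (separated_pairs lam (?\<beta> p))) / (fact n * K)"
    proof (cases "m - p \<le> n")
      case True
      then have "int n - int m + int p = int (n - (m - p))" using p by auto
      then have "inv_fact (int n - int m + int p) = 1 / fact (n - (m - p))"
        by (simp only: inv_fact_def nat_int of_nat_less_0_iff if_False)
      moreover have "sep_prob lam (?\<beta> p) = fact (m - k - p + 1) * fact (n - (m - p))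
          * real (card (separated_pairs lam (?\<beta> p))) / (fact n * K)"
        using sep_prob_eq_fact[OF lam0 assms(1), of "?\<beta> p"] n1 True unfolding size assms(3) K_def by (simp del: fact_Suc)
      ultimately show ?thesis by (simp del: fact_Suc)
    next
      \<comment> \<open>The hook is larger than \<open>n\<close>, so its \<open>sep_prob\<close> is
        an unspecified number; it is removed by \<open>inv_fact\<close>, which is \<open>0\<close>
        at negative arguments, and there are no separated pairs either.\<close>
      case False
      then have "inv_fact (int n - int m + int p) = 0" by (simp add: inv_fact_def)
      moreover have "separated_pairs lam (?\<beta> p) = {}"
        using False assms(3) size by (intro separated_pairs_empty) simp
      ultimately show ?thesis by simp
    qed
    then show ?thesis by (simp only: mult.assoc times_divide_eq_right[symmetric])
  qed
  \<comment> \<open>\<open>fact (n + r) / P\<close> is the multinomial coefficient in the prefactor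
    of the statement.\<close>
  define P where "P = (\<Prod>a\<leftarrow>\<alpha>. fact a) * (fact (n + r - m) :: real)"
  have P: "P \<noteq> 0" unfolding P_def by (induction \<alpha>) auto
  have mu: "0 \<notin># ?mu" "?mu \<noteq> {#}" "sum_mset ?mu = n + r" using lam0 assms(1,3) by (auto split: if_splits)
  have "sep_prob ?mu \<alpha> = P * real (card (separated_pairs ?mu \<alpha>)) / (fact (n + r) * (real ((n + r) choose r) * K))"
    using sep_prob_eq_fact[OF mu(1,2), of \<alpha>] n1 assms(8) card_perms_of_type_add_fixed_points[OF assms(2,3), of r]
    unfolding mu(3) assms(7) P_def K_def by simp
  also have "\<dots> = fact n / (fact (n + r) / P * real ((n + r) choose r)) * (real (card (separated_pairs ?mu \<alpha>)) / (fact n * K))"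
    using P K by (simp add: field_simps)
  also have "real (card (separated_pairs ?mu \<alpha>)) / (fact n * K) = (\<Sum>p = 0..m - k.
      ?c p * real ((m - k) choose p) * inv_fact (int n - int m + int p) * (1 / fact (m - k - p + 1)) * sep_prob lam (?\<beta> p))"
    unfolding count sum_divide_distrib by (rule sum.cong[OF refl]) (rule term_eq[symmetric])
  finally show ?thesis using count unfolding P_def by blast
qed

end
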